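(* Let $\mathcal X$ be an infinite dimensional complex Banach space and let $A\in B(\mathcal X)$, with adjoint $A^*\in B(\mathcal X^* )$ on the dual space. Let $R_A\in B(B(\mathcal X))$ be the operator $R_A(T)=TA$. Then the following statements are equivalent: (i) $A^*$ satisfies generalized Weyl's theorem. (ii) $R_A$ satisfies generalized Weyl's theorem and $A$ satisfies Browder's theorem.
   Context: For a complex Banach space $\mathcal Z$, $B(\mathcal Z)$ is the Banach algebra of bounded linear operators on $\mathcal Z$. For $T\in B(\mathcal Z)$, $N(T)$, $R(T)$ and $\sigma(T)$ are the null space, range and spectrum; $T-\lambda$ means $T-\lambda I$; $\alpha(T)=\dim N(T)$, $\beta(T)=\dim \mathcal Z/R(T)$. $T$ is Fredholm if $\alpha(T),\beta(T)<\infty$, with index $\mathrm{ind}(T)=\alpha(T)-\beta(T)$; $T$ is Weyl if it is Fredholm of index $0$; $\sigma_w(T)=\{\lambda\in\mathbb C: T-\lambda \text{ is not Weyl}\}$. The ascent $\mathrm{asc}(T)$ (resp. descent $\mathrm{dsc}(T)$) is the smallest non-negative integer $n$ with $N(T^n)=N(T^{n+1})$ (resp. $R(T^n)=R(T^{n+1})$), or $\infty$ if none exists. $\Pi(T)=\{\lambda\in\mathbb C: \mathrm{asc}(T-\lambda)=\mathrm{dsc}(T-\lambda)<\infty\}$ and $\Pi_0(T)=\{\lambda\in\Pi(T):\alpha(T-\lambda)<\infty\}$. Browder's theorem holds for (is satisfied by) $T$ if $\sigma_w(T)=\sigma(T)\setminus\Pi_0(T)$. $T$ is B-Fredholm if for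 some $n\in\mathbb N$ the range $R(T^n)$ is closed and the induced operator $T_n=T|_{R(T^n)}\in B(R(T^n))$ is Fredholm; its index is $\mathrm{ind}(T)=\mathrm{ind}(T_n)$ (independent of such $n$). $T$ is B-Weyl if it is B-Fredholm of index $0$; $\sigma_{BW}(T)=\{\lambda\in\mathbb C: T-\lambda\text{ is not B-Weyl}\}$. For $K\subseteq \mathbb C$, $\mathrm{iso}\,K$ is the set of isolated points of $K$. $E(T)=\{\lambda\in\mathrm{iso}\,\sigma(T): 0<\alpha(T-\lambda)\}$. $T$ satisfies generalized Weyl's theorem if $\sigma_{BW}(T)=\sigma(T)\setminus E(T)$. *)

theory Defs
  imports "HOL-Analysis.Analysis"
begin

section \<open>Complex Banach spaces\<close>

text \<open>HOL-Analysis only has real normed spaces. A complex Banach space is rendered as a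
  real Banach space with a complex scalar multiplication that extends the real one and for
  which the norm is absolutely homogeneous.\<close>

class scaleC =
  fixes scaleC :: "complex \<Rightarrow> 'a \<Rightarrow> 'a" (infixr "*\<^sub>C" 75)

class complex_normed_vector = real_normed_vector + scaleC +
  assumes scaleC_add_right: "a *\<^sub>C (x + y) = a *\<^sub>C x + a *\<^sub>C y"
    and scaleC_add_left: "(a + b) *\<^sub>C x = a *\<^sub>C x + b *\<^sub>C x"
    and scaleC_scaleC: "a *\<^sub>C (b *\<^sub>C x) = (a * b) *\<^sub>C x"
    and scaleC_of_real: "complex_of_real r *\<^sub>C x = r *\<^sub>R x"
    and norm_scaleC: "norm (a *\<^sub>C x) = cmod a * norm x"

class complex_banach = complex_normed_vector + banach

interpretation complex_vector: vector_space "scaleC :: complex \<Rightarrow> 'a \<Rightarrow> 'a::complex_normed_vector"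
proof
  show "1 *\<^sub>C x = x" for x :: 'a
    using scaleC_of_real[of 1 x] by simp
qed (simp_all add: scaleC_add_right scaleC_add_left scaleC_scaleC)

instantiation complex :: complex_banach
begin

definition "scaleC_complex (a::complex) (x::complex) = a * x"

instance
  by standard
    (simp_all add: scaleC_complex_def algebra_simps norm_mult scaleR_conv_of_real)

end


section \<open>Bounded complex-linear operators\<close>

definition bounded_clinear ::
    "('a::complex_normed_vector \<Rightarrow> 'b::complex_normed_vector) \<Rightarrow> bool" where
  "bounded_clinear f \<longleftrightarrow> bounded_linear f \<and> (\<forall>c x. f (c *\<^sub>C x) = c *\<^sub>C f x)"

lemma bounded_clinear_scaleC:
  "bounded_clinear (\<lambda>x::'a::complex_normed_vector. c *\<^sub>C x)"
proof -
  have "bounded_linear (\<lambda>x::'a. c *\<^sub>C x)"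
  proof (rule bounded_linear_intro[where K = "cmod c"])
    show "c *\<^sub>C (r *\<^sub>R x) = r *\<^sub>R c *\<^sub>C x" for r and x :: 'a
      by (simp add: scaleC_of_real[symmetric] scaleC_scaleC mult.commute)
  qed (simp_all add: scaleC_add_right norm_scaleC mult.commute)
  then show ?thesis
    by (simp add: bounded_clinear_def scaleC_scaleC mult.commute)
qed

lemma bounded_clinear_compose:
  "bounded_clinear f \<Longrightarrow> bounded_clinear g \<Longrightarrow> bounded_clinear (\<lambda>x. f (g x))"
  unfolding bounded_clinear_def by (auto intro: bounded_linear_compose)

typedef (overloaded) ('a, 'b) cblinfun ("(_ \<Rightarrow>\<^sub>\<complex> /_)" [22, 21] 21) =
    "{f::'a::complex_normed_vector \<Rightarrow> 'b::complex_normed_vector. bounded_clinear f}"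
  morphisms cblinfun_apply cBlinfun
  by (rule exI[of _ "\<lambda>_. 0"]) (simp add: bounded_clinear_def)

setup_lifting type_definition_cblinfun

declare [[coercion
    "cblinfun_apply :: ('a::complex_normed_vector \<Rightarrow>\<^sub>\<complex> 'b::complex_normed_vector) \<Rightarrow> 'a \<Rightarrow> 'b"]]

lemma cblinfun_eqI: "(\<And>x. cblinfun_apply f x = cblinfun_apply g x) \<Longrightarrow> f = g"
  by transfer auto

lemma bounded_clinear_cblinfun_apply: "bounded_clinear (cblinfun_apply f)"
  using cblinfun_apply by blast

lemma bounded_linear_cblinfun_apply: "bounded_linear (cblinfun_apply f)"
  using bounded_clinear_cblinfun_apply bounded_clinear_def by blast

lemma cblinfun_apply_scaleC: "cblinfun_apply f (c *\<^sub>C x) = c *\<^sub>C cblinfun_apply f x"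
  using bounded_clinear_cblinfun_apply bounded_clinear_def by blast

instantiation cblinfun :: (complex_normed_vector, complex_normed_vector) complex_normed_vector
begin

lift_definition norm_cblinfun :: "'a \<Rightarrow>\<^sub>\<complex> 'b \<Rightarrow> real" is onorm .

lift_definition zero_cblinfun :: "'a \<Rightarrow>\<^sub>\<complex> 'b" is "\<lambda>x. 0"
  by (simp add: bounded_clinear_def)

lift_definition uminus_cblinfun :: "'a \<Rightarrow>\<^sub>\<complex> 'b \<Rightarrow> 'a \<Rightarrow>\<^sub>\<complex> 'b" is "\<lambda>f x. - f x"
  by (simp add: bounded_clinear_def bounded_linear_minus)

lift_definition plus_cblinfun :: "'a \<Rightarrow>\<^sub>\<complex> 'b \<Rightarrow> 'a \<Rightarrow>\<^sub>\<complex> 'b \<Rightarrow> 'a \<Rightarrow>\<^sub>\<complex> 'b" is "\<lambda>f g x. f x + g x"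
  by (simp add: bounded_clinear_def bounded_linear_add scaleC_add_right)

lift_definition minus_cblinfun :: "'a \<Rightarrow>\<^sub>\<complex> 'b \<Rightarrow> 'a \<Rightarrow>\<^sub>\<complex> 'b \<Rightarrow> 'a \<Rightarrow>\<^sub>\<complex> 'b" is "\<lambda>f g x. f x - g x"
  by (simp add: bounded_clinear_def bounded_linear_sub complex_vector.scale_right_diff_distrib)

lift_definition scaleC_cblinfun :: "complex \<Rightarrow> 'a \<Rightarrow>\<^sub>\<complex> 'b \<Rightarrow> 'a \<Rightarrow>\<^sub>\<complex> 'b" is "\<lambda>c f x. c *\<^sub>C f x"
  by (rule bounded_clinear_compose[OF bounded_clinear_scaleC])

definition scaleR_cblinfun :: "real \<Rightarrow> 'a \<Rightarrow>\<^sub>\<complex> 'b \<Rightarrow> 'a \<Rightarrow>\<^sub>\<complex> 'b" where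
  "scaleR_cblinfun r f = complex_of_real r *\<^sub>C f"

definition dist_cblinfun :: "'a \<Rightarrow>\<^sub>\<complex> 'b \<Rightarrow> 'a \<Rightarrow>\<^sub>\<complex> 'b \<Rightarrow> real" where
  "dist_cblinfun f g = norm (f - g)"

definition sgn_cblinfun :: "'a \<Rightarrow>\<^sub>\<complex> 'b \<Rightarrow> 'a \<Rightarrow>\<^sub>\<complex> 'b" where
  "sgn_cblinfun f = inverse (norm f) *\<^sub>R f"

definition [code del]:
  "(uniformity :: (('a \<Rightarrow>\<^sub>\<complex> 'b) \<times> ('a \<Rightarrow>\<^sub>\<complex> 'b)) filter) =
    (INF e\<in>{0 <..}. principal {(x, y). dist x y < e})"

definition open_cblinfun :: "('a \<Rightarrow>\<^sub>\<complex> 'b) set \<Rightarrow> bool" where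
  [code del]: "open_cblinfun S = (\<forall>x\<in>S. \<forall>\<^sub>F (x', y) in uniformity. x' = x \<longrightarrow> y \<in> S)"

lemma scaleR_cblinfun_apply: "cblinfun_apply (r *\<^sub>R f) x = r *\<^sub>R cblinfun_apply f x"
  by (simp add: scaleR_cblinfun_def scaleC_cblinfun.rep_eq scaleC_of_real)

instance
proof
  fix f g h :: "'a \<Rightarrow>\<^sub>\<complex> 'b" and r s :: real and a b :: complex
  show "f + g + h = f + (g + h)" "f + g = g + f" "0 + f = f" "- f + f = 0" "f - g = f + - g"
    by (transfer; simp add: fun_eq_iff algebra_simps)+
  show "r *\<^sub>R (f + g) = r *\<^sub>R f + r *\<^sub>R g" "(r + s) *\<^sub>R f = r *\<^sub>R f + s *\<^sub>R f"
    "r *\<^sub>R s *\<^sub>R f = (r * s) *\<^sub>R f" "1 *\<^sub>R f = f"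
    by (rule cblinfun_eqI;
        simp add: scaleR_cblinfun_apply plus_cblinfun.rep_eq scaleR_add_right scaleR_add_left)+
  show "a *\<^sub>C (f + g) = a *\<^sub>C f + a *\<^sub>C g" "(a + b) *\<^sub>C f = a *\<^sub>C f + b *\<^sub>C f"
    "a *\<^sub>C (b *\<^sub>C f) = (a * b) *\<^sub>C f"
    by (transfer; simp add: fun_eq_iff scaleC_add_right scaleC_add_left scaleC_scaleC)+
  show "complex_of_real r *\<^sub>C f = r *\<^sub>R f"
    by (simp add: scaleR_cblinfun_def)
  show "(norm f = 0) = (f = 0)"
    by transfer (simp add: bounded_clinear_def onorm_eq_0 fun_eq_iff)
  show "norm (f + g) \<le> norm f + norm g"
    by transfer (simp add: bounded_clinear_def onorm_triangle)
  show "norm (r *\<^sub>R f) = \<bar>r\<bar> * norm f"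
    by (simp add: norm_cblinfun.rep_eq scaleR_cblinfun_apply[abs_def]
        onorm_scaleR bounded_linear_cblinfun_apply)
  have le: "norm (c *\<^sub>C k) \<le> cmod c * norm k" for c and k :: "'a \<Rightarrow>\<^sub>\<complex> 'b"
    unfolding norm_cblinfun.rep_eq scaleC_cblinfun.rep_eq
  proof (rule onorm_bound)
    show "norm (c *\<^sub>C cblinfun_apply k x) \<le> cmod c * onorm (cblinfun_apply k) * norm x" for x
      using onorm[OF bounded_linear_cblinfun_apply, of k x]
      by (simp add: norm_scaleC mult.assoc mult_left_mono)
  qed (simp add: onorm_pos_le bounded_linear_cblinfun_apply)
  show "norm (a *\<^sub>C f) = cmod a * norm f"
  proof (cases "a = 0")
    case True
    then show ?thesis
      using le[of a f] by (simp add: norm_cblinfun.rep_eq onorm_pos_le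
          bounded_linear_cblinfun_apply antisym)
  next
    case False
    have "f = inverse a *\<^sub>C (a *\<^sub>C f)"
      using False by (intro cblinfun_eqI) (simp add: scaleC_cblinfun.rep_eq)
    then have "norm f \<le> cmod (inverse a) * norm (a *\<^sub>C f)"
      using le[of "inverse a" "a *\<^sub>C f"] by simp
    then have "cmod a * norm f \<le> norm (a *\<^sub>C f)"
      using False by (simp add: norm_inverse norm_divide field_simps)
    then show ?thesis
      using le[of a f] by simp
  qed
qed (simp_all add: dist_cblinfun_def sgn_cblinfun_def uniformity_cblinfun_def open_cblinfun_def)

end

lemma norm_cblinfun: "norm (cblinfun_apply f x) \<le> norm f * norm x"
  unfolding norm_cblinfun.rep_eq by (rule onorm[OF bounded_linear_cblinfun_apply])

lemma norm_cblinfun_bound: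
  "0 \<le> b \<Longrightarrow> (\<And>x. norm (cblinfun_apply f x) \<le> b * norm x) \<Longrightarrow> norm f \<le> b"
  unfolding norm_cblinfun.rep_eq by (rule onorm_bound)

instance cblinfun :: (complex_normed_vector, complex_banach) complex_banach
proof
  fix X :: "nat \<Rightarrow> 'a \<Rightarrow>\<^sub>\<complex> 'b"
  assume X: "Cauchy X"
  define J where "J f = Blinfun (cblinfun_apply f)" for f :: "'a \<Rightarrow>\<^sub>\<complex> 'b"
  have J: "blinfun_apply (J f) = cblinfun_apply f" for f
    by (simp add: J_def bounded_linear_Blinfun_apply bounded_linear_cblinfun_apply)
  have dist_J: "norm (J f - L) = onorm (\<lambda>x. cblinfun_apply f x - blinfun_apply L x)" for f L
    by (simp add: norm_blinfun.rep_eq minus_blinfun.rep_eq J)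
  have "dist (J f) (J g) = dist f g" for f g
    by (simp add: dist_norm dist_J J norm_cblinfun.rep_eq minus_cblinfun.rep_eq)
  with X have "Cauchy (\<lambda>n. J (X n))"
    by (simp add: Cauchy_def)
  then obtain L where L: "(\<lambda>n. J (X n)) \<longlonglongrightarrow> L"
    using Cauchy_convergent convergent_def by blast
  have lim: "(\<lambda>n. cblinfun_apply (X n) x) \<longlonglongrightarrow> blinfun_apply L x" for x
    using blinfun.tendsto[OF L tendsto_const[of x]] by (simp add: J)
  have "blinfun_apply L (c *\<^sub>C x) = c *\<^sub>C blinfun_apply L x" for c x
  proof (rule LIMSEQ_unique)
    show "(\<lambda>n. cblinfun_apply (X n) (c *\<^sub>C x)) \<longlonglongrightarrow> blinfun_apply L (c *\<^sub>C x)"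
      by (rule lim)
    have "bounded_linear (\<lambda>y::'b. c *\<^sub>C y)"
      using bounded_clinear_scaleC bounded_clinear_def by blast
    from bounded_linear.tendsto[OF this lim[of x]]
    show "(\<lambda>n. cblinfun_apply (X n) (c *\<^sub>C x)) \<longlonglongrightarrow> c *\<^sub>C blinfun_apply L x"
      by (simp add: cblinfun_apply_scaleC)
  qed
  then have "bounded_clinear (blinfun_apply L)"
    by (simp add: bounded_clinear_def blinfun.bounded_linear_right)
  then have "cblinfun_apply (cBlinfun (blinfun_apply L)) = blinfun_apply L"
    by (simp add: cBlinfun_inverse)
  then have "J (cBlinfun (blinfun_apply L)) = L"
    by (intro blinfun_eqI) (simp add: J)
  with L \<open>\<And>f g. dist (J f) (J g) = dist f g\<close>
  have "X \<longlonglongrightarrow> cBlinfun (blinfun_apply L)"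
    by (metis (no_types, lifting) LIMSEQ_def)
  then show "convergent X"
    by (rule convergentI)
qed

lift_definition id_cblinfun :: "'a::complex_normed_vector \<Rightarrow>\<^sub>\<complex> 'a" is "\<lambda>x. x"
  by (simp add: bounded_clinear_def)

lift_definition cblinfun_compose ::
    "('b::complex_normed_vector \<Rightarrow>\<^sub>\<complex> 'c::complex_normed_vector) \<Rightarrow>
     ('a::complex_normed_vector \<Rightarrow>\<^sub>\<complex> 'b) \<Rightarrow> 'a \<Rightarrow>\<^sub>\<complex> 'c" (infixl "o\<^sub>C" 55)
  is "\<lambda>f g x. f (g x)"
  by (rule bounded_clinear_compose)

lemma norm_cblinfun_compose: "norm (f o\<^sub>C g) \<le> norm f * norm g"
proof (rule norm_cblinfun_bound)
  fix x
  have "norm (cblinfun_apply f (cblinfun_apply g x)) \<le> norm f * norm (cblinfun_apply g x)"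
    by (rule norm_cblinfun)
  also have "\<dots> \<le> norm f * (norm g * norm x)"
    by (intro mult_left_mono norm_cblinfun norm_ge_zero)
  finally show "norm (cblinfun_apply (f o\<^sub>C g) x) \<le> norm f * norm g * norm x"
    by (simp add: cblinfun_compose.rep_eq mult.assoc)
qed simp

lemma bounded_clinear_compose_left:
  fixes A :: "'a::complex_normed_vector \<Rightarrow>\<^sub>\<complex> 'b::complex_normed_vector"
  shows "bounded_clinear (\<lambda>T::'b \<Rightarrow>\<^sub>\<complex> 'c::complex_normed_vector. T o\<^sub>C A)"
proof -
  have "bounded_linear (\<lambda>T::'b \<Rightarrow>\<^sub>\<complex> 'c. T o\<^sub>C A)"
  proof (rule bounded_linear_intro[where K = "norm A"])
    show "norm (T o\<^sub>C A) \<le> norm T * norm A" for T :: "'b \<Rightarrow>\<^sub>\<complex> 'c"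
      by (rule norm_cblinfun_compose)
  qed (rule cblinfun_eqI; simp add: cblinfun_compose.rep_eq plus_cblinfun.rep_eq
      scaleR_cblinfun_apply)+
  moreover have "(c *\<^sub>C T) o\<^sub>C A = c *\<^sub>C (T o\<^sub>C A)" for c and T :: "'b \<Rightarrow>\<^sub>\<complex> 'c"
    by transfer simp
  ultimately show ?thesis
    by (simp add: bounded_clinear_def)
qed

text \<open>The adjoint on the dual space, without conjugation: \<open>A\<^sup>* \<phi> = \<phi> \<circ> A\<close>.\<close>

lift_definition dual_operator ::
    "('a::complex_normed_vector \<Rightarrow>\<^sub>\<complex> 'b::complex_normed_vector) \<Rightarrow>
     ('b \<Rightarrow>\<^sub>\<complex> complex) \<Rightarrow>\<^sub>\<complex> ('a \<Rightarrow>\<^sub>\<complex> complex)"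
  is "\<lambda>A \<phi>. \<phi> o\<^sub>C A"
  by (rule bounded_clinear_compose_left)

lift_definition right_mult ::
    "('a::complex_normed_vector \<Rightarrow>\<^sub>\<complex> 'a) \<Rightarrow> ('a \<Rightarrow>\<^sub>\<complex> 'a) \<Rightarrow>\<^sub>\<complex> ('a \<Rightarrow>\<^sub>\<complex> 'a)"
  is "\<lambda>A T. T o\<^sub>C A"
  by (rule bounded_clinear_compose_left)


section \<open>Dimensions\<close>

definition finite_cdim :: "'a::complex_normed_vector set \<Rightarrow> bool" where
  "finite_cdim M \<longleftrightarrow> (\<exists>B. finite B \<and> M \<subseteq> complex_vector.span B)"

text \<open>The library's \<open>dim\<close> is a natural number and is only meaningful in the
  finite-dimensional case.\<close>

definition ecdim :: "'a::complex_normed_vector set \<Rightarrow> enat" where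
  "ecdim M = (if finite_cdim M then enat (complex_vector.dim M) else \<infinity>)"

text \<open>The cosets of the elements of \<open>B\<close> form a basis of the quotient \<open>M / W\<close> of subspaces
  \<open>W \<subseteq> M\<close>, distinct elements having distinct cosets.\<close>

definition finite_quotient_basis ::
    "'a::complex_normed_vector set \<Rightarrow> 'a set \<Rightarrow> 'a set \<Rightarrow> bool" where
  "finite_quotient_basis M W B \<longleftrightarrow> finite B \<and> B \<subseteq> M \<and>
     (\<forall>c. (\<Sum>b\<in>B. c b *\<^sub>C b) \<in> W \<longrightarrow> (\<forall>b\<in>B. c b = 0)) \<and>
     (\<forall>x\<in>M. \<exists>c. x - (\<Sum>b\<in>B. c b *\<^sub>C b) \<in> W)"

definition quotient_ecdim :: "'a::complex_normed_vector set \<Rightarrow> 'a set \<Rightarrow> enat" where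
  "quotient_ecdim M W =
     (if \<exists>B. finite_quotient_basis M W B
      then enat (card (SOME B. finite_quotient_basis M W B)) else \<infinity>)"


section \<open>Fredholm theory of an operator restricted to an invariant subspace\<close>

text \<open>\<open>M\<close> is a subspace with \<open>f ` M \<subseteq> M\<close>; the notions refer to the induced operator
  \<open>f : M \<rightarrow> M\<close>.\<close>

definition nullity_on :: "'a::complex_normed_vector set \<Rightarrow> ('a \<Rightarrow> 'a) \<Rightarrow> enat" where
  "nullity_on M f = ecdim {x \<in> M. f x = 0}"

definition defect_on :: "'a::complex_normed_vector set \<Rightarrow> ('a \<Rightarrow> 'a) \<Rightarrow> enat" where
  "defect_on M f = quotient_ecdim M (f ` M)"

definition fredholm_on :: "'a::complex_normed_vector set \<Rightarrow> ('a \<Rightarrow> 'a) \<Rightarrow> bool" where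
  "fredholm_on M f \<longleftrightarrow> nullity_on M f < \<infinity> \<and> defect_on M f < \<infinity>"

definition index_on :: "'a::complex_normed_vector set \<Rightarrow> ('a \<Rightarrow> 'a) \<Rightarrow> int" where
  "index_on M f = int (the_enat (nullity_on M f)) - int (the_enat (defect_on M f))"


section \<open>Spectra and Weyl type theorems\<close>

abbreviation shifted :: "('a::complex_normed_vector \<Rightarrow>\<^sub>\<complex> 'a) \<Rightarrow> complex \<Rightarrow> 'a \<Rightarrow>\<^sub>\<complex> 'a" where
  "shifted T l \<equiv> T - l *\<^sub>C id_cblinfun"

definition spectrum :: "('a::complex_normed_vector \<Rightarrow>\<^sub>\<complex> 'a) \<Rightarrow> complex set" where
  "spectrum T = {l. \<not> (\<exists>S. S o\<^sub>C shifted T l = id_cblinfun \<and> shifted T l o\<^sub>C S = id_cblinfun)}"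

definition null_power :: "('a::complex_normed_vector \<Rightarrow>\<^sub>\<complex> 'a) \<Rightarrow> nat \<Rightarrow> 'a set" where
  "null_power T n = {x. (cblinfun_apply T ^^ n) x = 0}"

definition range_power :: "('a::complex_normed_vector \<Rightarrow>\<^sub>\<complex> 'a) \<Rightarrow> nat \<Rightarrow> 'a set" where
  "range_power T n = range (cblinfun_apply T ^^ n)"

definition nullity :: "('a::complex_normed_vector \<Rightarrow>\<^sub>\<complex> 'a) \<Rightarrow> enat" where
  "nullity T = nullity_on UNIV (cblinfun_apply T)"

definition weyl :: "('a::complex_normed_vector \<Rightarrow>\<^sub>\<complex> 'a) \<Rightarrow> bool" where
  "weyl T \<longleftrightarrow> fredholm_on UNIV (cblinfun_apply T) \<and> index_on UNIV (cblinfun_apply T) = 0"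

definition weyl_spectrum :: "('a::complex_normed_vector \<Rightarrow>\<^sub>\<complex> 'a) \<Rightarrow> complex set" where
  "weyl_spectrum T = {l. \<not> weyl (shifted T l)}"

definition ascent :: "('a::complex_normed_vector \<Rightarrow>\<^sub>\<complex> 'a) \<Rightarrow> enat" where
  "ascent T =
     (if \<exists>n. null_power T n = null_power T (Suc n)
      then enat (LEAST n. null_power T n = null_power T (Suc n)) else \<infinity>)"

definition descent :: "('a::complex_normed_vector \<Rightarrow>\<^sub>\<complex> 'a) \<Rightarrow> enat" where
  "descent T =
     (if \<exists>n. range_power T n = range_power T (Suc n)
      then enat (LEAST n. range_power T n = range_power T (Suc n)) else \<infinity>)"

text \<open>As usual in this context, points of the resolvent set (where ascent and descent are 0)
  are not excluded from these two sets.\<close>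

definition Pi_set :: "('a::complex_normed_vector \<Rightarrow>\<^sub>\<complex> 'a) \<Rightarrow> complex set" where
  "Pi_set T = {l. ascent (shifted T l) = descent (shifted T l) \<and> descent (shifted T l) < \<infinity>}"

definition Pi0_set :: "('a::complex_normed_vector \<Rightarrow>\<^sub>\<complex> 'a) \<Rightarrow> complex set" where
  "Pi0_set T = {l \<in> Pi_set T. nullity (shifted T l) < \<infinity>}"

definition browder_theorem :: "('a::complex_normed_vector \<Rightarrow>\<^sub>\<complex> 'a) \<Rightarrow> bool" where
  "browder_theorem T \<longleftrightarrow> weyl_spectrum T = spectrum T - Pi0_set T"

definition b_fredholm_at :: "('a::complex_normed_vector \<Rightarrow>\<^sub>\<complex> 'a) \<Rightarrow> nat \<Rightarrow> bool" where
  "b_fredholm_at T n \<longleftrightarrow>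
     closed (range_power T n) \<and> fredholm_on (range_power T n) (cblinfun_apply T)"

definition b_fredholm :: "('a::complex_normed_vector \<Rightarrow>\<^sub>\<complex> 'a) \<Rightarrow> bool" where
  "b_fredholm T \<longleftrightarrow> (\<exists>n. b_fredholm_at T n)"

text \<open>On a Banach space the value does not depend on the admissible \<open>n\<close>; the least one is
  picked.\<close>

definition b_index :: "('a::complex_normed_vector \<Rightarrow>\<^sub>\<complex> 'a) \<Rightarrow> int" where
  "b_index T = index_on (range_power T (LEAST n. b_fredholm_at T n)) (cblinfun_apply T)"

definition b_weyl :: "('a::complex_normed_vector \<Rightarrow>\<^sub>\<complex> 'a) \<Rightarrow> bool" where
  "b_weyl T \<longleftrightarrow> b_fredholm T \<and> b_index T = 0"

definition b_weyl_spectrum :: "('a::complex_normed_vector \<Rightarrow>\<^sub>\<complex> 'a) \<Rightarrow> complex set" where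
  "b_weyl_spectrum T = {l. \<not> b_weyl (shifted T l)}"

definition E_set :: "('a::complex_normed_vector \<Rightarrow>\<^sub>\<complex> 'a) \<Rightarrow> complex set" where
  "E_set T = {l. l isolated_in spectrum T \<and> 0 < nullity (shifted T l)}"

definition generalized_weyl_theorem :: "('a::complex_normed_vector \<Rightarrow>\<^sub>\<complex> 'a) \<Rightarrow> bool" where
  "generalized_weyl_theorem T \<longleftrightarrow> b_weyl_spectrum T = spectrum T - E_set T"

end

theory Submission
  imports Defs
begin

text \<open>Write \<open>S\<close> for \<open>A - l\<close>. Everything is measured against one algebraic condition on \<open>S\<close>, Drazin
invertibility: \<open>S\<close> maps the range of some power \<open>S\<^sup>p\<close> bijectively onto itself. It says exactly that
ascent and descent of \<open>S\<close> are finite and equal, so \<open>Pi_set A\<close> is the set of all \<open>l\<close> for which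
\<open>A - l\<close> is Drazin invertible. On a Banach space the condition is also equivalent to the existence
of a bounded operator \<open>V\<close> that commutes with \<open>S\<close> and satisfies \<open>S\<^sup>p\<^sup>+\<^sup>1 V = S\<^sup>p\<close>. Such a \<open>V\<close> passes to
\<open>S\<^sup>*\<close> and to \<open>R\<^sub>S\<close>, whose powers are again given by composition with powers of \<open>S\<close>; conversely
Drazin invertibility of \<open>S\<^sup>*\<close> comes back to \<open>S\<close> (\<open>drazin_invertible_if_dual\<close>). Invertibility and
the Weyl property also agree for \<open>S\<close> and \<open>S\<^sup>*\<close> (\<open>bij_dual_operator_iff\<close>, \<open>weyl_dual_operator_iff\<close>),
and \<open>A\<close>, \<open>A\<^sup>*\<close>, \<open>R\<^sub>A\<close> have the same spectrum, \<open>A\<^sup>*\<close> and \<open>R\<^sub>A\<close> the same set \<open>E\<close>.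

For \<open>R\<^sub>S\<close> the three notions B-Fredholm, B-Weyl and Drazin invertible coincide. The reason is that
kernels and ranges of powers of \<open>R\<^sub>S\<close> are left ideals of the algebra of all operators: with
one operator \<open>x \<otimes> f\<close> of rank one they contain all \<open>y \<otimes> f\<close>, an infinite dimensional family that
finite nullity and defect do not tolerate, as the underlying space is infinite dimensional
(\<open>drazin_invertible_dual_if_b_fredholm_right_mult\<close>). Hence the generalized
Weyl theorem for \<open>R\<^sub>A\<close> reads \<open>{l. A - l not Drazin invertible} = \<sigma>(A) - E(A\<^sup>*)\<close>, while for \<open>A\<^sup>*\<close> it reads
\<open>{l. A\<^sup>* - l not B-Weyl} = \<sigma>(A) - E(A\<^sup>*)\<close>. Drazin invertible operators are B-Weyl
(\<open>b_weyl_if_drazin_invertible\<close>), so it remains to see when a B-Weyl operator \<open>A\<^sup>* - l\<close> is Drazin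
invertible.

It is as soon as \<open>l\<close> is a limit of points of the resolvent set
(\<open>drazin_invertible_if_b_fredholm_and_resolvent_nearby\<close>). If the generalized Weyl theorem holds for
\<open>A\<^sup>*\<close>, then a spectral point \<open>l\<close> with \<open>A\<^sup>* - l\<close> B-Weyl lies in \<open>E(A\<^sup>*)\<close>, hence is isolated, and the
criterion applies; Browder's theorem for \<open>A\<close> follows because Weyl operators are B-Weyl. If instead
Browder's theorem holds for \<open>A\<close>, let \<open>A\<^sup>* - l\<close> be B-Weyl. Then \<open>A - m\<close> is Weyl for all \<open>m \<noteq> l\<close> close to
\<open>l\<close> (\<open>b_weyl_punctured_weyl\<close>), so \<open>A - m\<close> is Drazin invertible, so points close to \<open>m\<close> and
different from \<open>m\<close> belong to the resolvent set (\<open>drazin_invertible_punctured_resolvent\<close>), and the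
criterion applies again.

The functional analysis rests on two tools: the open mapping theorem for closed subspaces and a
Hahn-Banach theorem for seminorms. Statements about a Fredholm operator of index 0 use its
description as a bijection up to an operator of finite rank.\<close>

section \<open>The open mapping theorem for closed subspaces\<close>

text \<open>By Baire's theorem, applied to the complete space \<open>f ` D\<close>, the closure of the image of some ball of
radius \<open>k\<close> has interior points. So every small vector of the image, and after rescaling every
vector \<open>y\<close> of it, is approximated by the image of a vector of norm at most a constant times that
of \<open>y\<close>.\<close>

lemma approximate_preimages_on_subspace:
  fixes f :: "'a::banach \<Rightarrow> 'b::banach"
  assumes f: "bounded_linear f" and D: "subspace D" and Y: "closed (f ` D)"
  shows "\<exists>c>0. \<forall>y\<in>f ` D. \<exists>x\<in>D. norm x \<le> c * norm y \<and> norm (y - f x) \<le> norm y / 2"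
proof -
  interpret f: bounded_linear f by (rule f)
  define C where "C k = closure (f ` (D \<inter> cball 0 (real k)))" for k :: nat
  have C_sub: "C k \<subseteq> f ` D" for k
    unfolding C_def by (rule closure_minimal[OF _ Y]) auto
  have union: "\<Union>(range C) = f ` D"
  proof
    show "f ` D \<subseteq> \<Union>(range C)"
    proof
      fix y assume "y \<in> f ` D"
      then obtain x where x: "x \<in> D" "y = f x" by auto
      obtain k :: nat where "norm x \<le> real k"
        using real_arch_simple by blast
      then have "y \<in> f ` (D \<inter> cball 0 (real k))"
        using x by auto
      then show "y \<in> \<Union>(range C)"
        using closure_subset[of "f ` (D \<inter> cball 0 (real k))"] by (auto simp: C_def)
    qed
  qed (use C_sub in blast)
  have "top_of_set (f ` D) interior_of \<Union>(range C) = f ` D"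
    unfolding union by (metis interior_of_topspace topspace_euclidean_subtopology)
  moreover have "f ` D \<noteq> {}"
    using subspace_0[OF D] by auto
  moreover have "completely_metrizable_space (top_of_set (f ` D))"
    using Y closed_closedin completely_metrizable_space_closedin
      completely_metrizable_space_euclidean by blast
  moreover have "closedin (top_of_set (f ` D)) (C k)" for k
    using C_sub by (simp add: C_def closed_subset)
  ultimately obtain k where "top_of_set (f ` D) interior_of C k \<noteq> {}"
    using Baire_category_alt[of "top_of_set (f ` D)" "range C"] by fastforce
  then obtain y0 U where U: "openin (top_of_set (f ` D)) U" "y0 \<in> U" "U \<subseteq> C k"
    by (auto simp: interior_of_def)
  then obtain r where r: "r > 0" "ball y0 r \<inter> f ` D \<subseteq> U" and y0: "y0 \<in> f ` D"
    unfolding openin_contains_ball by blast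
  \<comment> \<open>A small vector is a difference of two points of the ball around \<open>y0\<close>.\<close>
  have approx: "\<exists>x\<in>D. norm x \<le> 2 * real k \<and> norm (y - f x) < e"
    if y: "y \<in> f ` D" "norm y < r" and e: "e > 0" for y e
  proof -
    have sub: "subspace (f ` D)"
      using D f.linear_axioms linear_subspace_image by blast
    have "y0 + y \<in> ball y0 r"
      using y by (simp add: dist_norm)
    then have "y0 + y \<in> C k" "y0 \<in> C k"
      using U r(2) subspace_add[OF sub y0 y(1)] by blast+
    moreover have "\<exists>a\<in>D. norm a \<le> real k \<and> dist (f a) z < e / 2" if "z \<in> C k" for z
    proof -
      have "\<exists>w\<in>f ` (D \<inter> cball 0 (real k)). dist w z < e / 2"
        using that half_gt_zero[OF e] unfolding C_def closure_approachable by blast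
      then show ?thesis by auto
    qed
    ultimately obtain a b where a: "a \<in> D" "norm a \<le> real k" "dist (f a) (y0 + y) < e / 2"
      and b: "b \<in> D" "norm b \<le> real k" "dist (f b) y0 < e / 2"
      by meson
    have "y - f (a - b) = (y0 + y - f a) - (y0 - f b)"
      by (simp add: f.diff)
    then have "norm (y - f (a - b)) \<le> norm (y0 + y - f a) + norm (y0 - f b)"
      by (metis norm_triangle_ineq4)
    also have "\<dots> < e"
      using a b by (simp add: dist_norm norm_minus_commute)
    finally show ?thesis
      using a b subspace_diff[OF D] norm_triangle_ineq4[of a b] by (intro bexI[of _ "a - b"]) auto
  qed
  have "\<exists>x\<in>D. norm x \<le> (4 * real k / r + 1) * norm y \<and> norm (y - f x) \<le> norm y / 2"
    if y: "y \<in> f ` D" for y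
  proof (cases "y = 0")
    case True
    then show ?thesis
      using subspace_0[OF D] by (intro bexI[of _ 0]) (auto simp: f.zero)
  next
    case False
    \<comment> \<open>Rescale \<open>y\<close> to norm \<open>r / 2\<close>.\<close>
    define s where "s = r / (2 * norm y)"
    have s: "s > 0" using False r by (simp add: s_def)
    have "s *\<^sub>R y \<in> f ` D"
      using y subspace_scale[OF D] by (auto simp: f.scaleR[symmetric])
    moreover have "norm (s *\<^sub>R y) < r"
      using False r s by (simp add: s_def)
    ultimately obtain x where x: "x \<in> D" "norm x \<le> 2 * real k" "norm (s *\<^sub>R y - f x) < s * norm y / 2"
      using approx[of "s *\<^sub>R y" "s * norm y / 2"] s False by auto
    have "s *\<^sub>R (y - f (x /\<^sub>R s)) = s *\<^sub>R y - f x"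
      using s by (simp add: f.scaleR algebra_simps)
    then have "s * norm (y - f (x /\<^sub>R s)) = norm (s *\<^sub>R y - f x)"
      using s by (metis abs_of_pos norm_scaleR)
    then have "norm (y - f (x /\<^sub>R s)) \<le> norm y / 2"
      using x(3) s by (smt (verit) mult_left_mono times_divide_eq_right mult_less_cancel_left_pos)
    moreover have "norm (x /\<^sub>R s) \<le> (4 * real k / r + 1) * norm y"
    proof -
      have "norm (x /\<^sub>R s) \<le> 2 * real k / s"
        using x(2) s by (simp add: field_simps)
      also have "\<dots> = 4 * real k / r * norm y"
        using False by (simp add: s_def)
      also have "\<dots> \<le> (4 * real k / r + 1) * norm y"
        by (intro mult_right_mono) auto
      finally show ?thesis .
    qed
    ultimately show ?thesis
      using x(1) subspace_scale[OF D] by (intro bexI[of _ "x /\<^sub>R s"]) auto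
  qed
  moreover have "4 * real k / r + 1 > 0"
    using r by (simp add: add_nonneg_pos)
  ultimately show ?thesis by blast
qed

text \<open>Correcting the error of an approximate preimage again and again produces a geometric series that
converges to a preimage.\<close>

theorem open_mapping_on_subspace:
  fixes f :: "'a::banach \<Rightarrow> 'b::banach"
  assumes f: "bounded_linear f" and D: "subspace D" "closed D" and Y: "closed (f ` D)"
  obtains c where "c > 0" "\<And>y. y \<in> f ` D \<Longrightarrow> \<exists>x\<in>D. f x = y \<and> norm x \<le> c * norm y"
proof -
  interpret f: bounded_linear f by (rule f)
  obtain c where c: "c > 0"
    and "\<forall>y\<in>f ` D. \<exists>x\<in>D. norm x \<le> c * norm y \<and> norm (y - f x) \<le> norm y / 2"
    using approximate_preimages_on_subspace[OF f D(1) Y] by blast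
  then obtain g where g: "\<And>y. y \<in> f ` D \<Longrightarrow> g y \<in> D" "\<And>y. y \<in> f ` D \<Longrightarrow> norm (g y) \<le> c * norm y"
    "\<And>y. y \<in> f ` D \<Longrightarrow> norm (y - f (g y)) \<le> norm y / 2"
    by metis
  have sub: "subspace (f ` D)"
    using D f.linear_axioms linear_subspace_image by blast
  have "\<exists>x\<in>D. f x = y \<and> norm x \<le> (2 * c) * norm y" if y: "y \<in> f ` D" for y
  proof -
    \<comment> \<open>The residuals of the successive approximation of \<open>y\<close>; their norms are at least halved
      in each step.\<close>
    define u where "u n = ((\<lambda>y. y - f (g y)) ^^ n) y" for n
    have u0: "u 0 = y" and uS: "u (Suc n) = u n - f (g (u n))" for n
      by (simp_all add: u_def)
    have uY: "u n \<in> f ` D" for n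
      by (induction n) (auto simp: u0 uS y intro!: subspace_diff[OF sub] g)
    have un: "norm (u n) \<le> norm y * (1/2) ^ n" for n
    proof (induction n)
      case (Suc n)
      then show ?case using g(3)[OF uY[of n]] by (simp add: uS)
    qed (simp add: u0)
    have gn: "norm (g (u n)) \<le> (c * norm y) * (1/2) ^ n" for n
      using order_trans[OF g(2)[OF uY[of n]] mult_left_mono[OF un[of n]]] c by (simp add: mult.assoc)
    have geo: "(\<lambda>n. (c * norm y) * (1/2::real) ^ n) sums ((c * norm y) * 2)"
      using geometric_sums[of "1/2::real"] by (intro sums_mult) simp
    have sg: "summable (\<lambda>n. g (u n))"
      by (rule summable_comparison_test'[OF sums_summable[OF geo] gn])
    define x where "x = (\<Sum>n. g (u n))"
    have lim: "(\<lambda>n. \<Sum>i<n. g (u i)) \<longlonglongrightarrow> x"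
      using sg unfolding x_def by (simp add: summable_LIMSEQ)
    have "(\<Sum>i<n. g (u i)) \<in> D" for n
      by (intro subspace_sum[OF D(1)] g uY)
    then have xD: "x \<in> D"
      using closed_sequentially[OF D(2) _ lim] by blast
    have part: "f (\<Sum>i<n. g (u i)) = y - u n" for n
      by (induction n) (simp_all add: u0 uS f.zero f.add)
    have "u \<longlonglongrightarrow> 0"
    proof (rule Lim_null_comparison)
      show "\<forall>\<^sub>F n in sequentially. norm (u n) \<le> norm y * (1/2) ^ n"
        using un by simp
      show "(\<lambda>n. norm y * (1/2::real) ^ n) \<longlonglongrightarrow> 0"
        by (intro tendsto_mult_right_zero LIMSEQ_power_zero) simp
    qed
    then have "(\<lambda>n. y - u n) \<longlonglongrightarrow> y"
      using tendsto_diff[OF tendsto_const] by fastforce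
    moreover have "(\<lambda>n. y - u n) \<longlonglongrightarrow> f x"
      using f.tendsto[OF lim] by (simp add: part)
    ultimately have "f x = y"
      using LIMSEQ_unique by blast
    moreover have "norm x \<le> (2 * c) * norm y"
    proof -
      have "norm x \<le> (\<Sum>n. norm (g (u n)))"
        unfolding x_def
        by (rule summable_norm, rule summable_comparison_test'[OF sums_summable[OF geo]])
          (simp add: gn)
      also have "\<dots> \<le> (\<Sum>n. (c * norm y) * (1/2::real) ^ n)"
        by (rule suminf_le[OF gn _ sums_summable[OF geo]])
          (rule summable_comparison_test'[OF sums_summable[OF geo]], simp add: gn)
      finally show ?thesis
        using sums_unique[OF geo] by (simp add: mult.commute mult.left_commute)
    qed
    ultimately show ?thesis using xD by blast
  qed
  with c show ?thesis
    using that[of "2 * c"] by simp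
qed

text \<open>The map \<open>(x, y) \<mapsto> f x + y\<close> is open from \<open>D \<times> F\<close> onto a closed subspace. So if images \<open>v n\<close> tend to
\<open>l\<close>, then \<open>l - v n\<close> is represented by pairs that tend to 0; the \<open>F\<close>-component of a representation
of \<open>l\<close> is therefore a limit of vectors of \<open>f ` D \<inter> F\<close>.\<close>

lemma closed_image_if_complemented:
  fixes f :: "'a::banach \<Rightarrow> 'b::banach"
  assumes f: "bounded_linear f" and D: "subspace D" "closed D" and F: "subspace F" "closed F"
    and M: "closed {f x + y |x y. x \<in> D \<and> y \<in> F}" and int: "closed (f ` D \<inter> F)"
  shows "closed (f ` D)"
  unfolding closed_sequential_limits
proof (intro allI impI)
  interpret f: bounded_linear f by (rule f)
  fix v l assume "(\<forall>n. v n \<in> f ` D) \<and> v \<longlonglongrightarrow> l"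
  then have v: "\<And>n. v n \<in> f ` D" and lim: "v \<longlonglongrightarrow> l" by auto
  define g where "g = (\<lambda>p. f (fst p) + snd p)"
  have g: "bounded_linear g"
    unfolding g_def
    by (intro bounded_linear_add bounded_linear_compose[OF f] bounded_linear_fst bounded_linear_snd)
  interpret g: bounded_linear g by (rule g)
  have img: "g ` (D \<times> F) = {f x + y |x y. x \<in> D \<and> y \<in> F}"
    by (fastforce simp: g_def image_iff)
  have sub: "subspace (f ` D)" "subspace (g ` (D \<times> F))"
    using D F f.linear_axioms g.linear_axioms linear_subspace_image subspace_Times by blast+
  obtain c where c: "c > 0"
    "\<And>z. z \<in> g ` (D \<times> F) \<Longrightarrow> \<exists>p\<in>D \<times> F. g p = z \<and> norm p \<le> c * norm z"
    by (rule open_mapping_on_subspace[OF g subspace_Times[OF D(1) F(1)] closed_Times[OF D(2) F(2)]])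
      (simp_all only: img M)
  have v': "v n \<in> g ` (D \<times> F)" for n
    using v[of n] subspace_0[OF F(1)] by (force simp: g_def)
  then have l': "l \<in> g ` (D \<times> F)"
    using closed_sequentially[OF M[folded img] _ lim] by blast
  then obtain x y where xy: "x \<in> D" "y \<in> F" "l = f x + y"
    by (auto simp: g_def)
  have "\<forall>n. \<exists>p\<in>D \<times> F. g p = l - v n \<and> norm p \<le> c * norm (l - v n)"
    using c(2) subspace_diff[OF sub(2) l' v'] by blast
  then obtain p where p: "\<And>n. p n \<in> D \<times> F" "\<And>n. g (p n) = l - v n"
    "\<And>n. norm (p n) \<le> c * norm (l - v n)"
    by metis
  have "(\<lambda>n. c * norm (l - v n)) \<longlonglongrightarrow> 0"
    using tendsto_mult_left[OF tendsto_norm[OF tendsto_diff[OF tendsto_const[of l] lim]], of c]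
    by simp
  then have "p \<longlonglongrightarrow> 0"
    using Lim_null_comparison[of p "\<lambda>n. c * norm (l - v n)"] p(3) by simp
  then have lim2: "(\<lambda>n. y - snd (p n)) \<longlonglongrightarrow> y"
    using tendsto_diff[OF tendsto_const[of y] tendsto_snd] by fastforce
  have "y - snd (p n) \<in> f ` D \<inter> F" for n
  proof -
    obtain w where w: "w \<in> D" "v n = f w" using v by blast
    have "y - snd (p n) = f (fst (p n) - x + w)"
      using p(2)[of n] w xy(3) by (simp add: g_def f.add f.diff algebra_simps)
    moreover have "fst (p n) - x + w \<in> D"
      using p(1)[of n] w xy by (intro subspace_add[OF D(1)] subspace_diff[OF D(1)]) auto
    moreover have "y - snd (p n) \<in> F"
      using p(1)[of n] xy by (intro subspace_diff[OF F(1)]) auto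
    ultimately show ?thesis by blast
  qed
  then have "y \<in> f ` D"
    using closed_sequentially[OF int _ lim2] by blast
  then show "l \<in> f ` D"
    using xy subspace_add[OF sub(1)] by blast
qed

section \<open>Finite dimension, quotient bases and operators of index 0\<close>

abbreviation clinear :: "('a::complex_normed_vector \<Rightarrow> 'b::complex_normed_vector) \<Rightarrow> bool" where
  "clinear \<equiv> Vector_Spaces.linear scaleC scaleC"

lemma clinearI:
  assumes "\<And>x y. f (x + y) = f x + f y" "\<And>c x. f (c *\<^sub>C x) = c *\<^sub>C f x"
  shows "clinear f"
  by unfold_locales (simp_all add: assms)

lemma independent_family:
  fixes v :: "'i \<Rightarrow> 'a::complex_normed_vector"
  assumes I: "finite I" and indep: "\<And>c. (\<Sum>i\<in>I. c i *\<^sub>C v i) = 0 \<Longrightarrow> \<forall>i\<in>I. c i = 0"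
  shows "inj_on v I" "complex_vector.independent (v ` I)"
proof -
  show inj: "inj_on v I"
  proof (rule inj_onI, rule ccontr)
    fix i j assume ij: "i \<in> I" "j \<in> I" "v i = v j" "i \<noteq> j"
    define c :: "'i \<Rightarrow> complex" where "c k = (if k = i then 1 else if k = j then - 1 else 0)" for k
    have "(\<Sum>k\<in>I. c k *\<^sub>C v k) = (\<Sum>k\<in>{i, j}. c k *\<^sub>C v k)"
      by (rule sum.mono_neutral_right) (use I ij in \<open>auto simp: c_def\<close>)
    also have "\<dots> = 0"
      using ij by (simp add: c_def)
    finally show False
      using indep[of c] ij by (auto simp: c_def)
  qed
  show "complex_vector.independent (v ` I)"
  proof (rule complex_vector.independent_if_scalars_zero)
    fix f x assume "(\<Sum>x\<in>v ` I. f x *\<^sub>C x) = 0" and x: "x \<in> v ` I"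
    then have "(\<Sum>i\<in>I. f (v i) *\<^sub>C v i) = 0"
      by (simp add: sum.reindex[OF inj])
    then show "f x = 0"
      using indep[of "\<lambda>i. f (v i)"] x by auto
  qed (use I in simp)
qed

text \<open>A family version of the bound on the size of independent sets. It counts indices, which is
legitimate since a repetition in the family would itself be a linear relation.\<close>

lemma card_le_if_independent_family:
  fixes v :: "'i \<Rightarrow> 'a::complex_normed_vector"
  assumes I: "finite I" and B: "finite B" and v: "\<And>i. i \<in> I \<Longrightarrow> v i \<in> complex_vector.span B"
    and indep: "\<And>c. (\<Sum>i\<in>I. c i *\<^sub>C v i) = 0 \<Longrightarrow> \<forall>i\<in>I. c i = 0"
  shows "card I \<le> card B"
proof -
  have "card (v ` I) \<le> card B"
    using complex_vector.independent_span_bound[OF B independent_family(2)[of I v, OF I indep]] v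
    by blast
  then show ?thesis
    by (simp add: card_image[OF independent_family(1)[of I v, OF I indep]])
qed

lemma finite_quotient_basis_expansion:
  assumes "finite_quotient_basis M W C" "x \<in> M"
  shows "\<exists>c. x - (\<Sum>b\<in>C. c b *\<^sub>C b) \<in> W"
  using assms unfolding finite_quotient_basis_def by blast

text \<open>Replace each \<open>x \<in> C\<close> by its representative in the span of \<open>B\<close>. These representatives satisfy no
linear relation, because a relation between them would be one between the cosets of \<open>C\<close>.\<close>

lemma finite_quotient_basis_card_le:
  assumes W: "complex_vector.subspace W"
    and B: "finite_quotient_basis M W B" and C: "finite_quotient_basis M W C"
  shows "card C \<le> card B"
proof -
  have "\<forall>x\<in>C. \<exists>c. x - (\<Sum>b\<in>B. c b *\<^sub>C b) \<in> W"
    using B C by (auto simp: finite_quotient_basis_def)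
  then obtain a where a: "\<And>x. x \<in> C \<Longrightarrow> x - (\<Sum>b\<in>B. a x b *\<^sub>C b) \<in> W"
    by metis
  define v where "v x = (\<Sum>b\<in>B. a x b *\<^sub>C b)" for x
  show ?thesis
  proof (rule card_le_if_independent_family)
    show "finite C" "finite B"
      using B C by (auto simp: finite_quotient_basis_def)
    show "v x \<in> complex_vector.span B" for x
      unfolding v_def
      by (intro complex_vector.span_sum complex_vector.span_scale complex_vector.span_base)
    fix c :: "'a \<Rightarrow> complex" assume 0: "(\<Sum>x\<in>C. c x *\<^sub>C v x) = 0"
    have "(\<Sum>x\<in>C. c x *\<^sub>C (x - v x)) \<in> W"
      using a by (intro complex_vector.subspace_sum[OF W] complex_vector.subspace_scale[OF W])
        (simp add: v_def)
    then have "(\<Sum>x\<in>C. c x *\<^sub>C x) \<in> W"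
      by (simp add: complex_vector.scale_right_diff_distrib sum_subtractf 0)
    then show "\<forall>x\<in>C. c x = 0"
      using C by (auto simp: finite_quotient_basis_def)
  qed
qed

lemma quotient_ecdim_eq:
  assumes "complex_vector.subspace W" "finite_quotient_basis M W B"
  shows "quotient_ecdim M W = enat (card B)"
proof -
  have "finite_quotient_basis M W (SOME B. finite_quotient_basis M W B)"
    using assms(2) by (rule someI)
  then have "card (SOME B. finite_quotient_basis M W B) = card B"
    using assms finite_quotient_basis_card_le by (meson antisym)
  then show ?thesis
    using assms(2) by (auto simp: quotient_ecdim_def)
qed

lemma ecdim_eq:
  assumes "complex_vector.independent B" "B \<subseteq> Z" "Z \<subseteq> complex_vector.span B" "finite B"
  shows "ecdim Z = enat (card B)"
  using assms complex_vector.basis_card_eq_dim[of B Z] by (auto simp: ecdim_def finite_cdim_def)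

lemma finite_cdim_basis:
  assumes "finite_cdim Z"
  obtains B where "finite B" "complex_vector.independent B" "B \<subseteq> Z" "Z \<subseteq> complex_vector.span B"
  using assms complex_vector.basis_exists[of Z] complex_vector.independent_span_bound
  unfolding finite_cdim_def by (metis subset_trans)

lemma finite_cdim_subset: "finite_cdim Z \<Longrightarrow> Y \<subseteq> Z \<Longrightarrow> finite_cdim Y"
  unfolding finite_cdim_def by blast

lemma ecdim_eq_0_iff:
  assumes "0 \<in> Z" shows "ecdim Z = 0 \<longleftrightarrow> Z = {0}"
proof
  assume Z: "ecdim Z = 0"
  then have "finite_cdim Z"
    by (auto simp: ecdim_def split: if_splits)
  then obtain B where B: "finite B" "complex_vector.independent B" "B \<subseteq> Z" "Z \<subseteq> complex_vector.span B"
    by (rule finite_cdim_basis)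
  then have "B = {}"
    using ecdim_eq[of B Z] Z by (simp add: zero_enat_def)
  then show "Z = {0}" using B assms by auto
next
  assume "Z = {0}"
  then show "ecdim Z = 0"
    using ecdim_eq[of "{}" Z] complex_vector.independent_empty by (simp add: zero_enat_def)
qed

lemma fredholm_on_index:
  assumes "complex_vector.subspace M" "clinear f"
    and "finite N" "complex_vector.independent N" "N \<subseteq> {x \<in> M. f x = 0}"
      "{x \<in> M. f x = 0} \<subseteq> complex_vector.span N"
    and "finite_quotient_basis M (f ` M) C"
  shows "fredholm_on M f" "index_on M f = int (card N) - int (card C)"
proof -
  interpret f: Vector_Spaces.linear scaleC scaleC f by fact
  have "nullity_on M f = enat (card N)"
    unfolding nullity_on_def using assms by (intro ecdim_eq)
  moreover have "defect_on M f = enat (card C)"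
    unfolding defect_on_def using assms by (intro quotient_ecdim_eq f.subspace_image)
  ultimately show "fredholm_on M f" "index_on M f = int (card N) - int (card C)"
    by (simp_all add: fredholm_on_def index_on_def)
qed

lemma fredholm_onE:
  assumes "complex_vector.subspace M" "clinear f" "fredholm_on M f"
  obtains N C where "finite N" "complex_vector.independent N" "N \<subseteq> {x \<in> M. f x = 0}"
      "{x \<in> M. f x = 0} \<subseteq> complex_vector.span N" "finite_quotient_basis M (f ` M) C"
      "index_on M f = int (card N) - int (card C)"
proof -
  have "finite_cdim {x \<in> M. f x = 0}"
    using assms(3) by (auto simp: fredholm_on_def nullity_on_def ecdim_def split: if_splits)
  then obtain N where N: "finite N" "complex_vector.independent N" "N \<subseteq> {x \<in> M. f x = 0}"
      "{x \<in> M. f x = 0} \<subseteq> complex_vector.span N"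
    by (rule finite_cdim_basis)
  obtain C where C: "finite_quotient_basis M (f ` M) C"
    using assms(3) by (auto simp: fredholm_on_def defect_on_def quotient_ecdim_def split: if_splits)
  show ?thesis
    using that[OF N C fredholm_on_index(2)[OF assms(1,2) N C]] .
qed

text \<open>The rank-nullity theorem. The bijection \<open>g\<close> only serves to express that \<open>H\<close> and \<open>F\<close> have the same
finite dimension. Extend a basis \<open>N\<close> of the kernel to a basis \<open>B\<close> of \<open>H\<close>; then \<open>f\<close> maps \<open>B - N\<close> to
an independent set, and what completes it to a basis of \<open>F\<close> is a basis of the cokernel.\<close>

lemma kernel_and_cokernel_bases:
  fixes f g :: "'a::complex_normed_vector \<Rightarrow> 'b::complex_normed_vector"
  assumes f: "clinear f" and g: "clinear g" and H: "complex_vector.subspace H"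
    and F: "complex_vector.subspace F" "finite_cdim F"
    and bij: "bij_betw g H F" and fH: "f ` H \<subseteq> F"
  obtains N C where "finite N" "complex_vector.independent N" "N \<subseteq> {x \<in> H. f x = 0}"
      "{x \<in> H. f x = 0} \<subseteq> complex_vector.span N" "finite_quotient_basis F (f ` H) C"
      "card N = card C"
proof -
  interpret f: Vector_Spaces.linear scaleC scaleC f by fact
  interpret g: Vector_Spaces.linear scaleC scaleC g by fact
  define K where "K = {x \<in> H. f x = 0}"
  have spanF: "complex_vector.span S \<subseteq> F" if "S \<subseteq> F" for S
    using F that complex_vector.span_minimal by blast
  have spanH: "complex_vector.span S \<subseteq> H" if "S \<subseteq> H" for S
    using H that complex_vector.span_minimal by blast
  have injg: "x = 0" if "x \<in> H" "g x = 0" for x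
    using that bij complex_vector.subspace_0[OF H] g.zero by (auto simp: bij_betw_def inj_on_def)
  obtain E0 where E0: "finite E0" "F \<subseteq> complex_vector.span E0"
    using F(2) by (auto simp: finite_cdim_def)
  obtain N where N: "N \<subseteq> K" "complex_vector.independent N" "K \<subseteq> complex_vector.span N"
    using complex_vector.maximal_independent_subset_extend[of "{}" K]
      complex_vector.independent_empty by auto
  then obtain B where B: "N \<subseteq> B" "B \<subseteq> H" "complex_vector.independent B"
    "H \<subseteq> complex_vector.span B"
    using complex_vector.maximal_independent_subset_extend[of N H] unfolding K_def by blast
  have indep_g: "\<forall>i\<in>S. c i = 0"
    if "(\<Sum>i\<in>S. c i *\<^sub>C g i) = 0" "S \<subseteq> B" "finite S" for c S
  proof -
    have "g (\<Sum>i\<in>S. c i *\<^sub>C i) = 0"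
      using that by (simp add: g.sum g.scale)
    moreover have "(\<Sum>i\<in>S. c i *\<^sub>C i) \<in> H"
      using that B by (intro complex_vector.subspace_sum[OF H] complex_vector.subspace_scale[OF H]) auto
    ultimately have "(\<Sum>i\<in>S. c i *\<^sub>C i) = 0" using injg by blast
    then show ?thesis
      using complex_vector.independent_explicit_finite_subsets[of B] B that by blast
  qed
  have gB: "g b \<in> complex_vector.span E0" if "b \<in> B" for b
    using that bij B E0 by (auto simp: bij_betw_def subset_iff)
  have finB: "finite B"
  proof (rule ccontr)
    assume "infinite B"
    then obtain S where S: "S \<subseteq> B" "finite S" "card S = Suc (card E0)"
      using infinite_arbitrarily_large by blast
    have "card S \<le> card E0"
      using indep_g[OF _ S(1,2)] S gB E0(1) by (intro card_le_if_independent_family[of S E0 g]) auto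
    then show False using S by simp
  qed
  then have finN: "finite N" using B finite_subset by blast
  have fK: "f x = 0" if "x \<in> N" for x using that N by (auto simp: K_def)
  have indep_f: "\<forall>b\<in>B - N. c b = 0" if "(\<Sum>b\<in>B - N. c b *\<^sub>C f b) = 0" for c
  proof -
    define x where "x = (\<Sum>b\<in>B - N. c b *\<^sub>C b)"
    have "f x = 0" using that by (simp add: x_def f.sum f.scale)
    moreover have "x \<in> H"
      unfolding x_def using B
      by (intro complex_vector.subspace_sum[OF H] complex_vector.subspace_scale[OF H]) auto
    ultimately have "x \<in> complex_vector.span N" using N by (auto simp: K_def)
    then obtain d where d: "x = (\<Sum>b\<in>N. d b *\<^sub>C b)"
      using complex_vector.span_finite[OF finN] by auto
    define e where "e b = (if b \<in> N then - d b else c b)" for b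
    have "(\<Sum>b\<in>B. e b *\<^sub>C b) = (\<Sum>b\<in>B - N. e b *\<^sub>C b) + (\<Sum>b\<in>N. e b *\<^sub>C b)"
      by (rule sum.subset_diff[OF B(1) finB])
    also have "\<dots> = x - x"
      by (subst (2) d) (simp add: e_def x_def sum_negf)
    finally have "\<forall>b\<in>B. e b = 0"
      using complex_vector.independent_explicit_finite_subsets[of B] B finB by auto
    then show ?thesis by (auto simp: e_def)
  qed
  have injf: "inj_on f (B - N)" and "complex_vector.independent (f ` (B - N))"
    using independent_family[of "B - N" f] finB indep_f by auto
  then obtain E where E: "f ` (B - N) \<subseteq> E" "E \<subseteq> F" "complex_vector.independent E"
    "F \<subseteq> complex_vector.span E"
    using complex_vector.maximal_independent_subset_extend[of "f ` (B - N)" F] fH B by blast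
  have finE: "finite E"
    using complex_vector.independent_span_bound[OF E0(1) E(3)] E E0 by blast
  have "card B \<le> card E"
    using indep_g[OF _ subset_refl finB] finB finE B bij E
    by (intro card_le_if_independent_family[of B E g]) (auto simp: bij_betw_def subset_iff)
  moreover have "card E \<le> card B"
  proof -
    have "\<forall>e\<in>E. \<exists>h\<in>H. g h = e"
      using E bij by (auto simp: bij_betw_def)
    then obtain h where h: "\<And>e. e \<in> E \<Longrightarrow> h e \<in> H" "\<And>e. e \<in> E \<Longrightarrow> g (h e) = e"
      by metis
    show ?thesis
    proof (rule card_le_if_independent_family[OF finE finB])
      show "h e \<in> complex_vector.span B" if "e \<in> E" for e using h that B by blast
      fix c assume "(\<Sum>e\<in>E. c e *\<^sub>C h e) = 0"
      then have "g (\<Sum>e\<in>E. c e *\<^sub>C h e) = 0" by (simp add: g.zero)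
      then have "(\<Sum>e\<in>E. c e *\<^sub>C e) = 0" by (simp add: g.sum g.scale h)
      then show "\<forall>e\<in>E. c e = 0"
        using complex_vector.independent_explicit_finite_subsets[of E] E finE by auto
    qed
  qed
  ultimately have card: "card E = card B" by simp
  define C where "C = E - f ` (B - N)"
  have "card C = card E - card (B - N)"
    unfolding C_def using card_Diff_subset[of "f ` (B - N)" E] E finB card_image[OF injf] by simp
  then have "card N = card C"
    using card card_Diff_subset[OF finN B(1)] card_mono[OF finB B(1)] by simp
  moreover have "finite_quotient_basis F (f ` H) C"
    unfolding finite_quotient_basis_def
  proof (intro conjI allI impI ballI)
    show "finite C" "C \<subseteq> F" using finE E by (auto simp: C_def)
  next
    fix c b assume c: "(\<Sum>b\<in>C. c b *\<^sub>C b) \<in> f ` H" and b: "b \<in> C"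
    have "f ` H \<subseteq> complex_vector.span (f ` (B - N))"
    proof
      fix y assume "y \<in> f ` H"
      then obtain x where x: "x \<in> H" "y = f x" by auto
      then have "x \<in> complex_vector.span B" using B by auto
      then obtain a where "x = (\<Sum>b\<in>B. a b *\<^sub>C b)"
        using complex_vector.span_finite[OF finB] by auto
      then have "y = (\<Sum>b\<in>B. a b *\<^sub>C f b)"
        using x by (simp add: f.sum f.scale)
      also have "\<dots> = (\<Sum>b\<in>B - N. a b *\<^sub>C f b)"
        by (rule sum.mono_neutral_right) (use finB fK in auto)
      finally have "y = (\<Sum>b\<in>B - N. a b *\<^sub>C f b)" .
      moreover have "(\<Sum>b\<in>B - N. a b *\<^sub>C f b) \<in> complex_vector.span (f ` (B - N))"
        by (intro complex_vector.span_sum complex_vector.span_scale complex_vector.span_base imageI)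
      ultimately show "y \<in> complex_vector.span (f ` (B - N))" by simp
    qed
    then obtain d where d: "(\<Sum>b\<in>C. c b *\<^sub>C b) = (\<Sum>b\<in>f ` (B - N). d b *\<^sub>C b)"
      using c complex_vector.span_finite[of "f ` (B - N)"] finB by auto
    define e where "e b = (if b \<in> f ` (B - N) then - d b else c b)" for b
    have "(\<Sum>b\<in>E. e b *\<^sub>C b) = (\<Sum>b\<in>C. e b *\<^sub>C b) + (\<Sum>b\<in>f ` (B - N). e b *\<^sub>C b)"
      unfolding C_def by (rule sum.subset_diff[OF E(1) finE])
    also have "(\<Sum>b\<in>C. e b *\<^sub>C b) = (\<Sum>b\<in>C. c b *\<^sub>C b)"
      by (rule sum.cong) (auto simp: C_def e_def)
    also have "(\<Sum>b\<in>f ` (B - N). e b *\<^sub>C b) = - (\<Sum>b\<in>f ` (B - N). d b *\<^sub>C b)"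
      unfolding sum_negf[symmetric] by (rule sum.cong) (auto simp: e_def)
    finally have "(\<Sum>b\<in>E. e b *\<^sub>C b) = 0" by (simp add: d)
    then have "e b = 0"
      using complex_vector.independent_explicit_finite_subsets[of E] E finE b by (auto simp: C_def)
    then show "c b = 0" using b by (auto simp: e_def C_def split: if_splits)
  next
    fix x assume "x \<in> F"
    then have "x \<in> complex_vector.span E" using E by auto
    then obtain c where c: "x = (\<Sum>b\<in>E. c b *\<^sub>C b)"
      using complex_vector.span_finite[OF finE] by auto
    have "x = (\<Sum>b\<in>C. c b *\<^sub>C b) + (\<Sum>b\<in>f ` (B - N). c b *\<^sub>C b)"
      unfolding C_def c by (rule sum.subset_diff[OF E(1) finE])
    moreover have "(\<Sum>b\<in>f ` (B - N). c b *\<^sub>C b) \<in> f ` H"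
      using B by (intro complex_vector.subspace_sum complex_vector.subspace_scale f.subspace_image H) auto
    ultimately have "x - (\<Sum>b\<in>C. c b *\<^sub>C b) \<in> f ` H"
      by simp
    then show "\<exists>c. x - (\<Sum>b\<in>C. c b *\<^sub>C b) \<in> f ` H" by blast
  qed
  ultimately show ?thesis
    using that[of N C] N finN by (simp add: K_def)
qed

text \<open>An operator that differs from a bijection by an operator of finite rank has index 0. Together with
\<open>bij_betw_finite_rank_correction\<close>, which is the converse, this replaces the additivity and
stability theorems for the index.\<close>

theorem fredholm_index_0_if_finite_rank_perturbation:
  fixes f g :: "'a::complex_normed_vector \<Rightarrow> 'a"
  assumes f: "clinear f" and g: "clinear g" and M: "complex_vector.subspace M"
    and F: "complex_vector.subspace F" "finite_cdim F" "F \<subseteq> M"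
    and bij: "bij_betw g M M" and diff: "\<And>x. x \<in> M \<Longrightarrow> f x - g x \<in> F"
  shows "fredholm_on M f" "index_on M f = 0"
proof -
  interpret f: Vector_Spaces.linear scaleC scaleC f by fact
  interpret g: Vector_Spaces.linear scaleC scaleC g by fact
  \<comment> \<open>\<open>f\<close> maps the finite dimensional space \<open>H\<close> into \<open>F\<close>; kernel and cokernel of \<open>f\<close> on \<open>M\<close> are
    those of this restriction.\<close>
  define H where "H = {x \<in> M. g x \<in> F}"
  have HF: "f x \<in> F \<longleftrightarrow> g x \<in> F" if "x \<in> M" for x
    using diff[OF that] complex_vector.subspace_add[OF F(1), of "f x - g x" "g x"]
      complex_vector.subspace_diff[OF F(1), of "f x" "f x - g x"] by auto
  have H: "complex_vector.subspace H"
    unfolding H_def complex_vector.subspace_def using M F(1)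
    by (auto simp: g.zero g.add g.scale complex_vector.subspace_def)
  have bijH: "bij_betw g H F"
    using bij F(3) by (auto simp: bij_betw_def H_def inj_on_def)
  have fH: "f ` H \<subseteq> F" using HF by (auto simp: H_def)
  obtain N C where N: "finite N" "complex_vector.independent N" "N \<subseteq> {x \<in> H. f x = 0}"
      "{x \<in> H. f x = 0} \<subseteq> complex_vector.span N" and C: "finite_quotient_basis F (f ` H) C"
    and card: "card N = card C"
    using kernel_and_cokernel_bases[OF f g H F(1,2) bijH fH] .
  have ker: "{x \<in> M. f x = 0} = {x \<in> H. f x = 0}"
    using HF complex_vector.subspace_0[OF F(1)] by (force simp: H_def)
  have CM: "finite_quotient_basis M (f ` M) C"
    unfolding finite_quotient_basis_def
  proof (intro conjI allI impI ballI)
    show "finite C" "C \<subseteq> M" using C F by (auto simp: finite_quotient_basis_def)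
  next
    fix c b assume "(\<Sum>b\<in>C. c b *\<^sub>C b) \<in> f ` M" and b: "b \<in> C"
    moreover have "(\<Sum>b\<in>C. c b *\<^sub>C b) \<in> F"
      using C by (intro complex_vector.subspace_sum complex_vector.subspace_scale F)
        (auto simp: finite_quotient_basis_def)
    ultimately have "(\<Sum>b\<in>C. c b *\<^sub>C b) \<in> f ` H"
      using HF by (auto simp: H_def)
    then show "c b = 0" using C b by (auto simp: finite_quotient_basis_def)
  next
    fix y assume "y \<in> M"
    then obtain x where x: "x \<in> M" "y = g x" using bij by (auto simp: bij_betw_def)
    then have "y - f x \<in> F"
      using complex_vector.subspace_neg[OF F(1) diff[OF x(1)]] by simp
    then obtain c where "y - f x - (\<Sum>b\<in>C. c b *\<^sub>C b) \<in> f ` H"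
      using C unfolding finite_quotient_basis_def by blast
    then obtain z where z: "z \<in> M" "y - f x - (\<Sum>b\<in>C. c b *\<^sub>C b) = f z"
      by (auto simp: H_def)
    then have "y - (\<Sum>b\<in>C. c b *\<^sub>C b) = f (x + z)"
      by (simp add: f.add algebra_simps)
    then show "\<exists>c. y - (\<Sum>b\<in>C. c b *\<^sub>C b) \<in> f ` M"
      using x z complex_vector.subspace_add[OF M] by blast
  qed
  show "fredholm_on M f" "index_on M f = 0"
    using fredholm_on_index[OF M f N(1,2) _ _ CM] N(3,4) card by (auto simp: ker)
qed

text \<open>A Fredholm operator of index 0 becomes bijective when its kernel is mapped isomorphically onto a
complement of its range, the coordinates in the kernel being read off by functionals \<open>\<phi> b\<close>. The
functionals are a parameter because different applications need them to be bounded, or to be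
evaluations at points.\<close>

theorem bij_betw_finite_rank_correction:
  fixes f :: "'a::complex_normed_vector \<Rightarrow> 'a" and \<phi> :: "'a \<Rightarrow> 'a \<Rightarrow> complex"
  assumes f: "clinear f" and M: "complex_vector.subspace M" "f ` M \<subseteq> M"
    and N: "finite N" "N \<subseteq> {x \<in> M. f x = 0}" "{x \<in> M. f x = 0} \<subseteq> complex_vector.span N"
    and C: "finite_quotient_basis M (f ` M) C" and p: "bij_betw p N C"
    and phi: "\<And>b. b \<in> N \<Longrightarrow> clinear (\<phi> b)"
    and delta: "\<And>b b'. b \<in> N \<Longrightarrow> b' \<in> N \<Longrightarrow> \<phi> b b' = (if b = b' then 1 else 0)"
  shows "bij_betw (\<lambda>x. f x + (\<Sum>b\<in>N. \<phi> b x *\<^sub>C p b)) M M"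
proof -
  interpret f: Vector_Spaces.linear scaleC scaleC f by fact
  define K where "K x = (\<Sum>b\<in>N. \<phi> b x *\<^sub>C p b)" for x
  have injp: "inj_on p N" and pN: "p ` N = C" using p by (auto simp: bij_betw_def)
  have phi_simps: "\<phi> b (x + y) = \<phi> b x + \<phi> b y" "\<phi> b (x - y) = \<phi> b x - \<phi> b y"
    "\<phi> b (c *\<^sub>C x) = c * \<phi> b x" "\<phi> b (sum h S) = (\<Sum>i\<in>S. \<phi> b (h i))"
    if "b \<in> N" for b x y c h and S :: "'a set"
  proof -
    interpret F: Vector_Spaces.linear scaleC scaleC "\<phi> b" using phi that .
    show "\<phi> b (x + y) = \<phi> b x + \<phi> b y" "\<phi> b (x - y) = \<phi> b x - \<phi> b y"
      "\<phi> b (c *\<^sub>C x) = c * \<phi> b x" "\<phi> b (sum h S) = (\<Sum>i\<in>S. \<phi> b (h i))"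
      by (simp_all add: F.add F.diff F.scale F.sum scaleC_complex_def)
  qed
  have coeff: "\<phi> b (\<Sum>b'\<in>N. c b' *\<^sub>C b') = c b" if "b \<in> N" for b c
  proof -
    have "\<phi> b (\<Sum>b'\<in>N. c b' *\<^sub>C b') = (\<Sum>b'\<in>N. if b = b' then c b' else 0)"
      using that by (simp add: phi_simps delta if_distrib cong: sum.cong if_cong)
    then show ?thesis using N(1) that by simp
  qed
  have KC: "K x = (\<Sum>c\<in>C. \<phi> (the_inv_into N p c) x *\<^sub>C c)" for x
    unfolding K_def pN[symmetric] sum.reindex[OF injp]
    by (rule sum.cong) (simp_all add: the_inv_into_f_f[OF injp])
  have KM: "K x \<in> M" for x
    unfolding KC using C
    by (intro complex_vector.subspace_sum complex_vector.subspace_scale M)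
      (auto simp: finite_quotient_basis_def)
  have kernel: "x = 0" if x: "x \<in> M" "f x + K x = 0" for x
  proof -
    have "K x = f (- x)" using x by (simp add: f.neg eq_neg_iff_add_eq_0 add.commute)
    then have "K x \<in> f ` M" using complex_vector.subspace_neg[OF M(1) x(1)] by blast
    then have "\<forall>c\<in>C. \<phi> (the_inv_into N p c) x = 0"
      using C unfolding KC finite_quotient_basis_def by auto
    then have z: "\<forall>b\<in>N. \<phi> b x = 0"
      using pN the_inv_into_f_f[OF injp] by force
    then have "f x = 0" using x by (simp add: K_def)
    then have "x \<in> complex_vector.span N" using x N by auto
    then obtain c where c: "x = (\<Sum>b\<in>N. c b *\<^sub>C b)"
      using complex_vector.span_finite[OF N(1)] by auto
    then show "x = 0" using z coeff by simp
  qed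
  have Kd: "K (x - y) = K x - K y" for x y
    by (simp add: K_def phi_simps complex_vector.scale_left_diff_distrib sum_subtractf)
  show ?thesis
    unfolding K_def[symmetric]
  proof (rule bij_betwI')
    fix x y assume xy: "x \<in> M" "y \<in> M"
    show "(f x + K x = f y + K y) = (x = y)"
    proof
      assume "f x + K x = f y + K y"
      then have "f (x - y) + K (x - y) = 0" by (simp add: f.diff Kd algebra_simps)
      then show "x = y"
        using kernel[OF complex_vector.subspace_diff[OF M(1) xy]] by simp
    qed simp
  next
    fix x assume "x \<in> M"
    then show "f x + K x \<in> M" using M KM complex_vector.subspace_add[OF M(1)] by blast
  next
    fix y assume "y \<in> M"
    then obtain d where "y - (\<Sum>c\<in>C. d c *\<^sub>C c) \<in> f ` M"
      using C unfolding finite_quotient_basis_def by blast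
    then obtain x where x: "x \<in> M" "y - (\<Sum>c\<in>C. d c *\<^sub>C c) = f x" by auto
    define s where "s = (\<Sum>b\<in>N. (d (p b) - \<phi> b x) *\<^sub>C b)"
    have NM: "b \<in> M" "f b = 0" if "b \<in> N" for b using that N by auto
    have sM: "s \<in> M" unfolding s_def
      by (intro complex_vector.subspace_sum complex_vector.subspace_scale M NM)
    have "f s = 0" by (simp add: s_def f.sum f.scale NM)
    moreover have "K (x + s) = (\<Sum>c\<in>C. d c *\<^sub>C c)"
    proof -
      have "\<phi> b (x + s) = d (p b)" if "b \<in> N" for b
        using that by (simp only: phi_simps(1) s_def coeff) simp
      then show ?thesis
        unfolding pN[symmetric] sum.reindex[OF injp] K_def by simp
    qed
    ultimately have "y = f (x + s) + K (x + s)" using x by (simp add: f.add algebra_simps)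
    then show "\<exists>x\<in>M. y = f x + K x"
      using complex_vector.subspace_add[OF M(1) x(1) sM] by blast
  qed
qed

lemma finite_cdim_if_finite_kernel_and_image:
  assumes f: "clinear f" and Z: "complex_vector.subspace Z"
    and ker: "finite_cdim {x \<in> Z. f x = 0}" and im: "finite_cdim (f ` Z)"
  shows "finite_cdim Z"
proof -
  interpret f: Vector_Spaces.linear scaleC scaleC f by fact
  obtain E where E: "finite E" "E \<subseteq> f ` Z" "f ` Z \<subseteq> complex_vector.span E"
    using im by (rule finite_cdim_basis)
  obtain E' where E': "finite E'" "E' \<subseteq> Z" "E = f ` E'"
    using finite_subset_image[OF E(1,2)] by blast
  obtain N where N: "finite N" "{x \<in> Z. f x = 0} \<subseteq> complex_vector.span N"
    using ker by (auto simp: finite_cdim_def)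
  have "Z \<subseteq> complex_vector.span (N \<union> E')"
  proof
    fix z assume z: "z \<in> Z"
    then have "f z \<in> f ` complex_vector.span E'"
      using E E' f.span_image by blast
    then obtain s where s: "s \<in> complex_vector.span E'" "f z = f s" by auto
    have "s \<in> Z" using s E' Z complex_vector.span_minimal by blast
    then have "z - s \<in> complex_vector.span N"
      using N z s complex_vector.subspace_diff[OF Z] by (auto simp: f.diff)
    then have "(z - s) + s \<in> complex_vector.span (N \<union> E')"
      using s complex_vector.span_mono[of N "N \<union> E'"] complex_vector.span_mono[of E' "N \<union> E'"]
      by (intro complex_vector.span_add) auto
    then show "z \<in> complex_vector.span (N \<union> E')" by simp
  qed
  then show ?thesis
    unfolding finite_cdim_def using N E' by blast
qed

text \<open>The dimension attains its minimum, and from there on the subspaces agree.\<close>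

lemma decreasing_finite_dim_subspaces_stabilize:
  fixes V :: "nat \<Rightarrow> 'a::complex_normed_vector set"
  assumes V: "\<And>k. complex_vector.subspace (V k)" and dec: "\<And>k. V (Suc k) \<subseteq> V k"
    and fin: "finite_cdim (V 0)"
  obtains k where "\<And>j. j \<ge> k \<Longrightarrow> V j = V k"
proof -
  have anti: "V j \<subseteq> V i" if "i \<le> j" for i j
    using lift_Suc_antimono_le[of V, OF dec that] .
  have finV: "finite_cdim (V k)" for k
    using fin anti[of 0 k] finite_cdim_subset by blast
  obtain k where k: "\<And>j. complex_vector.dim (V k) \<le> complex_vector.dim (V j)"
    using ex_has_least_nat[of "\<lambda>_. True" _ "\<lambda>k. complex_vector.dim (V k)"] by blast
  have "V j = V k" if "j \<ge> k" for j
  proof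
    show "V j \<subseteq> V k" using anti that .
    obtain B where B: "finite B" "complex_vector.independent B" "B \<subseteq> V j" "V j \<subseteq> complex_vector.span B"
      using finV by (rule finite_cdim_basis)
    have "B \<subseteq> V k" using B(3) anti[OF that] by (rule order_trans)
    then obtain B' where B': "B \<subseteq> B'" "B' \<subseteq> V k" "complex_vector.independent B'"
        "V k \<subseteq> complex_vector.span B'"
      using complex_vector.maximal_independent_subset_extend[of B "V k"] B(2) by blast
    obtain E where "finite E" "V k \<subseteq> complex_vector.span E"
      using finV[of k] by (auto simp: finite_cdim_def)
    then have "finite B'" using complex_vector.independent_span_bound[of E B'] B' by blast
    moreover have "card B' \<le> card B"
      using k[of j] complex_vector.basis_card_eq_dim[of B "V j"]
        complex_vector.basis_card_eq_dim[of B' "V k"] B B' by simp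
    ultimately have "B' = B" using B' card_seteq by blast
    then show "V k \<subseteq> V j"
      using B' B V complex_vector.span_minimal by blast
  qed
  then show ?thesis using that by blast
qed

section \<open>The Hahn-Banach theorem\<close>

definition sublinear :: "('a::real_vector \<Rightarrow> real) \<Rightarrow> bool" where
  "sublinear q \<longleftrightarrow> (\<forall>x y. q (x + y) \<le> q x + q y) \<and> (\<forall>t\<ge>0. \<forall>x. q (t *\<^sub>R x) = t * q x)"

text \<open>Covers the two infima used below: over a chain of sublinear functionals, and over the translates of
one functional along a ray.\<close>

lemma sublinear_INF:
  fixes h :: "'i \<Rightarrow> 'a::real_vector \<Rightarrow> real"
  assumes I: "I \<noteq> {}" and bdd: "\<And>x. bdd_below ((\<lambda>i. h i x) ` I)"
    and zero: "\<And>i. i \<in> I \<Longrightarrow> h i 0 = 0"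
    and add: "\<And>i j x y. i \<in> I \<Longrightarrow> j \<in> I \<Longrightarrow> \<exists>k\<in>I. h k (x + y) \<le> h i x + h j y"
    and scale: "\<And>i t x. i \<in> I \<Longrightarrow> t > 0 \<Longrightarrow> \<exists>k\<in>I. t * h k x \<le> h i (t *\<^sub>R x)"
  shows "sublinear (\<lambda>x. INF i\<in>I. h i x)"
proof -
  define u where "u x = (INF i\<in>I. h i x)" for x
  have le: "u x \<le> h i x" if "i \<in> I" for i x
    unfolding u_def using bdd that by (rule cINF_lower)
  have ge: "r \<le> u x" if "\<And>i. i \<in> I \<Longrightarrow> r \<le> h i x" for r x
    unfolding u_def using I that by (rule cINF_greatest)
  have add': "u (x + y) \<le> u x + u y" for x y
  proof -
    have "u (x + y) - h i x \<le> h j y" if "i \<in> I" "j \<in> I" for i j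
      using add[OF that, of x y] le[of _ "x + y"] by fastforce
    then have "u (x + y) - u y \<le> h i x" if "i \<in> I" for i
      using ge[of "u (x + y) - h i x" y] that by fastforce
    then show ?thesis using ge[of "u (x + y) - u y" x] by simp
  qed
  have scale_le: "t * u x \<le> u (t *\<^sub>R x)" if t: "t > 0" for t x
  proof (rule ge)
    fix i assume "i \<in> I"
    then obtain k where "k \<in> I" "t * h k x \<le> h i (t *\<^sub>R x)" using scale t by blast
    then show "t * u x \<le> h i (t *\<^sub>R x)"
      using le[of k x] t by (smt (verit) mult_left_mono)
  qed
  have "u (t *\<^sub>R x) = t * u x" if "t \<ge> 0" for t x
  proof (cases "t = 0")
    case True
    have "u 0 = 0"
      unfolding u_def using zero I by (simp cong: INF_cong_simp)
    then show ?thesis using True by simp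
  next
    case False
    then have "t > 0" using that by simp
    moreover have "(1 / t) * u (t *\<^sub>R x) \<le> u ((1 / t) *\<^sub>R (t *\<^sub>R x))"
      using \<open>t > 0\<close> by (intro scale_le) simp
    ultimately show ?thesis
      using scale_le[of t x] by (simp add: field_simps)
  qed
  then show ?thesis
    using add' by (simp add: sublinear_def u_def[symmetric])
qed

text \<open>The functional \<open>q' x = (INF t\<in>{0..}. q (x + t *\<^sub>R y) - t * q y)\<close> is the largest minorant of \<open>q\<close>
with \<open>q' (x + t *\<^sub>R y) = q' x + t * q y\<close> for \<open>t \<ge> 0\<close>.\<close>

lemma sublinear_shift_minorant:
  assumes q: "sublinear q"
  obtains q' where "sublinear q'" "\<And>x. q' x \<le> q x" "\<And>x. q' x \<le> q (x + y) - q y"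
proof -
  have sub: "q (a + b) \<le> q a + q b" for a b using q by (simp add: sublinear_def)
  have hom: "q (t *\<^sub>R a) = t * q a" if "t \<ge> 0" for t a using q that by (simp add: sublinear_def)
  define h where "h t x = q (x + t *\<^sub>R y) - t * q y" for t x
  have "q (t *\<^sub>R y) \<le> q (x + t *\<^sub>R y) + q (- x)" for t x
    using sub[of "x + t *\<^sub>R y" "- x"] by simp
  then have lower: "- q (- x) \<le> h t x" if "t \<in> {0..}" for t x
    unfolding h_def using hom[of t y] that by (smt (verit) atLeast_iff)
  have bdd: "bdd_below ((\<lambda>t. h t x) ` {0..})" for x
    using lower by (rule bdd_belowI2)
  define q' where "q' x = (INF t\<in>{0..}. h t x)" for x
  have le: "q' x \<le> h t x" if "t \<ge> 0" for t x
    unfolding q'_def using bdd that by (intro cINF_lower) auto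
  have sub': "sublinear (\<lambda>x. INF t\<in>{0..}. h t x)"
  proof (rule sublinear_INF)
    fix s t :: real and a b assume st: "s \<in> {0..}" "t \<in> {0..}"
    have "a + b + (s + t) *\<^sub>R y = (a + s *\<^sub>R y) + (b + t *\<^sub>R y)"
      by (simp add: algebra_simps)
    then have "h (s + t) (a + b) \<le> h s a + h t b"
      unfolding h_def using sub[of "a + s *\<^sub>R y" "b + t *\<^sub>R y"] by (simp add: algebra_simps)
    then show "\<exists>k\<in>{0..}. h k (a + b) \<le> h s a + h t b"
      using st by (intro bexI[of _ "s + t"]) auto
  next
    fix s t :: real and a assume st: "s \<in> {0..}" "t > 0"
    have "t *\<^sub>R a + s *\<^sub>R y = t *\<^sub>R (a + (s / t) *\<^sub>R y)"
      using st by (simp add: algebra_simps)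
    then have "h s (t *\<^sub>R a) = t * h (s / t) a"
      using st hom[of t "a + (s / t) *\<^sub>R y"] by (simp add: h_def right_diff_distrib)
    then show "\<exists>k\<in>{0..}. t * h k a \<le> h s (t *\<^sub>R a)"
      using st by (intro bexI[of _ "s / t"]) auto
  next
    fix t :: real assume "t \<in> {0..}"
    then show "h t 0 = 0" by (simp add: h_def hom)
  qed (use bdd in auto)
  show ?thesis
  proof (rule that[of q'])
    show "sublinear q'" using sub' by (simp add: q'_def[abs_def])
    show "q' x \<le> q x" "q' x \<le> q (x + y) - q y" for x
      using le[of 0 x] le[of 1 x] by (simp_all add: h_def)
  qed
qed

lemma sublinear_minimal_minorant:
  assumes p: "sublinear p"
  obtains q where "sublinear q" "\<And>x. q x \<le> p x"
    "\<And>q' x. sublinear q' \<Longrightarrow> (\<And>x. q' x \<le> q x) \<Longrightarrow> q' x = q x"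
proof -
  define A where "A = {q. sublinear q \<and> (\<forall>x. q x \<le> p x)}"
  define P where "P q q' \<longleftrightarrow> (\<forall>x. q' x \<le> q x)" for q q' :: "'a \<Rightarrow> real"
  have "\<exists>m\<in>A. \<forall>a\<in>A. P m a \<longrightarrow> a = m"
  proof (rule predicate_Zorn)
    show "partial_order_on A (relation_of P A)"
      by (rule partial_order_on_relation_ofI) (auto simp: P_def fun_eq_iff intro: order_trans antisym)
  next
    fix C assume C: "C \<in> Chains (relation_of P A)"
    then have CA: "C \<subseteq> A" and total: "\<And>q q'. q \<in> C \<Longrightarrow> q' \<in> C \<Longrightarrow> P q q' \<or> P q' q"
      by (auto simp: Chains_def relation_of_def)
    show "\<exists>u\<in>A. \<forall>a\<in>C. P a u"
    proof (cases "C = {}")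
      case True
      then show ?thesis using p by (intro bexI[of _ p]) (auto simp: A_def)
    next
      case False
      have add: "q (x + y) \<le> q x + q y" if "q \<in> C" for q x y
        using that CA by (auto simp: A_def sublinear_def)
      have hom: "q (t *\<^sub>R x) = t * q x" if "q \<in> C" "t \<ge> 0" for q t x
        using that CA by (auto simp: A_def sublinear_def)
      have z: "q 0 = 0" if "q \<in> C" for q using hom[OF that, of 0 0] by simp
      have lower: "- p (- x) \<le> q x" if "q \<in> C" for q x
      proof -
        have "0 \<le> q x + q (- x)" using add[OF that, of x "- x"] z[OF that] by simp
        moreover have "q (- x) \<le> p (- x)" using that CA by (auto simp: A_def)
        ultimately show ?thesis by simp
      qed
      have bdd: "bdd_below ((\<lambda>q. q x) ` C)" for x
        using lower by (rule bdd_belowI2)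
      define u where "u x = (INF q\<in>C. q x)" for x
      have "sublinear (\<lambda>x. INF q\<in>C. q x)"
      proof (rule sublinear_INF[OF False bdd z])
        fix q q' x y assume "q \<in> C" "q' \<in> C"
        then show "\<exists>k\<in>C. k (x + y) \<le> q x + q' y"
          using total[of q q'] add[of q x y] add[of q' x y] unfolding P_def
          by (meson add_left_mono add_right_mono order_trans)
      next
        fix q t x assume "q \<in> C" "t > (0::real)"
        then show "\<exists>k\<in>C. t * k x \<le> q (t *\<^sub>R x)"
          using hom[of q t x] by (intro bexI[of _ q]) auto
      qed auto
      moreover have le: "u x \<le> q x" if "q \<in> C" for q x
        unfolding u_def using bdd that by (rule cINF_lower)
      moreover have "u x \<le> p x" for x
      proof -
        obtain q where "q \<in> C" using False by blast
        moreover have "q x \<le> p x" using calculation CA by (auto simp: A_def)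
        ultimately show ?thesis using le[of q x] by simp
      qed
      ultimately have "u \<in> A" by (simp add: A_def u_def[symmetric])
      then show ?thesis using le by (auto simp: P_def)
    qed
  qed
  then obtain q where q: "q \<in> A" "\<And>q'. q' \<in> A \<Longrightarrow> P q q' \<Longrightarrow> q' = q" by blast
  show ?thesis
  proof (rule that[of q])
    show "sublinear q" "q x \<le> p x" for x using q by (auto simp: A_def)
    fix q' x assume q': "sublinear q'" "\<And>x. q' x \<le> q x"
    then have "q' \<in> A" using q(1) by (auto simp: A_def intro: order_trans)
    then show "q' x = q x" using q(2)[of q'] q'(2) by (auto simp: P_def)
  qed
qed

text \<open>Hahn-Banach without partial functionals: a minimal sublinear functional \<open>q\<close> is linear, since it
coincides with its own shift minorant in every direction. Starting below the shift minorant of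
\<open>p\<close> in direction \<open>y\<close> forces the value \<open>- p y\<close> at \<open>- y\<close>.\<close>

lemma linear_minorant_of_sublinear:
  assumes p: "sublinear p"
  obtains F where "linear F" "\<And>x. F x \<le> p x" "F y = p y"
proof -
  obtain p' where p': "sublinear p'" "\<And>x. p' x \<le> p x" "\<And>x. p' x \<le> p (x + y) - p y"
    using sublinear_shift_minorant[OF p] by blast
  obtain q where q: "sublinear q" "\<And>x. q x \<le> p' x"
    and minimal: "\<And>q' x. sublinear q' \<Longrightarrow> (\<And>x. q' x \<le> q x) \<Longrightarrow> q' x = q x"
    using sublinear_minimal_minorant[OF p'(1)] by blast
  have hom: "q (t *\<^sub>R a) = t * q a" if "t \<ge> 0" for t a using q that by (simp add: sublinear_def)
  have q0: "q 0 = 0" using hom[of 0 0] by simp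
  have add: "q (a + b) = q a + q b" for a b
  proof (rule antisym)
    show "q (a + b) \<le> q a + q b" using q by (simp add: sublinear_def)
    obtain q' where "sublinear q'" "\<And>x. q' x \<le> q x" "\<And>x. q' x \<le> q (x + b) - q b"
      using sublinear_shift_minorant[OF q(1)] by blast
    then have "q a \<le> q (a + b) - q b" using minimal[of q' a] by metis
    then show "q a + q b \<le> q (a + b)" by simp
  qed
  have neg: "q (- a) = - q a" for a using add[of a "- a"] q0 by simp
  have "q (t *\<^sub>R a) = t * q a" for t a
  proof (cases "t \<ge> 0")
    case False
    then have "q ((- t) *\<^sub>R a) = - t * q a" by (intro hom) simp
    then show ?thesis using neg[of "t *\<^sub>R a"] by simp
  qed (rule hom)
  then have "linear q" using add by (intro linearI) auto
  moreover have le: "q x \<le> p x" for x using q(2)[of x] p'(2)[of x] by simp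
  moreover have "q y = p y"
  proof (rule antisym)
    have "p 0 = 0" using p unfolding sublinear_def by (metis mult_zero_left order_refl scaleR_zero_left)
    then have "q (- y) \<le> - p y" using q(2)[of "- y"] p'(3)[of "- y"] by simp
    then show "p y \<le> q y" using neg[of y] by simp
  qed (rule le)
  ultimately show ?thesis using that by blast
qed

theorem Hahn_Banach_seminorm:
  fixes p :: "'a::complex_normed_vector \<Rightarrow> real"
  assumes add: "\<And>x y. p (x + y) \<le> p x + p y" and hom: "\<And>c x. p (c *\<^sub>C x) = cmod c * p x"
  obtains f :: "'a \<Rightarrow> complex" where "clinear f" "\<And>x. cmod (f x) \<le> p x" "f y = of_real (p y)"
proof -
  have "sublinear p"
    unfolding sublinear_def using add hom[of "complex_of_real _"] by (simp add: scaleC_of_real)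
  then obtain F where F: "linear F" "\<And>x. F x \<le> p x" "F y = p y"
    using linear_minorant_of_sublinear[of p y] by blast
  interpret F: linear F by fact
  \<comment> \<open>The complex linear functional with real part \<open>F\<close>.\<close>
  define f where "f x = Complex (F x) (- F (\<i> *\<^sub>C x))" for x
  have fi: "f (\<i> *\<^sub>C x) = \<i> * f x" for x
    by (simp add: f_def complex_eq_iff scaleC_scaleC F.neg)
  have fadd: "f (a + b) = f a + f b" for a b
    by (simp add: f_def F.add scaleC_add_right complex_eq_iff)
  have fR: "f (r *\<^sub>R x) = of_real r * f x" for r x
  proof -
    have "\<i> *\<^sub>C r *\<^sub>R x = r *\<^sub>R \<i> *\<^sub>C x"
      by (simp add: scaleC_of_real[symmetric] scaleC_scaleC mult.commute)
    then show ?thesis by (simp add: f_def F.scale complex_eq_iff)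
  qed
  have fC: "f (c *\<^sub>C x) = c * f x" for c x
  proof -
    have "c *\<^sub>C x = Re c *\<^sub>R x + Im c *\<^sub>R (\<i> *\<^sub>C x)"
      by (simp add: scaleC_of_real[symmetric] scaleC_scaleC scaleC_add_left[symmetric]
          complex_eq mult.commute)
    then have "f (c *\<^sub>C x) = of_real (Re c) * f x + of_real (Im c) * (\<i> * f x)"
      by (simp add: fadd fR fi)
    also have "\<dots> = c * f x"
      by (subst (3) complex_eq) (simp add: algebra_simps)
    finally show ?thesis .
  qed
  have "clinear f" by (rule clinearI) (simp_all add: fadd fC scaleC_complex_def)
  moreover have bound: "cmod (f x) \<le> p x" for x
  proof (cases "f x = 0")
    case True
    have "p 0 = 0" using hom[of 0 0] by simp
    moreover have "p (- x) = p x" using hom[of "- 1" x] by simp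
    ultimately have "0 \<le> p x" using add[of x "- x"] by simp
    then show ?thesis using True by simp
  next
    case False
    \<comment> \<open>Rotate \<open>x\<close> so that the value of \<open>f\<close> becomes real.\<close>
    define c where "c = cnj (f x) / cmod (f x)"
    have c1: "cmod c = 1" using False by (simp add: c_def norm_divide)
    have "f (c *\<^sub>C x) = of_real (cmod (f x))"
      using False by (simp add: fC c_def complex_norm_square[symmetric] power2_eq_square
          mult.commute[of _ "f x"] field_simps)
    then have "cmod (f x) = F (c *\<^sub>C x)" by (simp add: f_def complex_eq_iff)
    also have "\<dots> \<le> p x" using F(2)[of "c *\<^sub>C x"] by (simp add: hom c1)
    finally show ?thesis .
  qed
  moreover have "f y = of_real (p y)"
  proof -
    have re: "Re (f y) = p y" by (simp add: f_def F)
    then have "(p y)\<^sup>2 + (Im (f y))\<^sup>2 \<le> (p y)\<^sup>2"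
      using power_mono[OF bound[of y] norm_ge_zero, of 2] by (simp add: cmod_power2)
    then have "Im (f y) = 0" by simp
    then show ?thesis using re by (simp add: complex_eq_iff)
  qed
  ultimately show ?thesis using that by blast
qed

lemma functional_of_seminorm:
  fixes p :: "'a::complex_normed_vector \<Rightarrow> real"
  assumes "\<And>x y. p (x + y) \<le> p x + p y" "\<And>c x. p (c *\<^sub>C x) = cmod c * p x" "\<And>x. p x \<le> norm x"
  obtains \<phi> :: "'a \<Rightarrow>\<^sub>\<complex> complex" where "\<And>x. cmod (\<phi> x) \<le> p x" "\<phi> y = of_real (p y)"
proof -
  obtain f :: "'a \<Rightarrow> complex" where f: "clinear f" "\<And>x. cmod (f x) \<le> p x" "f y = of_real (p y)"
    using Hahn_Banach_seminorm[of p y, OF assms(1,2)] by blast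
  interpret f: Vector_Spaces.linear scaleC scaleC f by fact
  have "bounded_linear f"
  proof (rule bounded_linear_intro[where K = 1])
    show "f (r *\<^sub>R x) = r *\<^sub>R f x" for r x
      using f.scale[of "complex_of_real r" x] by (simp only: scaleC_of_real)
    show "norm (f x) \<le> norm x * 1" for x using f(2)[of x] assms(3)[of x] by simp
  qed (rule f.add)
  then have "bounded_clinear f" by (simp add: bounded_clinear_def f.scale)
  then show ?thesis using that[of "cBlinfun f"] f by (simp add: cBlinfun_inverse)
qed

corollary norming_functional:
  fixes y :: "'a::complex_normed_vector"
  obtains \<phi> :: "'a \<Rightarrow>\<^sub>\<complex> complex" where "\<And>x. cmod (\<phi> x) \<le> norm x" "\<phi> y = of_real (norm y)"
  using functional_of_seminorm[of norm y] by (auto simp: norm_scaleC norm_triangle_ineq)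

text \<open>The distance to \<open>W\<close> is a seminorm, vanishing exactly on \<open>W\<close>.\<close>

corollary separating_functional:
  fixes W :: "'a::complex_normed_vector set"
  assumes W: "complex_vector.subspace W" "closed W" and y: "y \<notin> W"
  obtains \<phi> :: "'a \<Rightarrow>\<^sub>\<complex> complex" where "\<And>w. w \<in> W \<Longrightarrow> \<phi> w = 0" "\<phi> y = 1"
proof -
  have W0: "0 \<in> W" using W complex_vector.subspace_0 by blast
  then have ne: "W \<noteq> {}" by auto
  have near: "\<exists>w\<in>W. norm (x - w) < infdist x W + e" if "e > 0" for x e
  proof -
    have "Inf ((\<lambda>w. dist x w) ` W) < infdist x W + e"
      using that ne by (simp add: infdist_def)
    then show ?thesis
      using cInf_lessD[of "(\<lambda>w. dist x w) ` W"] ne by (auto simp: dist_norm)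
  qed
  have le: "infdist x W \<le> norm (x - w)" if "w \<in> W" for x w
    using infdist_le[OF that, of x] by (simp add: dist_norm)
  have scale_le: "infdist (c *\<^sub>C x) W \<le> cmod c * infdist x W" for c x
  proof (rule field_le_epsilon)
    fix e :: real assume e: "e > 0"
    have "0 < cmod c + 1" by (smt (verit) norm_ge_zero)
    then obtain w where w: "w \<in> W" "norm (x - w) < infdist x W + e / (cmod c + 1)"
      using near[of "e / (cmod c + 1)" x] e by auto
    have "infdist (c *\<^sub>C x) W \<le> norm (c *\<^sub>C x - c *\<^sub>C w)"
      using w W complex_vector.subspace_scale by (intro le) blast
    also have "\<dots> = cmod c * norm (x - w)"
      by (simp add: complex_vector.scale_right_diff_distrib[symmetric] norm_scaleC)
    also have "\<dots> \<le> cmod c * (infdist x W + e / (cmod c + 1))"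
      using w by (intro mult_left_mono) auto
    also have "\<dots> \<le> cmod c * infdist x W + e"
    proof -
      have "cmod c * e \<le> (cmod c + 1) * e" using e by simp
      then have "cmod c * (e / (cmod c + 1)) \<le> e"
        using \<open>0 < cmod c + 1\<close> by (simp add: pos_divide_le_eq mult.commute)
      then show ?thesis by (simp add: distrib_left)
    qed
    finally show "infdist (c *\<^sub>C x) W \<le> cmod c * infdist x W + e" .
  qed
  have "infdist (x + z) W \<le> infdist x W + infdist z W" for x z
  proof (rule field_le_epsilon)
    fix e :: real assume "e > 0"
    then obtain w w' where w: "w \<in> W" "norm (x - w) < infdist x W + e / 2"
        "w' \<in> W" "norm (z - w') < infdist z W + e / 2"
      using near[of "e / 2"] by (meson half_gt_zero)
    have "infdist (x + z) W \<le> norm (x + z - (w + w'))"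
      using w W complex_vector.subspace_add by (intro le) blast
    also have "\<dots> \<le> norm (x - w) + norm (z - w')"
      using norm_triangle_ineq[of "x - w" "z - w'"] by (simp add: algebra_simps)
    finally show "infdist (x + z) W \<le> infdist x W + infdist z W + e" using w by linarith
  qed
  moreover have "infdist (c *\<^sub>C x) W = cmod c * infdist x W" for c x
  proof (cases "c = 0")
    case True
    then show ?thesis using W0 by simp
  next
    case False
    have "infdist x W \<le> cmod (inverse c) * infdist (c *\<^sub>C x) W"
      using scale_le[of "inverse c" "c *\<^sub>C x"] False by (simp add: scaleC_scaleC)
    then have "cmod c * infdist x W \<le> cmod c * (cmod (inverse c) * infdist (c *\<^sub>C x) W)"
      by (intro mult_left_mono) auto
    also have "\<dots> = infdist (c *\<^sub>C x) W"
      using False by (simp add: mult.assoc[symmetric] norm_mult[symmetric])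
    finally have "cmod c * infdist x W \<le> infdist (c *\<^sub>C x) W" .
    then show ?thesis using scale_le[of c x] by simp
  qed
  moreover have "infdist x W \<le> norm x" for x using le[OF W0] by simp
  ultimately obtain \<phi> :: "'a \<Rightarrow>\<^sub>\<complex> complex"
    where phi: "\<And>x. cmod (\<phi> x) \<le> infdist x W" "\<phi> y = of_real (infdist y W)"
    using functional_of_seminorm[of "\<lambda>x. infdist x W" y] by blast
  have nz: "infdist y W \<noteq> 0" using in_closed_iff_infdist_zero[OF W(2) ne] y by simp
  show ?thesis
  proof (rule that)
    show "cblinfun_apply (inverse (of_real (infdist y W)) *\<^sub>C \<phi>) y = 1"
      using phi nz by (simp add: scaleC_cblinfun.rep_eq scaleC_complex_def)
    show "cblinfun_apply (inverse (of_real (infdist y W)) *\<^sub>C \<phi>) w = 0" if "w \<in> W" for w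
      using phi(1)[of w] that by (simp add: scaleC_cblinfun.rep_eq)
  qed
qed


lemma functional_eq_1:
  fixes y :: "'a::complex_normed_vector"
  assumes "y \<noteq> 0"
  obtains \<phi> :: "'a \<Rightarrow>\<^sub>\<complex> complex" where "\<phi> y = 1"
  by (rule separating_functional[OF complex_vector.subspace_single_0 closed_singleton])
    (use assms in auto)

section \<open>Bounded operators, finite dimensional subspaces and dual systems\<close>

lemma bounded_clinear_clinear: "bounded_clinear f \<Longrightarrow> clinear f"
  unfolding bounded_clinear_def by (intro clinearI) (auto simp: linear_simps)

lemma clinear_cblinfun_apply: "clinear (cblinfun_apply f)"
  by (rule bounded_clinear_clinear[OF bounded_clinear_cblinfun_apply])

lemmas cblinfun_simps = cblinfun_compose.rep_eq id_cblinfun.rep_eq plus_cblinfun.rep_eq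
  minus_cblinfun.rep_eq uminus_cblinfun.rep_eq scaleC_cblinfun.rep_eq zero_cblinfun.rep_eq

lemma cblinfun_apply_add: "cblinfun_apply f (x + y) = f x + f y"
  and cblinfun_apply_diff: "cblinfun_apply f (x - y) = f x - f y"
  and cblinfun_apply_minus: "cblinfun_apply f (- x) = - f x"
  and cblinfun_apply_zero: "cblinfun_apply f 0 = 0"
  and cblinfun_apply_sum: "cblinfun_apply f (\<Sum>i\<in>I. h i) = (\<Sum>i\<in>I. f (h i))"
  using bounded_linear_cblinfun_apply[of f] by (simp_all add: linear_simps bounded_linear.linear linear_sum)

lemmas cblinfun_linear_simps = cblinfun_apply_add cblinfun_apply_diff cblinfun_apply_minus
  cblinfun_apply_zero cblinfun_apply_sum cblinfun_apply_scaleC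

lemma nonzero_value:
  assumes "T \<noteq> 0"
  obtains z where "cblinfun_apply T z \<noteq> 0"
  using assms cblinfun_eqI[of T 0] by (auto simp: zero_cblinfun.rep_eq)

lemma nonzero_if_nonzero_value: "cblinfun_apply T z \<noteq> 0 \<Longrightarrow> T \<noteq> 0"
  by (auto simp: zero_cblinfun.rep_eq)

lemma continuous_on_cblinfun_apply: "continuous_on S (cblinfun_apply f)"
  by (rule linear_continuous_on[OF bounded_linear_cblinfun_apply])

lemma real_subspace_if_complex_subspace: "complex_vector.subspace M \<Longrightarrow> subspace M"
  by (auto simp: complex_vector.subspace_def subspace_def scaleC_of_real[symmetric])

text \<open>A functional that vanishes on the span of \<open>B\<close> and not at \<open>y\<close> computes the coefficient of \<open>y\<close>, so
this coefficient depends continuously on the vector.\<close>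

lemma closed_span_finite:
  fixes B :: "'a::complex_normed_vector set"
  assumes "finite B"
  shows "closed (complex_vector.span B)"
  using assms
proof induction
  case empty
  then show ?case by simp
next
  case (insert y B)
  show ?case
  proof (cases "y \<in> complex_vector.span B")
    case True
    then show ?thesis using insert by (simp add: complex_vector.span_redundant)
  next
    case False
    then obtain \<phi> :: "'a \<Rightarrow>\<^sub>\<complex> complex"
      where phi: "\<And>w. w \<in> complex_vector.span B \<Longrightarrow> \<phi> w = 0" "\<phi> y = 1"
      using separating_functional[OF complex_vector.subspace_span insert.IH] by blast
    have coeff: "k = \<phi> x" if "x - k *\<^sub>C y \<in> complex_vector.span B" for x k
      using phi(1)[OF that] phi(2) by (simp add: cblinfun_linear_simps scaleC_complex_def)
    have "complex_vector.span (insert y B) = {x. x - \<phi> x *\<^sub>C y \<in> complex_vector.span B}"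
      unfolding complex_vector.span_insert using coeff by auto
    also have "\<dots> = (\<lambda>x. x - \<phi> x *\<^sub>C y) -` complex_vector.span B"
      by auto
    also have "closed \<dots>"
    proof (rule continuous_closed_vimage[OF insert.IH])
      have "bounded_linear (\<lambda>c::complex. c *\<^sub>C y)"
      proof (rule bounded_linear_intro[where K = "norm y"])
        show "(r *\<^sub>R c) *\<^sub>C y = r *\<^sub>R c *\<^sub>C y" for r and c :: complex
          by (simp add: scaleC_of_real[symmetric] scaleC_scaleC scaleC_complex_def)
      qed (simp_all add: scaleC_add_left norm_scaleC)
      from bounded_linear_compose[OF this bounded_linear_cblinfun_apply[of \<phi>]]
      have "bounded_linear (\<lambda>x. x - \<phi> x *\<^sub>C y)"
        by (intro bounded_linear_sub bounded_linear_ident)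
      then show "isCont (\<lambda>x. x - \<phi> x *\<^sub>C y) x" for x
        by (rule linear_continuous_at)
    qed
    finally show ?thesis .
  qed
qed

lemma closed_if_finite_cdim:
  assumes S: "complex_vector.subspace S" "finite_cdim S"
  shows "closed S"
proof -
  obtain B where B: "finite B" "B \<subseteq> S" "S \<subseteq> complex_vector.span B"
    using S(2) by (rule finite_cdim_basis)
  then have "S = complex_vector.span B"
    using S complex_vector.span_minimal by blast
  then show ?thesis using closed_span_finite[OF B(1)] by simp
qed

lemma dual_functionals:
  fixes N :: "'a::complex_normed_vector set"
  assumes "finite N" "complex_vector.independent N"
  obtains \<phi> :: "'a \<Rightarrow> 'a \<Rightarrow>\<^sub>\<complex> complex"
  where "\<And>b b'. b \<in> N \<Longrightarrow> b' \<in> N \<Longrightarrow> \<phi> b b' = (if b = b' then 1 else 0)"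
proof -
  have "\<exists>f :: 'a \<Rightarrow>\<^sub>\<complex> complex. f b = 1 \<and> (\<forall>b'\<in>N - {b}. f b' = 0)" if "b \<in> N" for b
  proof -
    have "b \<notin> complex_vector.span (N - {b})"
      using assms(2) that by (auto simp: complex_vector.dependent_def)
    then obtain f :: "'a \<Rightarrow>\<^sub>\<complex> complex"
      where f: "\<And>w. w \<in> complex_vector.span (N - {b}) \<Longrightarrow> f w = 0" "f b = 1"
      using separating_functional[OF complex_vector.subspace_span closed_span_finite[of "N - {b}"]]
        assms(1) by blast
    then show ?thesis using f(1)[OF complex_vector.span_base] by (intro exI[of _ f]) simp
  qed
  then obtain \<phi> :: "'a \<Rightarrow> 'a \<Rightarrow>\<^sub>\<complex> complex"
    where "\<And>b. b \<in> N \<Longrightarrow> \<phi> b b = 1 \<and> (\<forall>b'\<in>N - {b}. \<phi> b b' = 0)"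
    by metis
  then show ?thesis using that[of \<phi>] by auto
qed

text \<open>If \<open>g\<close> does not already vanish on the common kernel of \<open>B\<close>, subtracting a multiple of \<open>g\<close> from \<open>f\<close>
makes it vanish there.\<close>

lemma functional_in_span_if_common_kernel:
  fixes B :: "('a::complex_normed_vector \<Rightarrow>\<^sub>\<complex> complex) set" and f :: "'a \<Rightarrow>\<^sub>\<complex> complex"
  assumes "finite B" "\<And>x. (\<forall>g\<in>B. g x = 0) \<Longrightarrow> f x = 0"
  shows "f \<in> complex_vector.span B"
  using assms
proof (induction arbitrary: f)
  case empty
  then have "f = 0" by (intro cblinfun_eqI) (simp add: zero_cblinfun.rep_eq)
  then show ?case by (simp add: complex_vector.span_zero)
next
  case (insert g B)
  show ?case
  proof (cases "\<forall>x. (\<forall>h\<in>B. h x = 0) \<longrightarrow> g x = 0")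
    case True
    then have "f \<in> complex_vector.span B" using insert.prems by (intro insert.IH) auto
    then show ?thesis using complex_vector.span_mono[of B "insert g B"] by blast
  next
    case False
    then obtain y where y: "\<forall>h\<in>B. h y = 0" "g y \<noteq> 0" by blast
    define c where "c = f y / g y"
    have "f - c *\<^sub>C g \<in> complex_vector.span B"
    proof (rule insert.IH)
      fix x assume x: "\<forall>h\<in>B. h x = 0"
      have "\<forall>h\<in>insert g B. h (x - (g x / g y) *\<^sub>C y) = 0"
        using x y by (auto simp: cblinfun_linear_simps scaleC_complex_def)
      from insert.prems[OF this] show "(f - c *\<^sub>C g) x = 0"
        using y by (simp add: cblinfun_simps cblinfun_linear_simps scaleC_complex_def c_def)
    qed
    then show ?thesis
      using complex_vector.span_insert by blast
  qed
qed

text \<open>The counterpart of \<open>dual_functionals\<close> in which the finite independent set consists of functionals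
and the dual system of points of the underlying space.\<close>

lemma dual_points:
  fixes N :: "('a::complex_normed_vector \<Rightarrow>\<^sub>\<complex> complex) set"
  assumes "finite N" "complex_vector.independent N"
  obtains x :: "('a \<Rightarrow>\<^sub>\<complex> complex) \<Rightarrow> 'a"
  where "\<And>f g. f \<in> N \<Longrightarrow> g \<in> N \<Longrightarrow> g (x f) = (if f = g then 1 else 0)"
proof -
  have "\<exists>x. f x = 1 \<and> (\<forall>g\<in>N - {f}. g x = 0)" if "f \<in> N" for f
  proof -
    have "f \<notin> complex_vector.span (N - {f})"
      using assms(2) that by (auto simp: complex_vector.dependent_def)
    then obtain x where x: "\<forall>g\<in>N - {f}. g x = 0" "f x \<noteq> 0"
      using functional_in_span_if_common_kernel[of "N - {f}" f] assms(1) by blast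
    then show ?thesis
      by (intro exI[of _ "inverse (f x) *\<^sub>C x"]) (auto simp: cblinfun_linear_simps scaleC_complex_def)
  qed
  then obtain x where "\<And>f. f \<in> N \<Longrightarrow> f (x f) = 1 \<and> (\<forall>g\<in>N - {f}. g (x f) = 0)"
    by metis
  then show ?thesis using that[of x] by auto
qed

section \<open>Perturbation of bijections by small scalars\<close>

lemma injective_bounded_below:
  fixes f :: "'a::complex_banach \<Rightarrow> 'b::complex_banach"
  assumes f: "bounded_clinear f" and M: "complex_vector.subspace M" "closed M"
    and inj: "inj_on f M" and img: "closed (f ` M)"
  obtains c where "c > 0" "\<And>x. x \<in> M \<Longrightarrow> c * norm x \<le> norm (f x)"
proof -
  have "bounded_linear f" using f by (simp add: bounded_clinear_def)
  then obtain c where c: "c > 0" "\<And>y. y \<in> f ` M \<Longrightarrow> \<exists>x\<in>M. f x = y \<and> norm x \<le> c * norm y"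
    using open_mapping_on_subspace[of f M] real_subspace_if_complex_subspace[OF M(1)] M(2) img
    by metis
  show ?thesis
  proof (rule that[of "1 / c"])
    fix x assume x: "x \<in> M"
    then obtain x' where "x' \<in> M" "f x' = f x" "norm x' \<le> c * norm (f x)" using c by blast
    moreover from this x have "x' = x" using inj by (auto simp: inj_on_def)
    ultimately show "1 / c * norm x \<le> norm (f x)" using c(1) by (simp add: field_simps)
  qed (use c in simp)
qed

lemma bij_betw_bounded_below:
  fixes f :: "'a::complex_banach \<Rightarrow> 'a"
  assumes f: "bounded_clinear f" and M: "complex_vector.subspace M" "closed M" and bij: "bij_betw f M M"
  obtains c where "c > 0" "\<And>x. x \<in> M \<Longrightarrow> c * norm x \<le> norm (f x)"
  using injective_bounded_below[OF f M] bij M(2) by (auto simp: bij_betw_def)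

text \<open>The equation \<open>f x - v *\<^sub>C x = y\<close> says that \<open>x\<close> is a fixed point of \<open>x \<mapsto> f\<^sup>-\<^sup>1 (y + v *\<^sub>C x)\<close>, which is a
contraction of \<open>M\<close>.\<close>

lemma bij_betw_diff_small_scalar:
  fixes f :: "'a::complex_banach \<Rightarrow> 'a"
  assumes f: "clinear f" and M: "complex_vector.subspace M" "closed M" and bij: "bij_betw f M M"
    and c: "\<And>x. x \<in> M \<Longrightarrow> c * norm x \<le> norm (f x)" and v: "cmod v < c"
  shows "bij_betw (\<lambda>x. f x - v *\<^sub>C x) M M"
proof -
  interpret f: Vector_Spaces.linear scaleC scaleC f by fact
  have c0: "c > 0" using v by (smt (verit) norm_ge_zero)
  define g where "g = inv_into M f"
  have g: "g y \<in> M" "f (g y) = y" if "y \<in> M" for y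
    using bij that unfolding g_def by (metis bij_betw_def inv_into_into, metis bij_betw_inv_into_right)
  have unique: "\<exists>!x. x \<in> M \<and> g (y + v *\<^sub>C x) = x" if y: "y \<in> M" for y
  proof (rule Banach_fix[where c = "cmod v / c"])
    have mem: "y + v *\<^sub>C x \<in> M" if "x \<in> M" for x
      using M y that by (simp add: complex_vector.subspace_add complex_vector.subspace_scale)
    show "complete M" using M(2) by (simp add: complete_eq_closed)
    show "M \<noteq> {}" using y by blast
    show "(\<lambda>x. g (y + v *\<^sub>C x)) ` M \<subseteq> M" using g(1)[OF mem] by blast
    fix a b assume ab: "a \<in> M" "b \<in> M"
    have "c * norm (g (y + v *\<^sub>C a) - g (y + v *\<^sub>C b))
        \<le> norm (f (g (y + v *\<^sub>C a) - g (y + v *\<^sub>C b)))"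
      using g(1)[OF mem] ab by (intro c complex_vector.subspace_diff M)
    also have "\<dots> = norm (v *\<^sub>C (a - b))"
      using g(2)[OF mem] ab by (simp add: f.diff complex_vector.scale_right_diff_distrib)
    also have "\<dots> = cmod v * norm (a - b)" by (rule norm_scaleC)
    finally show "dist (g (y + v *\<^sub>C a)) (g (y + v *\<^sub>C b)) \<le> cmod v / c * dist a b"
      using c0 by (simp add: dist_norm field_simps)
  qed (use c0 v in auto)
  have eq: "g (y + v *\<^sub>C x) = x \<longleftrightarrow> f x - v *\<^sub>C x = y" if "x \<in> M" "y \<in> M" for x y
  proof -
    have "y + v *\<^sub>C x \<in> M"
      using M that by (simp add: complex_vector.subspace_add complex_vector.subspace_scale)
    then have "g (y + v *\<^sub>C x) = x \<longleftrightarrow> y + v *\<^sub>C x = f x"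
      using g bij that by (metis bij_betw_def inj_on_def)
    then show ?thesis by (auto simp: algebra_simps)
  qed
  have mem: "f x - v *\<^sub>C x \<in> M" if "x \<in> M" for x
    using M that bij bij_betw_apply[OF bij]
    by (simp add: complex_vector.subspace_diff complex_vector.subspace_scale)
  show ?thesis
  proof (rule bij_betwI')
    fix x y assume xy: "x \<in> M" "y \<in> M"
    show "(f x - v *\<^sub>C x = f y - v *\<^sub>C y) = (x = y)"
      using unique[OF mem[OF xy(1)]] eq xy mem by metis
  next
    fix y assume "y \<in> M"
    then show "\<exists>x\<in>M. y = f x - v *\<^sub>C x" using unique[of y] eq by metis
  qed (rule mem)
qed

text \<open>If \<open>f\<close> is bounded below by \<open>c\<close>, then \<open>f - v\<close> is still bounded below by \<open>c / 2\<close>, a bound that does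
not deteriorate as \<open>v\<close> tends to 0; so \<open>f\<close> is a small perturbation of some bijective \<open>f - v\<close>.\<close>

lemma bij_betw_if_bounded_below_limit:
  fixes f :: "'a::complex_banach \<Rightarrow> 'a"
  assumes f: "clinear f" and M: "complex_vector.subspace M" "closed M"
    and c: "c > 0" "\<And>x. x \<in> M \<Longrightarrow> c * norm x \<le> norm (f x)"
    and near: "\<And>e. e > 0 \<Longrightarrow> \<exists>v. cmod v < e \<and> bij_betw (\<lambda>x. f x - v *\<^sub>C x) M M"
  shows "bij_betw f M M"
proof -
  interpret f: Vector_Spaces.linear scaleC scaleC f by fact
  obtain v where v: "cmod v < c / 2" "bij_betw (\<lambda>x. f x - v *\<^sub>C x) M M"
    using near[of "c / 2"] c by auto
  have "bij_betw (\<lambda>x. (f x - v *\<^sub>C x) - (- v) *\<^sub>C x) M M"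
  proof (rule bij_betw_diff_small_scalar[OF _ M v(2), where c = "c / 2"])
    show "clinear (\<lambda>x. f x - v *\<^sub>C x)"
      by (rule clinearI) (simp_all add: f.add f.scale scaleC_add_right scaleC_scaleC
          complex_vector.scale_right_diff_distrib mult.commute)
    fix x assume "x \<in> M"
    have "cmod v * norm x \<le> c / 2 * norm x" using v(1) by (intro mult_right_mono) auto
    moreover have "norm (f x) - norm (v *\<^sub>C x) \<le> norm (f x - v *\<^sub>C x)" by (rule norm_triangle_ineq2)
    ultimately show "c / 2 * norm x \<le> norm (f x - v *\<^sub>C x)"
      using c(2)[OF \<open>x \<in> M\<close>] by (simp add: norm_scaleC)
  qed (use v in simp)
  then show ?thesis by (simp add: complex_vector.scale_minus_left)
qed

section \<open>Powers and inverses of operators\<close>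

lemma shifted_apply: "cblinfun_apply (shifted T v) = (\<lambda>x. T x - v *\<^sub>C x)"
  by (rule ext) (simp add: cblinfun_simps)

lemma shifted_shifted: "shifted (shifted T l) v = shifted T (l + v)"
  by (rule cblinfun_eqI) (simp add: cblinfun_simps scaleC_add_left)

lift_definition rank_one :: "'b::complex_normed_vector \<Rightarrow> ('a::complex_normed_vector \<Rightarrow>\<^sub>\<complex> complex) \<Rightarrow> 'a \<Rightarrow>\<^sub>\<complex> 'b"
  is "\<lambda>w \<phi> z. cblinfun_apply \<phi> z *\<^sub>C w"
proof -
  fix w :: 'b and \<phi> :: "'a \<Rightarrow>\<^sub>\<complex> complex"
  have "bounded_linear (\<lambda>z. \<phi> z *\<^sub>C w)"
  proof (rule bounded_linear_intro[where K = "norm \<phi> * norm w"])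
    show "\<phi> (r *\<^sub>R x) *\<^sub>C w = r *\<^sub>R \<phi> x *\<^sub>C w" for r x
      by (simp add: scaleC_of_real[symmetric] scaleC_scaleC cblinfun_apply_scaleC scaleC_complex_def)
    show "norm (\<phi> x *\<^sub>C w) \<le> norm x * (norm \<phi> * norm w)" for x
      using mult_right_mono[OF norm_cblinfun[of \<phi> x] norm_ge_zero[of w]]
      by (simp add: norm_scaleC mult_ac)
  qed (simp add: cblinfun_linear_simps scaleC_add_left)
  then show "bounded_clinear (\<lambda>z. \<phi> z *\<^sub>C w)"
    by (simp add: bounded_clinear_def cblinfun_apply_scaleC scaleC_complex_def scaleC_scaleC)
qed

lemma sum_cblinfun_apply:
  "cblinfun_apply (\<Sum>i\<in>I. h i) x = (\<Sum>i\<in>I. cblinfun_apply (h i) x)"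
  by (induction I rule: infinite_finite_induct) (simp_all add: cblinfun_simps)

lemma rank_one_compose: "rank_one w \<phi> o\<^sub>C B = rank_one w (\<phi> o\<^sub>C B)"
  by (rule cblinfun_eqI) (simp add: cblinfun_simps rank_one.rep_eq)

lemma compose_rank_one: "\<phi> o\<^sub>C rank_one w f = \<phi> w *\<^sub>C f" for \<phi> :: "'a::complex_normed_vector \<Rightarrow>\<^sub>\<complex> complex"
  by (rule cblinfun_eqI) (simp add: cblinfun_simps rank_one.rep_eq cblinfun_linear_simps
      scaleC_complex_def mult.commute)

lemma rank_one_sum:
  "rank_one (\<Sum>x\<in>I. d x *\<^sub>C x) f = (\<Sum>x\<in>I. d x *\<^sub>C rank_one x f)"
  by (rule cblinfun_eqI) (simp add: cblinfun_simps rank_one.rep_eq sum_cblinfun_apply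
      complex_vector.scale_sum_right scaleC_scaleC mult.commute)

primrec cblinfun_power :: "('a::complex_normed_vector \<Rightarrow>\<^sub>\<complex> 'a) \<Rightarrow> nat \<Rightarrow> 'a \<Rightarrow>\<^sub>\<complex> 'a" where
  "cblinfun_power T 0 = id_cblinfun"
| "cblinfun_power T (Suc n) = T o\<^sub>C cblinfun_power T n"

lemma cblinfun_power_apply: "cblinfun_apply (cblinfun_power T n) = cblinfun_apply T ^^ n"
  by (induction n) (auto simp: cblinfun_simps fun_eq_iff)

lemma funpow_cblinfun_linear_simps:
  fixes T :: "'a::complex_normed_vector \<Rightarrow>\<^sub>\<complex> 'a"
  shows "(cblinfun_apply T ^^ n) (x + y) = (cblinfun_apply T ^^ n) x + (cblinfun_apply T ^^ n) y"
    "(cblinfun_apply T ^^ n) (x - y) = (cblinfun_apply T ^^ n) x - (cblinfun_apply T ^^ n) y"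
    "(cblinfun_apply T ^^ n) (c *\<^sub>C x) = c *\<^sub>C (cblinfun_apply T ^^ n) x"
    "(cblinfun_apply T ^^ n) 0 = 0"
  unfolding cblinfun_power_apply[symmetric] by (rule cblinfun_linear_simps)+

lemma clinear_funpow:
  fixes T :: "'a::complex_normed_vector \<Rightarrow>\<^sub>\<complex> 'a"
  shows "clinear (cblinfun_apply T ^^ n)"
  unfolding cblinfun_power_apply[symmetric] by (rule clinear_cblinfun_apply)

lemma bounded_clinear_funpow:
  fixes T :: "'a::complex_normed_vector \<Rightarrow>\<^sub>\<complex> 'a"
  shows "bounded_clinear (cblinfun_apply T ^^ n)"
  unfolding cblinfun_power_apply[symmetric] by (rule bounded_clinear_cblinfun_apply)

lemma subspace_range_power: "complex_vector.subspace (range_power T n)"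
proof -
  interpret f: Vector_Spaces.linear scaleC scaleC "cblinfun_apply T ^^ n" by (rule clinear_funpow)
  show ?thesis
    unfolding range_power_def by (rule f.subspace_image) (simp add: complex_vector.subspace_UNIV)
qed

lemma range_power_0: "range_power T 0 = UNIV"
  by (simp add: range_power_def)

lemma image_range_power: "cblinfun_apply T ` range_power T n = range_power T (Suc n)"
  by (simp add: range_power_def image_comp)

lemma funpow_image_range_power:
  "(cblinfun_apply T ^^ k) ` range_power T n = range_power T (k + n)"
proof (induction k)
  case (Suc k)
  have "(cblinfun_apply T ^^ Suc k) ` range_power T n = cblinfun_apply T ` (cblinfun_apply T ^^ k) ` range_power T n"
    by (simp add: image_comp)
  then show ?case using Suc by (simp add: image_range_power)
qed simp

lemma range_power_Suc_subset: "range_power T (Suc n) \<subseteq> range_power T n"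
  by (auto simp: range_power_def funpow_swap1 simp del: funpow.simps)
    (metis funpow_simps_right(2) comp_apply rangeI)

lemma range_power_antimono: "m \<le> n \<Longrightarrow> range_power T n \<subseteq> range_power T m"
  by (rule lift_Suc_antimono_le[of "range_power T"]) (rule range_power_Suc_subset)

lemma range_power_invariant: "x \<in> range_power T n \<Longrightarrow> T x \<in> range_power T n"
  using image_range_power[of T n] range_power_Suc_subset[of T n] by blast

lemma funpow_commute:
  fixes T V :: "'a::complex_normed_vector \<Rightarrow>\<^sub>\<complex> 'a"
  assumes "\<And>x. cblinfun_apply V (T x) = T (V x)"
  shows "cblinfun_apply V ((cblinfun_apply T ^^ n) x) = (cblinfun_apply T ^^ n) (V x)"
  by (induction n) (simp_all add: assms)

lemma bij_betw_range_power_if_commute: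
  fixes T U :: "'a::complex_normed_vector \<Rightarrow>\<^sub>\<complex> 'a"
  assumes comm: "\<And>x. cblinfun_apply U (T x) = T (U x)" and bij: "bij (cblinfun_apply U)"
  shows "bij_betw (cblinfun_apply U) (range_power T n) (range_power T n)"
  unfolding bij_betw_def
proof
  show "inj_on (cblinfun_apply U) (range_power T n)"
    using bij by (meson bij_is_inj inj_on_subset subset_UNIV)
  have "cblinfun_apply U ` range_power T n = (cblinfun_apply T ^^ n) ` range (cblinfun_apply U)"
    unfolding range_power_def image_image by (simp add: funpow_commute[of U T, OF comm])
  then show "cblinfun_apply U ` range_power T n = range_power T n"
    using bij by (simp add: bij_is_surj range_power_def)
qed

lemma shifted_commute:
  fixes T :: "'a::complex_normed_vector \<Rightarrow>\<^sub>\<complex> 'a"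
  shows "cblinfun_apply (shifted T v) (T x) = T (shifted T v x)"
  by (simp add: shifted_apply cblinfun_linear_simps)

text \<open>Yields inverses (\<open>g\<close> the identity, \<open>M\<close> the whole space) and Drazin inverses (\<open>f\<close> and \<open>g\<close> powers of
one operator).\<close>

lemma bounded_solution_operator:
  fixes f g :: "'a::complex_banach \<Rightarrow> 'a"
  assumes f: "bounded_clinear f" and g: "bounded_clinear g"
    and M: "complex_vector.subspace M" "closed M" and bij: "bij_betw f M M" and gM: "range g \<subseteq> M"
  obtains V :: "'a \<Rightarrow>\<^sub>\<complex> 'a" where "\<And>x. V x \<in> M" "\<And>x. f (V x) = g x"
proof -
  interpret f: Vector_Spaces.linear scaleC scaleC f by (rule bounded_clinear_clinear[OF f])
  interpret g: Vector_Spaces.linear scaleC scaleC g by (rule bounded_clinear_clinear[OF g])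
  obtain c where c: "c > 0" "\<And>x. x \<in> M \<Longrightarrow> c * norm x \<le> norm (f x)"
    using bij_betw_bounded_below[OF f M bij] by blast
  have "bounded_linear g" using g by (simp add: bounded_clinear_def)
  then obtain K where K: "\<And>x. norm (g x) \<le> norm x * K"
    using bounded_linear.bounded by blast
  define h where "h x = inv_into M f (g x)" for x
  have h: "h x \<in> M" "f (h x) = g x" for x
    using bij gM unfolding h_def
    by (metis bij_betw_def inv_into_into rangeI subsetD, metis bij_betw_inv_into_right rangeI subsetD)
  have eq: "h x = y" if "y \<in> M" "f y = g x" for x y
    using bij h[of x] that by (metis bij_betw_def inj_on_def)
  have add: "h (x + y) = h x + h y" for x y
    by (rule eq) (simp_all add: h f.add g.add complex_vector.subspace_add[OF M(1)])
  have scale: "h (a *\<^sub>C x) = a *\<^sub>C h x" for a x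
    by (rule eq) (simp_all add: h f.scale g.scale complex_vector.subspace_scale[OF M(1)])
  have "bounded_linear h"
  proof (rule bounded_linear_intro[where K = "K / c"])
    show "h (r *\<^sub>R x) = r *\<^sub>R h x" for r x
      using scale[of "complex_of_real r" x] by (simp add: scaleC_of_real)
    show "norm (h x) \<le> norm x * (K / c)" for x
      using c(2)[OF h(1)[of x]] K[of x] h(2)[of x] c(1) by (simp add: field_simps)
  qed (rule add)
  then have "bounded_clinear h" by (simp add: bounded_clinear_def scale)
  then show ?thesis using that[of "cBlinfun h"] h by (simp add: cBlinfun_inverse)
qed

lemma bij_imp_inverse:
  fixes T :: "'a::complex_banach \<Rightarrow>\<^sub>\<complex> 'a"
  assumes "bij (cblinfun_apply T)"
  obtains S where "S o\<^sub>C T = id_cblinfun" "T o\<^sub>C S = id_cblinfun"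
proof -
  have id: "bounded_clinear (\<lambda>x::'a. x)" by (simp add: bounded_clinear_def)
  obtain S :: "'a \<Rightarrow>\<^sub>\<complex> 'a" where S: "\<And>x. T (S x) = x"
    using bounded_solution_operator[OF bounded_clinear_cblinfun_apply id
        complex_vector.subspace_UNIV closed_UNIV assms] by auto
  have "S (T x) = x" for x
    using S[of "T x"] assms by (metis bij_is_inj injD)
  then have "S o\<^sub>C T = id_cblinfun" "T o\<^sub>C S = id_cblinfun"
    using S by (auto intro!: cblinfun_eqI simp: cblinfun_simps)
  then show ?thesis by (rule that)
qed

lemma bij_if_inverse:
  fixes S T :: "'a::complex_normed_vector \<Rightarrow>\<^sub>\<complex> 'a"
  assumes "S o\<^sub>C T = id_cblinfun" "T o\<^sub>C S = id_cblinfun"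
  shows "bij (cblinfun_apply T)"
proof (rule bij_betw_byWitness[where f' = "cblinfun_apply S"])
  have "S (T x) = x" "T (S x) = x" for x
    using assms by (metis cblinfun_compose.rep_eq id_cblinfun.rep_eq)+
  then show "\<forall>x\<in>UNIV. S (T x) = x" "\<forall>x\<in>UNIV. T (S x) = x" by auto
qed auto

lemma in_spectrum_iff:
  fixes T :: "'a::complex_banach \<Rightarrow>\<^sub>\<complex> 'a"
  shows "l \<in> spectrum T \<longleftrightarrow> \<not> bij (cblinfun_apply (shifted T l))"
  unfolding spectrum_def mem_Collect_eq using bij_imp_inverse bij_if_inverse by blast

section \<open>Drazin invertible operators\<close>

text \<open>For bounded operators on a Banach space this is the Drazin invertibility of \<open>T\<close> with index at
most \<open>p\<close>, see \<open>drazin_inverse\<close> and \<open>drazin_at_if_inverse\<close>.\<close>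

definition drazin_at :: "('a::complex_normed_vector \<Rightarrow>\<^sub>\<complex> 'a) \<Rightarrow> nat \<Rightarrow> bool" where
  "drazin_at T p \<longleftrightarrow> bij_betw (cblinfun_apply T) (range_power T p) (range_power T p)"

definition drazin_invertible :: "('a::complex_normed_vector \<Rightarrow>\<^sub>\<complex> 'a) \<Rightarrow> bool" where
  "drazin_invertible T \<longleftrightarrow> (\<exists>p. drazin_at T p)"

lemma drazin_invertible_if_bij: "bij (cblinfun_apply T) \<Longrightarrow> drazin_invertible T"
  unfolding drazin_invertible_def drazin_at_def by (rule exI[of _ 0]) (simp add: range_power_0)

lemma drazin_at_bij_betw_funpow:
  assumes "drazin_at T p"
  shows "bij_betw (cblinfun_apply T ^^ k) (range_power T p) (range_power T p)"
proof (induction k)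
  case (Suc k)
  then show ?case
    using bij_betw_trans assms unfolding drazin_at_def funpow.simps by blast
qed (simp add: id_def[symmetric] bij_betw_id)

text \<open>The range of \<open>T\<^sup>p\<close> is an algebraic complement of the kernel of \<open>T\<^sup>p\<close>, which is closed.\<close>

lemma drazin_at_closed:
  fixes T :: "'a::complex_banach \<Rightarrow>\<^sub>\<complex> 'a"
  assumes "drazin_at T p"
  shows "closed (range_power T p)"
proof -
  let ?f = "cblinfun_apply T ^^ p"
  let ?R = "range_power T p"
  let ?F = "?f -` {0}"
  note bij = drazin_at_bij_betw_funpow[OF assms, of p]
  have bl: "bounded_linear ?f" using bounded_clinear_funpow bounded_clinear_def by blast
  have F: "complex_vector.subspace ?F"
    by (auto simp: complex_vector.subspace_def funpow_cblinfun_linear_simps)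
  have "closed ?F"
    by (intro continuous_closed_vimage linear_continuous_at bl) auto
  moreover have "\<exists>x y. z = ?f x + y \<and> y \<in> ?F" for z
  proof -
    have "?f z \<in> ?R" by (simp add: range_power_def)
    then obtain w where "w \<in> ?R" "?f w = ?f z" using bij by (metis bij_betw_def imageE)
    moreover from this obtain x where "w = ?f x" by (auto simp: range_power_def)
    ultimately show ?thesis
      by (intro exI[of _ x] exI[of _ "z - w"]) (auto simp: funpow_cblinfun_linear_simps)
  qed
  then have "{?f x + y |x y. x \<in> UNIV \<and> y \<in> ?F} = UNIV" by auto
  then have "closed {?f x + y |x y. x \<in> UNIV \<and> y \<in> ?F}" by simp
  moreover have "range ?f \<inter> ?F = {0}"
  proof -
    have "x = 0" if "x \<in> ?R" "?f x = 0" for x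
      using that bij complex_vector.subspace_0[OF subspace_range_power[of T p]]
        funpow_cblinfun_linear_simps(4)[where T = T and n = p]
      by (metis bij_betw_def inj_on_def)
    then show ?thesis
      using funpow_cblinfun_linear_simps(4)[where T = T and n = p]
      by (auto simp: range_power_def image_iff)
  qed
  then have "closed (range ?f \<inter> ?F)" by simp
  ultimately show ?thesis
    unfolding range_power_def
    by (intro closed_image_if_complemented[OF bl subspace_UNIV closed_UNIV
          real_subspace_if_complex_subspace[OF F]])
qed

text \<open>\<open>V x\<close> is the unique vector in the range of \<open>T\<^sup>p\<close> that \<open>T\<^sup>p\<^sup>+\<^sup>1\<close> maps to \<open>T\<^sup>p x\<close>.\<close>

lemma drazin_inverse:
  fixes T :: "'a::complex_banach \<Rightarrow>\<^sub>\<complex> 'a"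
  assumes "drazin_at T p"
  obtains V :: "'a \<Rightarrow>\<^sub>\<complex> 'a" where "\<And>x. V (T x) = T (V x)" "\<And>x. V (T (V x)) = V x"
    "\<And>x. (cblinfun_apply T ^^ Suc p) (V x) = (cblinfun_apply T ^^ p) x"
proof -
  let ?R = "range_power T p"
  note bij = drazin_at_bij_betw_funpow[OF assms, of "Suc p"]
  have inj: "x = y" if "x \<in> ?R" "y \<in> ?R" "(cblinfun_apply T ^^ Suc p) x = (cblinfun_apply T ^^ Suc p) y" for x y
    using bij that by (metis bij_betw_def inj_on_def)
  obtain V :: "'a \<Rightarrow>\<^sub>\<complex> 'a" where V: "\<And>x. V x \<in> ?R"
    "\<And>x. (cblinfun_apply T ^^ Suc p) (V x) = (cblinfun_apply T ^^ p) x"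
    using bounded_solution_operator[OF bounded_clinear_funpow[of "Suc p" T] bounded_clinear_funpow[of p T]
        subspace_range_power drazin_at_closed[OF assms] bij] range_power_def[of T p] by blast
  have swap: "(cblinfun_apply T ^^ k) (T x) = T ((cblinfun_apply T ^^ k) x)" for k x
    by (simp add: funpow_swap1)
  have comm: "V (T x) = T (V x)" for x
  proof (rule inj)
    show "(cblinfun_apply T ^^ Suc p) (V (T x)) = (cblinfun_apply T ^^ Suc p) (T (V x))"
      unfolding V(2) swap ..
  qed (simp_all add: V range_power_invariant)
  have "V (T y) = y" if "y \<in> ?R" for y
  proof (rule inj)
    show "(cblinfun_apply T ^^ Suc p) (V (T y)) = (cblinfun_apply T ^^ Suc p) y"
      unfolding V(2) by (simp add: swap)
  qed (simp_all add: V that)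
  then show ?thesis using that[of V] comm V by blast
qed

lemma drazin_at_if_inverse:
  fixes T V :: "'a::complex_normed_vector \<Rightarrow>\<^sub>\<complex> 'a"
  assumes comm: "\<And>x. cblinfun_apply V (T x) = T (V x)"
    and inv: "\<And>x. (cblinfun_apply T ^^ Suc p) (V x) = (cblinfun_apply T ^^ p) x"
  shows "drazin_at T p"
proof -
  have VT: "V (T y) = y" if y: "y \<in> range_power T p" for y
  proof -
    obtain x where x: "y = (cblinfun_apply T ^^ p) x" using y by (auto simp: range_power_def)
    have "V (T y) = V ((cblinfun_apply T ^^ Suc p) x)" by (simp add: x)
    then show ?thesis using funpow_commute[of V T "Suc p" x, OF comm] inv[of x] x by simp
  qed
  have "V y \<in> range_power T p" if "y \<in> range_power T p" for y
    using that funpow_commute[of V T p, OF comm] by (auto simp: range_power_def)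
  then show ?thesis
    unfolding drazin_at_def using VT comm
    by (intro bij_betw_byWitness[where f' = "cblinfun_apply V"]) (auto simp: range_power_invariant)
qed

text \<open>If \<open>T\<close> is bijective on the range of \<open>T\<^sup>p\<close>, then ascent and descent are at most \<open>p\<close>. They are equal:
the range is constant from the descent \<open>d\<close> on, so \<open>T\<close> is injective on the range of \<open>T\<^sup>d\<close>, which
bounds the ascent \<open>a\<close> by \<open>d\<close>; and the kernel is constant from \<open>a\<close> on, which allows to cancel powers
of \<open>T\<close> in \<open>T\<^sup>p\<^sup>+\<^sup>a y = T\<^sup>p\<^sup>+\<^sup>a\<^sup>+\<^sup>1 z\<close> and bounds \<open>d\<close> by \<open>a\<close>.\<close>

lemma ascent_eq_descent_iff_drazin_invertible:
  "ascent T = descent T \<and> descent T < \<infinity> \<longleftrightarrow> drazin_invertible T"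
proof
  assume L: "ascent T = descent T \<and> descent T < \<infinity>"
  then have ex: "\<exists>n. null_power T n = null_power T (Suc n)" "\<exists>n. range_power T n = range_power T (Suc n)"
    by (auto simp: ascent_def descent_def split: if_splits)
  define p where "p = (LEAST n. null_power T n = null_power T (Suc n))"
  have "p = (LEAST n. range_power T n = range_power T (Suc n))"
    using L ex by (simp add: ascent_def descent_def p_def)
  then have p: "null_power T p = null_power T (Suc p)" "range_power T p = range_power T (Suc p)"
    using LeastI_ex[OF ex(1)] LeastI_ex[OF ex(2)] by (simp_all add: p_def)
  have "inj_on (cblinfun_apply T) (range_power T p)"
  proof (rule inj_onI)
    fix x y assume "x \<in> range_power T p" "y \<in> range_power T p" and eq: "T x = T y"
    then obtain a b where ab: "x = (cblinfun_apply T ^^ p) a" "y = (cblinfun_apply T ^^ p) b"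
      by (auto simp: range_power_def)
    have "a - b \<in> null_power T (Suc p)"
      using eq by (simp add: null_power_def ab funpow_cblinfun_linear_simps cblinfun_linear_simps)
    then have "a - b \<in> null_power T p" using p by simp
    then show "x = y" by (simp add: null_power_def ab funpow_cblinfun_linear_simps)
  qed
  then show "drazin_invertible T"
    unfolding drazin_invertible_def drazin_at_def bij_betw_def
    using p(2) image_range_power[of T p] by auto
next
  assume "drazin_invertible T"
  then obtain p where p: "drazin_at T p" by (auto simp: drazin_invertible_def)
  have R: "range_power T p = range_power T (Suc p)"
    using p image_range_power[of T p] by (auto simp: drazin_at_def bij_betw_def)
  have zero: "x = 0" if "x \<in> range_power T p" "(cblinfun_apply T ^^ k) x = 0" for x k
    using that drazin_at_bij_betw_funpow[OF p, of k] complex_vector.subspace_0[OF subspace_range_power[of T p]]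
      funpow_cblinfun_linear_simps(4)[where T = T and n = k]
    by (metis bij_betw_def inj_on_def)
  have "null_power T p = null_power T (Suc p)"
  proof
    show "null_power T (Suc p) \<subseteq> null_power T p"
    proof
      fix x assume "x \<in> null_power T (Suc p)"
      then show "x \<in> null_power T p"
        using zero[of "(cblinfun_apply T ^^ p) x" 1] by (simp add: null_power_def range_power_def)
    qed
  qed (auto simp: null_power_def cblinfun_linear_simps)
  then have ex: "\<exists>n. null_power T n = null_power T (Suc n)" "\<exists>n. range_power T n = range_power T (Suc n)"
    using R by blast+
  define a where "a = (LEAST n. null_power T n = null_power T (Suc n))"
  define d where "d = (LEAST n. range_power T n = range_power T (Suc n))"
  have a: "null_power T a = null_power T (Suc a)" and d: "range_power T d = range_power T (Suc d)"
    using LeastI_ex[OF ex(1)] LeastI_ex[OF ex(2)] by (simp_all add: a_def d_def)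
  have dp: "d \<le> p" unfolding d_def using R by (rule Least_le)
  have stable: "range_power T (k + d) = range_power T d" for k
  proof (induction k)
    case (Suc k)
    then show ?case using d image_range_power[of T "k + d"] image_range_power[of T d] by simp
  qed simp
  have Rd: "range_power T d = range_power T p" using stable[of "p - d"] dp by simp
  have "a \<le> d"
    unfolding a_def
  proof (rule Least_le, rule equalityI)
    show "null_power T (Suc d) \<subseteq> null_power T d"
    proof
      fix x assume "x \<in> null_power T (Suc d)"
      moreover have "(cblinfun_apply T ^^ d) x \<in> range_power T p"
        unfolding Rd[symmetric] by (simp add: range_power_def)
      ultimately show "x \<in> null_power T d"
        using zero[of "(cblinfun_apply T ^^ d) x" 1] by (simp add: null_power_def)
    qed
  qed (auto simp: null_power_def cblinfun_linear_simps)
  moreover have "d \<le> a"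
    unfolding d_def
  proof (rule Least_le, rule equalityI)
    have null: "null_power T (k + a) = null_power T a" for k
    proof (induction k)
      case (Suc k)
      have "x \<in> null_power T (Suc k + a) \<longleftrightarrow> T x \<in> null_power T (k + a)" for x
        by (simp add: null_power_def funpow_swap1)
      moreover have "T x \<in> null_power T a \<longleftrightarrow> x \<in> null_power T (Suc a)" for x
        by (simp add: null_power_def funpow_swap1)
      ultimately show ?case using Suc a by blast
    qed simp
    show "range_power T a \<subseteq> range_power T (Suc a)"
    proof
      fix x assume "x \<in> range_power T a"
      then obtain y where y: "x = (cblinfun_apply T ^^ a) y" by (auto simp: range_power_def)
      have "(cblinfun_apply T ^^ (p + a)) y \<in> range_power T (p + a)" by (simp add: range_power_def)
      also have "range_power T (p + a) \<subseteq> range_power T (Suc (p + a))"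
        using stable[of "p + a - d"] stable[of "Suc (p + a) - d"] dp by simp
      finally obtain z where z: "(cblinfun_apply T ^^ (p + a)) y = (cblinfun_apply T ^^ Suc (p + a)) z"
        by (auto simp: range_power_def)
      have "(cblinfun_apply T ^^ Suc (p + a)) z = (cblinfun_apply T ^^ (p + a)) (T z)"
        by (simp add: funpow_swap1)
      then have "y - T z \<in> null_power T (p + a)"
        using z by (simp only: null_power_def mem_Collect_eq funpow_cblinfun_linear_simps) simp
      then have "(cblinfun_apply T ^^ a) (y - T z) = 0" using null[of p] unfolding null_power_def by blast
      then have "x = (cblinfun_apply T ^^ Suc a) z"
        by (simp add: y funpow_cblinfun_linear_simps funpow_swap1)
      then show "x \<in> range_power T (Suc a)" unfolding range_power_def by blast
    qed
  qed (rule range_power_Suc_subset)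
  ultimately have "a = d" by simp
  then show "ascent T = descent T \<and> descent T < \<infinity>"
    using ex by (simp add: ascent_def descent_def a_def d_def)
qed

lemma Pi_set_eq: "Pi_set T = {l. drazin_invertible (shifted T l)}"
  unfolding Pi_set_def ascent_eq_descent_iff_drazin_invertible ..

lemma b_weyl_if_weyl: "weyl T \<Longrightarrow> b_weyl T"
proof -
  assume T: "weyl T"
  then have 0: "b_fredholm_at T 0" by (simp add: b_fredholm_at_def range_power_0 weyl_def)
  then have "(LEAST n. b_fredholm_at T n) = 0" by (rule Least_eq_0)
  then show "b_weyl T"
    using T 0 by (auto simp: b_weyl_def b_fredholm_def b_index_def range_power_0 weyl_def)
qed

text \<open>The kernel of \<open>T\<^sup>p\<close> in the invariant subspace is finite dimensional, so replacing \<open>T\<close> by the identity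
there changes it by an operator of finite rank and makes it bijective.\<close>

lemma drazin_invertible_index_0:
  fixes T :: "'a::complex_banach \<Rightarrow>\<^sub>\<complex> 'a"
  assumes "drazin_invertible T" and fin: "finite_cdim {x \<in> range_power T m. T x = 0}"
  shows "fredholm_on (range_power T m) T" "index_on (range_power T m) T = 0"
proof -
  let ?M = "range_power T m"
  obtain p where p: "drazin_at T p" using assms(1) by (auto simp: drazin_invertible_def)
  obtain V :: "'a \<Rightarrow>\<^sub>\<complex> 'a" where comm: "\<And>x. V (T x) = T (V x)" and VTV: "\<And>x. V (T (V x)) = V x"
    and inv: "\<And>x. (cblinfun_apply T ^^ Suc p) (V x) = (cblinfun_apply T ^^ p) x"
    using drazin_inverse[OF p] by blast
  have VM: "V x \<in> ?M" if "x \<in> ?M" for x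
    using that funpow_commute[of V T m, OF comm] by (auto simp: range_power_def)
  note TM = range_power_invariant[of _ T m]
  note M = subspace_range_power[of T m]
  \<comment> \<open>\<open>T V\<close> is the projection onto the range of \<open>T\<^sup>p\<close> along the kernel of \<open>T\<^sup>p\<close>. \<open>G\<close> is \<open>T\<close> on the
    first and the identity on the second summand, \<open>G'\<close> is its inverse.\<close>
  define G where "G x = T (T (V x)) + x - T (V x)" for x
  define G' where "G' x = V x + x - T (V x)" for x
  have G: "clinear G"
    by (rule clinearI) (simp_all add: G_def cblinfun_linear_simps algebra_simps scaleC_add_right
        complex_vector.scale_right_diff_distrib)
  define F where "F k = {x \<in> ?M. (cblinfun_apply T ^^ k) x = 0}" for k
  have F: "complex_vector.subspace (F k)" for k
    unfolding F_def complex_vector.subspace_def using M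
    by (auto simp: funpow_cblinfun_linear_simps complex_vector.subspace_def)
  have finF: "finite_cdim (F k)" for k
  proof (induction k)
    case 0
    have "F 0 \<subseteq> complex_vector.span {}" by (auto simp: F_def)
    then show ?case unfolding finite_cdim_def by blast
  next
    case (Suc k)
    show ?case
    proof (rule finite_cdim_if_finite_kernel_and_image[OF clinear_cblinfun_apply F])
      show "finite_cdim {x \<in> F (Suc k). T x = 0}"
        by (rule finite_cdim_subset[OF fin]) (auto simp: F_def)
      show "finite_cdim (cblinfun_apply T ` F (Suc k))"
        by (rule finite_cdim_subset[OF Suc.IH]) (auto simp: F_def TM funpow_swap1)
    qed
  qed
  have bij: "bij_betw G ?M ?M"
  proof (rule bij_betw_byWitness[where f' = G'])
    show "\<forall>x\<in>?M. G' (G x) = x" "\<forall>x\<in>?M. G (G' x) = x"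
      using VTV by (simp_all add: G_def G'_def cblinfun_linear_simps comm)
    show "G ` ?M \<subseteq> ?M" "G' ` ?M \<subseteq> ?M"
      using VM TM by (auto simp: G_def G'_def intro!: complex_vector.subspace_add[OF M]
          complex_vector.subspace_diff[OF M])
  qed
  have diff: "T x - G x \<in> F p" if x: "x \<in> ?M" for x
  proof -
    have z: "(cblinfun_apply T ^^ p) (x - T (V x)) = 0"
      using inv[of x] by (simp add: funpow_cblinfun_linear_simps funpow_swap1)
    have "T x - G x = T (x - T (V x)) - (x - T (V x))"
      by (simp add: G_def cblinfun_linear_simps)
    moreover have "x - T (V x) \<in> F p"
      using x VM TM z complex_vector.subspace_diff[OF M] by (simp add: F_def)
    moreover have "T y \<in> F p" if "y \<in> F p" for y
      using that TM by (simp add: F_def funpow_swap1[symmetric] cblinfun_linear_simps)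
    ultimately show ?thesis using complex_vector.subspace_diff[OF F] by simp
  qed
  show "fredholm_on ?M T" "index_on ?M T = 0"
    using fredholm_index_0_if_finite_rank_perturbation[OF clinear_cblinfun_apply G M F finF _ bij diff]
    by (auto simp: F_def)
qed

lemma finite_cdim_kernel_if_fredholm_on: "fredholm_on M f \<Longrightarrow> finite_cdim {x \<in> M. f x = 0}"
  by (auto simp: fredholm_on_def nullity_on_def ecdim_def split: if_splits)

lemma b_weyl_if_drazin_invertible:
  fixes T :: "'a::complex_banach \<Rightarrow>\<^sub>\<complex> 'a"
  assumes "drazin_invertible T"
  shows "b_weyl T"
proof -
  obtain p where p: "drazin_at T p" using assms by (auto simp: drazin_invertible_def)
  have "{x \<in> range_power T p. T x = 0} \<subseteq> complex_vector.span {}"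
    using p complex_vector.subspace_0[OF subspace_range_power[of T p]] cblinfun_apply_zero[of T]
    by (auto simp: drazin_at_def bij_betw_def inj_on_def)
  then have "finite_cdim {x \<in> range_power T p. T x = 0}"
    unfolding finite_cdim_def by blast
  then have ex: "b_fredholm_at T p"
    unfolding b_fredholm_at_def
    using drazin_at_closed[OF p] drazin_invertible_index_0[OF assms] by blast
  \<comment> \<open>The index is taken at the least admissible exponent, which may be smaller than \<open>p\<close>.\<close>
  define n where "n = (LEAST n. b_fredholm_at T n)"
  have "b_fredholm_at T n" unfolding n_def using ex by (rule LeastI)
  then have "finite_cdim {x \<in> range_power T n. T x = 0}"
    by (simp add: b_fredholm_at_def finite_cdim_kernel_if_fredholm_on)
  then have "index_on (range_power T n) T = 0"
    using drazin_invertible_index_0[OF assms] by blast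
  then show ?thesis
    using ex by (auto simp: b_weyl_def b_fredholm_def b_index_def n_def)
qed

lemma weyl_if_drazin_invertible:
  fixes T :: "'a::complex_banach \<Rightarrow>\<^sub>\<complex> 'a"
  assumes "drazin_invertible T" "nullity T < \<infinity>"
  shows "weyl T"
  using drazin_invertible_index_0[OF assms(1), of 0] assms(2)
  by (auto simp: weyl_def range_power_0 nullity_def nullity_on_def ecdim_def split: if_splits)

section \<open>Punctured neighbourhoods\<close>

text \<open>For \<open>v \<noteq> 0\<close>, kernel and cokernel of \<open>T - v\<close> live in the range of every power of \<open>T\<close>: modulo the range
of \<open>T - v\<close>, the vector \<open>x\<close> is \<open>T\<^sup>n x\<close> up to a factor, and \<open>x\<close> can be recovered from \<open>T x\<close> and
\<open>(T - v) x\<close>.\<close>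

lemma shifted_reduces_to_range_power:
  fixes T :: "'a::complex_normed_vector \<Rightarrow>\<^sub>\<complex> 'a"
  assumes v: "v \<noteq> 0"
  shows "shifted T v x \<in> range_power T n \<Longrightarrow> x \<in> range_power T n"
    and "\<exists>y. x - shifted T v y \<in> range_power T n"
proof -
  have x_eq: "x = inverse v *\<^sub>C (T x - shifted T v x)" for x
    using v by (simp add: shifted_apply scaleC_scaleC)
  assume S: "shifted T v x \<in> range_power T n"
  have "x \<in> range_power T j" if "j \<le> n" for j
    using that
  proof (induction j)
    case (Suc j)
    have "T x \<in> range_power T (Suc j)" using Suc image_range_power[of T j] by auto
    moreover have "shifted T v x \<in> range_power T (Suc j)"
      using S range_power_antimono[OF Suc.prems] by blast
    ultimately show ?case
      using x_eq[of x] complex_vector.subspace_scale[OF subspace_range_power]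
        complex_vector.subspace_diff[OF subspace_range_power] by metis
  qed (simp add: range_power_0)
  then show "x \<in> range_power T n" by simp
next
  show "\<exists>y. x - shifted T v y \<in> range_power T n"
  proof (induction n)
    case (Suc n)
    then obtain y where y: "x - shifted T v y \<in> range_power T n" by blast
    define z where "z = x - shifted T v y"
    have "x - shifted T v (y - inverse v *\<^sub>C z) = z + inverse v *\<^sub>C shifted T v z"
      by (simp add: z_def cblinfun_linear_simps)
    also have "\<dots> = inverse v *\<^sub>C T z"
      using v by (simp add: shifted_apply complex_vector.scale_right_diff_distrib scaleC_scaleC)
    also have "\<dots> \<in> range_power T (Suc n)"
      unfolding image_range_power[symmetric] z_def using y
      by (intro complex_vector.subspace_scale[OF subspace_range_power[of T "Suc n", folded image_range_power]] imageI)
    finally show ?case by blast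
  qed (simp add: range_power_0)
qed

lemma weyl_shifted_if_index_0_on_range_power:
  fixes T :: "'a::complex_normed_vector \<Rightarrow>\<^sub>\<complex> 'a"
  assumes v: "v \<noteq> 0" and F: "fredholm_on (range_power T n) (shifted T v)"
    "index_on (range_power T n) (shifted T v) = 0"
  shows "weyl (shifted T v)"
proof -
  let ?M = "range_power T n"
  let ?f = "cblinfun_apply (shifted T v)"
  note M = subspace_range_power[of T n]
  obtain N C where N: "finite N" "complex_vector.independent N" "N \<subseteq> {x \<in> ?M. ?f x = 0}"
      "{x \<in> ?M. ?f x = 0} \<subseteq> complex_vector.span N" and C: "finite_quotient_basis ?M (?f ` ?M) C"
    and i: "index_on ?M ?f = int (card N) - int (card C)"
    using fredholm_onE[OF M clinear_cblinfun_apply F(1)] .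
  have ker: "{x \<in> UNIV. ?f x = 0} = {x \<in> ?M. ?f x = 0}"
    using shifted_reduces_to_range_power(1)[OF v, of T _ n] complex_vector.subspace_0[OF M] by auto
  have "finite_quotient_basis UNIV (range ?f) C"
    unfolding finite_quotient_basis_def
  proof (intro conjI allI impI ballI)
    show "finite C" using C by (simp add: finite_quotient_basis_def)
    fix c b assume r: "(\<Sum>b\<in>C. c b *\<^sub>C b) \<in> range ?f" and b: "b \<in> C"
    have "(\<Sum>b\<in>C. c b *\<^sub>C b) \<in> ?M"
      using C by (intro complex_vector.subspace_sum complex_vector.subspace_scale M)
        (auto simp: finite_quotient_basis_def)
    then have "(\<Sum>b\<in>C. c b *\<^sub>C b) \<in> ?f ` ?M"
      using r shifted_reduces_to_range_power(1)[OF v, of T _ n] by auto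
    then show "c b = 0" using C b unfolding finite_quotient_basis_def by blast
  next
    fix x
    obtain y where "x - ?f y \<in> ?M" using shifted_reduces_to_range_power(2)[OF v] by blast
    then obtain c where "x - ?f y - (\<Sum>b\<in>C. c b *\<^sub>C b) \<in> ?f ` ?M"
      using C unfolding finite_quotient_basis_def by blast
    then obtain z where "x - ?f y - (\<Sum>b\<in>C. c b *\<^sub>C b) = ?f z" by blast
    then have "x - (\<Sum>b\<in>C. c b *\<^sub>C b) = ?f (y + z)"
      by (simp only: cblinfun_apply_add) (simp add: algebra_simps)
    then show "\<exists>c. x - (\<Sum>b\<in>C. c b *\<^sub>C b) \<in> range ?f" by blast
  qed simp
  from fredholm_on_index[OF complex_vector.subspace_UNIV clinear_cblinfun_apply N(1,2) _ _ this]
  show ?thesis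
    using N i F(2) ker by (simp add: weyl_def)
qed

lemma bij_shifted_if_bij_betw_range_power:
  fixes T :: "'a::complex_normed_vector \<Rightarrow>\<^sub>\<complex> 'a"
  assumes v: "v \<noteq> 0" and bij: "bij_betw (shifted T v) (range_power T n) (range_power T n)"
  shows "bij (cblinfun_apply (shifted T v))"
proof (rule bijI)
  note M = subspace_range_power[of T n]
  let ?f = "cblinfun_apply (shifted T v)"
  show "inj ?f"
  proof (rule injI)
    fix x y assume "?f x = ?f y"
    then have z: "?f (x - y) = 0" by (simp add: cblinfun_apply_diff)
    then have "x - y \<in> range_power T n"
      using shifted_reduces_to_range_power(1)[OF v] complex_vector.subspace_0[OF M] by metis
    then have "x - y = 0"
      using z bij complex_vector.subspace_0[OF M] cblinfun_apply_zero[of "shifted T v"]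
      by (metis bij_betw_def inj_on_def)
    then show "x = y" by simp
  qed
  show "surj ?f"
  proof
    show "UNIV \<subseteq> range ?f"
    proof
      fix x
      obtain y where "x - ?f y \<in> range_power T n" using shifted_reduces_to_range_power(2)[OF v] by blast
      then obtain z where "x - ?f y = ?f z" using bij by (metis bij_betw_def imageE)
      then have "x = ?f (y + z)" by (simp only: cblinfun_apply_add) (simp add: algebra_simps)
      then show "x \<in> range ?f" by blast
    qed
  qed simp
qed

text \<open>\<open>T\<close> is bijective on the closed range of \<open>T\<^sup>p\<close>; this persists for \<open>T - v\<close> with small \<open>v\<close>, and for
\<open>v \<noteq> 0\<close> it extends to the whole space.\<close>

lemma drazin_invertible_punctured_resolvent:
  fixes T :: "'a::complex_banach \<Rightarrow>\<^sub>\<complex> 'a"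
  assumes "drazin_invertible T"
  obtains c where "c > 0" "\<And>v. v \<noteq> 0 \<Longrightarrow> cmod v < c \<Longrightarrow> bij (cblinfun_apply (shifted T v))"
proof -
  obtain p where p: "drazin_at T p" using assms by (auto simp: drazin_invertible_def)
  note M = subspace_range_power[of T p] drazin_at_closed[OF p] p[unfolded drazin_at_def]
  obtain c where c: "c > 0" "\<And>x. x \<in> range_power T p \<Longrightarrow> c * norm x \<le> norm (T x)"
    using bij_betw_bounded_below[OF bounded_clinear_cblinfun_apply M] by blast
  show ?thesis
  proof (rule that[OF c(1)])
    fix v :: complex assume "v \<noteq> 0" "cmod v < c"
    then show "bij (cblinfun_apply (shifted T v))"
      using bij_betw_diff_small_scalar[OF clinear_cblinfun_apply M c(2)]
      by (intro bij_shifted_if_bij_betw_range_power[of v T p]) (auto simp: shifted_apply)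
  qed
qed

text \<open>On the range of \<open>T\<^sup>n\<close> add an operator of finite rank to make \<open>T\<close> bijective. The sum stays bijective
when a small \<open>v\<close> is subtracted, so \<open>T - v\<close> has index 0 there, and hence everywhere if \<open>v \<noteq> 0\<close>.\<close>

lemma b_weyl_punctured_weyl:
  fixes T :: "'a::complex_banach \<Rightarrow>\<^sub>\<complex> 'a"
  assumes "b_weyl T"
  obtains c where "c > 0" "\<And>v. v \<noteq> 0 \<Longrightarrow> cmod v < c \<Longrightarrow> weyl (shifted T v)"
proof -
  define n where "n = (LEAST n. b_fredholm_at T n)"
  let ?M = "range_power T n"
  have "b_fredholm_at T n"
    using assms LeastI_ex[of "b_fredholm_at T"] by (simp add: b_weyl_def b_fredholm_def n_def)
  then have closed: "closed ?M" and F: "fredholm_on ?M T" by (simp_all add: b_fredholm_at_def)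
  note M = subspace_range_power[of T n]
  obtain N C where N: "finite N" "complex_vector.independent N" "N \<subseteq> {x \<in> ?M. T x = 0}"
      "{x \<in> ?M. T x = 0} \<subseteq> complex_vector.span N" and C: "finite_quotient_basis ?M (T ` ?M) C"
    and i: "index_on ?M T = int (card N) - int (card C)"
    using fredholm_onE[OF M clinear_cblinfun_apply F] .
  have CM: "finite C" "C \<subseteq> ?M" using C by (auto simp: finite_quotient_basis_def)
  have "card N = card C"
    using assms i by (simp add: b_weyl_def b_index_def n_def)
  then obtain \<pi> where pi: "bij_betw \<pi> N C"
    using finite_same_card_bij[OF N(1) CM(1)] by blast
  obtain \<phi> :: "'a \<Rightarrow> 'a \<Rightarrow>\<^sub>\<complex> complex"
    where phi: "\<And>b b'. b \<in> N \<Longrightarrow> b' \<in> N \<Longrightarrow> \<phi> b b' = (if b = b' then 1 else 0)"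
    using dual_functionals[OF N(1,2)] by blast
  define K where "K x = (\<Sum>b\<in>N. \<phi> b x *\<^sub>C \<pi> b)" for x
  have K: "K = cblinfun_apply (\<Sum>b\<in>N. rank_one (\<pi> b) (\<phi> b))"
    by (auto simp: K_def sum_cblinfun_apply rank_one.rep_eq)
  have bcK: "bounded_clinear K"
    unfolding K by (rule bounded_clinear_cblinfun_apply)
  define G where "G x = T x + K x" for x
  have "bij_betw (\<lambda>x. T x + (\<Sum>b\<in>N. cblinfun_apply (\<phi> b) x *\<^sub>C \<pi> b)) ?M ?M"
    by (rule bij_betw_finite_rank_correction[OF clinear_cblinfun_apply M _ N(1,3,4) C pi
          clinear_cblinfun_apply phi]) (auto simp: range_power_invariant)
  then have G: "bij_betw G ?M ?M" by (simp add: G_def[abs_def] K_def)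
  have bcG: "bounded_clinear G"
    using bcK bounded_clinear_cblinfun_apply[of T] unfolding G_def bounded_clinear_def
    by (auto intro: bounded_linear_add simp: scaleC_add_right)
  note cG = bounded_clinear_clinear[OF bcG]
  obtain c where c: "c > 0" "\<And>x. x \<in> ?M \<Longrightarrow> c * norm x \<le> norm (G x)"
    using bij_betw_bounded_below[OF bcG M closed G] by blast
  have KC: "K x \<in> complex_vector.span C" for x
    unfolding K_def using pi
    by (intro complex_vector.span_sum complex_vector.span_scale complex_vector.span_base)
      (auto simp: bij_betw_def)
  show ?thesis
  proof (rule that[OF c(1)])
    fix v :: complex assume v: "v \<noteq> 0" "cmod v < c"
    have bijv: "bij_betw (\<lambda>x. G x - v *\<^sub>C x) ?M ?M"
      using bij_betw_diff_small_scalar[OF cG M closed G c(2) v(2)] .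
    interpret G: Vector_Spaces.linear scaleC scaleC G by (rule cG)
    have Gv: "clinear (\<lambda>x. G x - v *\<^sub>C x)"
      by (rule clinearI) (simp_all add: G.add G.scale scaleC_add_right scaleC_scaleC
          complex_vector.scale_right_diff_distrib mult.commute)
    have span: "complex_vector.span C \<subseteq> ?M" "finite_cdim (complex_vector.span C)"
      using CM M complex_vector.span_minimal by (blast, auto simp: finite_cdim_def)
    have diff: "shifted T v x - (G x - v *\<^sub>C x) \<in> complex_vector.span C" for x
      using complex_vector.span_neg[OF KC[of x]] by (simp add: shifted_apply G_def)
    show "weyl (shifted T v)"
      by (rule weyl_shifted_if_index_0_on_range_power[OF v(1)];
          rule fredholm_index_0_if_finite_rank_perturbation[OF clinear_cblinfun_apply Gv M
            complex_vector.subspace_span span(2,1) bijv diff])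
  qed
qed

section \<open>B-Fredholm operators near the resolvent set\<close>

text \<open>If \<open>C\<close> spans the range of \<open>T\<^sup>n\<close> modulo the range of \<open>T\<^sup>n\<^sup>+\<^sup>1\<close>, then \<open>T\<^sup>j ` C\<close> spans the range of
\<open>T\<^sup>n\<^sup>+\<^sup>j\<close> modulo the next one, which is therefore closed.\<close>

lemma closed_range_power_if_b_fredholm_at:
  fixes T :: "'a::complex_banach \<Rightarrow>\<^sub>\<complex> 'a"
  assumes "b_fredholm_at T n"
  shows "closed (range_power T (n + j))"
proof (induction j)
  case 0
  then show ?case using assms by (simp add: b_fredholm_at_def)
next
  case (Suc j)
  let ?M = "range_power T n" and ?D = "range_power T (n + j)"
  let ?p = "cblinfun_apply T ^^ j"
  interpret p: Vector_Spaces.linear scaleC scaleC ?p by (rule clinear_funpow)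
  interpret T: Vector_Spaces.linear scaleC scaleC "cblinfun_apply T" by (rule clinear_cblinfun_apply)
  have "fredholm_on ?M T" using assms by (simp add: b_fredholm_at_def)
  then obtain C where C: "finite_quotient_basis ?M (T ` ?M) C"
    using fredholm_onE[OF subspace_range_power clinear_cblinfun_apply] by blast
  then have CM: "finite C" "C \<subseteq> ?M" by (auto simp: finite_quotient_basis_def)
  define F where "F = complex_vector.span (?p ` C)"
  note D = subspace_range_power[of T "n + j"]
  have pM: "?p ` ?M = ?D" by (simp add: funpow_image_range_power add.commute)
  have FD: "F \<subseteq> ?D"
    unfolding F_def using CM pM by (intro complex_vector.span_minimal D) blast
  have "{T x + y |x y. x \<in> ?D \<and> y \<in> F} = ?D"
  proof (intro equalityI subsetI)
    fix z assume "z \<in> {T x + y |x y. x \<in> ?D \<and> y \<in> F}"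
    then show "z \<in> ?D" using FD D by (auto intro: complex_vector.subspace_add range_power_invariant)
  next
    fix d assume "d \<in> ?D"
    then obtain m where m: "m \<in> ?M" "d = ?p m" using pM by blast
    then obtain c where "m - (\<Sum>b\<in>C. c b *\<^sub>C b) \<in> T ` ?M"
      using C unfolding finite_quotient_basis_def by blast
    then obtain u where u: "u \<in> ?M" "m - (\<Sum>b\<in>C. c b *\<^sub>C b) = T u" by blast
    then have "m = T u + (\<Sum>b\<in>C. c b *\<^sub>C b)" by (simp add: algebra_simps)
    then have "d = T (?p u) + (\<Sum>b\<in>C. c b *\<^sub>C ?p b)"
      by (simp add: m p.add p.sum p.scale funpow_swap1)
    moreover have "?p u \<in> ?D" using u pM by blast
    moreover have "(\<Sum>b\<in>C. c b *\<^sub>C ?p b) \<in> F"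
      unfolding F_def
      by (intro complex_vector.span_sum complex_vector.span_scale complex_vector.span_base imageI)
    ultimately show "d \<in> {T x + y |x y. x \<in> ?D \<and> y \<in> F}" by blast
  qed
  then have sum: "closed {T x + y |x y. x \<in> ?D \<and> y \<in> F}" using Suc by simp
  have sF: "complex_vector.subspace F" by (simp add: F_def)
  have fF: "finite_cdim F" unfolding finite_cdim_def F_def using CM by blast
  have "closed (T ` ?D \<inter> F)"
    by (rule closed_if_finite_cdim[OF complex_vector.subspace_inter[OF T.subspace_image[OF D] sF]
          finite_cdim_subset[OF fF]]) simp
  from closed_image_if_complemented[OF bounded_linear_cblinfun_apply
      real_subspace_if_complex_subspace[OF D] Suc real_subspace_if_complex_subspace[OF sF]
      closed_if_finite_cdim[OF sF fF] sum this]
  show ?case by (simp add: image_range_power)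
qed

text \<open>Since \<open>T\<close> maps \<open>M\<close> onto \<open>M\<close>, vectors have preimages of controlled norm, and this bounds the
resolvents \<open>(T - v)\<^sup>-\<^sup>1\<close> on \<open>M\<close> uniformly for small \<open>v\<close>. On a kernel vector, however, the resolvent acts
as \<open>- 1 / v\<close>.\<close>

lemma injective_if_surjective_and_resolvent_nearby:
  fixes T :: "'a::complex_banach \<Rightarrow>\<^sub>\<complex> 'a"
  assumes M: "complex_vector.subspace M" "closed M" and onto: "T ` M = M"
    and near: "\<And>e. e > 0 \<Longrightarrow> \<exists>v. cmod v < e \<and> bij (cblinfun_apply (shifted T v))
        \<and> bij_betw (shifted T v) M M"
    and x: "x \<in> M" "T x = 0"
  shows "x = 0"
proof (rule ccontr)
  assume x0: "x \<noteq> 0"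
  obtain c where c: "c > 0" "\<And>y. y \<in> M \<Longrightarrow> \<exists>x\<in>M. T x = y \<and> norm x \<le> c * norm y"
    using open_mapping_on_subspace[OF bounded_linear_cblinfun_apply[of T]
        real_subspace_if_complex_subspace[OF M(1)] M(2)] onto M(2) by metis
  obtain v where v: "cmod v < 1 / (2 * c)" and bij: "bij (cblinfun_apply (shifted T v))"
    and bijM: "bij_betw (shifted T v) M M"
    using near[of "1 / (2 * c)"] c by auto
  obtain R where R: "R o\<^sub>C shifted T v = id_cblinfun" "shifted T v o\<^sub>C R = id_cblinfun"
    using bij_imp_inverse[OF bij] .
  have RT: "R (shifted T v y) = y" "shifted T v (R y) = y" for y
    using R by (metis cblinfun_compose.rep_eq id_cblinfun.rep_eq)+
  have RM: "R y \<in> M" if "y \<in> M" for y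
    using bijM RT(1) that by (metis bij_betw_def imageE)
  \<comment> \<open>The norm of the resolvent on \<open>M\<close>.\<close>
  define r where "r = (SUP y\<in>{y \<in> M. norm y \<le> 1}. norm (R y))"
  have bdd: "bdd_above ((\<lambda>y. norm (R y)) ` {y \<in> M. norm y \<le> 1})"
  proof (rule bdd_aboveI2)
    fix y assume "y \<in> {y \<in> M. norm y \<le> 1}"
    then show "norm (R y) \<le> norm R"
      using order_trans[OF norm_cblinfun[of R y] mult_left_mono[of "norm y" 1 "norm R"]] by simp
  qed
  have r: "norm (R y) \<le> r * norm y" if "y \<in> M" for y
  proof (cases "y = 0")
    case False
    define z where "z = (1 / norm y) *\<^sub>R y"
    have "z \<in> {y \<in> M. norm y \<le> 1}"
      using that False subspace_scale[OF real_subspace_if_complex_subspace[OF M(1)]] by (simp add: z_def)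
    then have "norm (R z) \<le> r" unfolding r_def by (intro cSUP_upper bdd)
    then show ?thesis
      using False by (simp add: z_def linear_simps[OF bounded_linear_cblinfun_apply] pos_divide_le_eq)
  qed (simp add: cblinfun_linear_simps)
  have "r \<le> c + cmod v * r * c"
    unfolding r_def
  proof (rule cSUP_least)
    show "{y \<in> M. norm y \<le> 1} \<noteq> {}" using complex_vector.subspace_0[OF M(1)] by force
    fix y assume y: "y \<in> {y \<in> M. norm y \<le> 1}"
    then obtain w where w: "w \<in> M" "T w = y" "norm w \<le> c * norm y" using c by blast
    have wc: "norm w \<le> c" using y c(1) by (intro order_trans[OF w(3)] mult_left_le) auto
    have r0: "0 \<le> r"
    proof -
      have "norm (R 0) \<le> r" unfolding r_def
        by (intro cSUP_upper bdd) (simp add: complex_vector.subspace_0[OF M(1)])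
      then show ?thesis by (simp add: cblinfun_linear_simps)
    qed
    have "y = shifted T v w + v *\<^sub>C w" using w by (simp add: shifted_apply)
    then have "R y = w + v *\<^sub>C R w" by (simp add: cblinfun_apply_add cblinfun_apply_scaleC RT)
    then have "norm (R y) \<le> norm w + cmod v * norm (R w)"
      using norm_triangle_ineq[of w "v *\<^sub>C R w"] by (simp add: norm_scaleC)
    also have "\<dots> \<le> c + cmod v * (r * c)"
      using wc r[OF w(1)] r0 mult_left_mono[OF wc r0]
      by (intro add_mono mult_left_mono) auto
    finally show "norm (R y) \<le> c + cmod v * (SUP y\<in>{y \<in> M. norm y \<le> 1}. norm (R y)) * c"
      by (simp add: r_def mult.assoc)
  qed
  moreover have vc: "cmod v * c < 1 / 2" using v c(1) by (simp add: field_simps)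
  ultimately have r2: "r \<le> 2 * c"
  proof -
    have r0: "0 \<le> r" using r[OF x(1)] x0 norm_ge_zero[of "R x"]
      by (meson norm_ge_zero order_trans zero_le_mult_iff zero_less_norm_iff not_le)
    have "cmod v * c * r \<le> 1 / 2 * r" using vc r0 by (intro mult_right_mono) auto
    then show ?thesis using \<open>r \<le> c + cmod v * r * c\<close> by (simp add: mult_ac)
  qed
  have "shifted T v x = (- v) *\<^sub>C x" using x by (simp add: shifted_apply)
  then have "x = (- v) *\<^sub>C R x" using RT(1)[of x] by (simp only: cblinfun_apply_scaleC)
  then have "norm x = cmod v * norm (R x)" by (metis norm_scaleC norm_minus_cancel)
  also have "\<dots> \<le> cmod v * (2 * c * norm x)"
    using order_trans[OF r[OF x(1)] mult_right_mono[OF r2 norm_ge_zero]] by (intro mult_left_mono) auto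
  also have "\<dots> = (2 * (cmod v * c)) * norm x" by simp
  also have "\<dots> < 1 * norm x" using vc x0 by (intro mult_strict_right_mono) auto
  finally show False by simp
qed

text \<open>On the intersection \<open>M\<close> of all ranges, \<open>T\<close> is onto because its kernel in these ranges is finite
dimensional; with resolvent points nearby it is also injective on \<open>M\<close>. As the kernels stabilize, \<open>T\<close>
is injective already on the range of a power. That range is closed, as is its image, so \<open>T\<close> is
bounded below on it, and being a limit of bijections it is bijective there.\<close>

theorem drazin_invertible_if_b_fredholm_and_resolvent_nearby:
  fixes T :: "'a::complex_banach \<Rightarrow>\<^sub>\<complex> 'a"
  assumes "b_fredholm T"
    and near: "\<And>e. e > 0 \<Longrightarrow> \<exists>v. cmod v < e \<and> bij (cblinfun_apply (shifted T v))"
  shows "drazin_invertible T"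
proof -
  obtain n where n: "b_fredholm_at T n" using assms(1) by (auto simp: b_fredholm_def)
  define D where "D j = range_power T (n + j)" for j
  have D: "complex_vector.subspace (D j)" "closed (D j)" for j
    by (simp_all add: D_def subspace_range_power closed_range_power_if_b_fredholm_at[OF n])
  have TD: "T ` D j = D (Suc j)" for j by (simp add: D_def image_range_power)
  have anti: "D j \<subseteq> D i" if "i \<le> j" for i j using that by (simp add: D_def range_power_antimono)
  have bijD: "bij_betw (shifted T v) (D j) (D j)" if "bij (cblinfun_apply (shifted T v))" for v j
    unfolding D_def using shifted_commute that by (rule bij_betw_range_power_if_commute)
  define V where "V j = {x \<in> D j. T x = 0}" for j
  have "complex_vector.subspace (V j)" for j
    using D(1)[of j] by (auto simp: V_def complex_vector.subspace_def cblinfun_linear_simps)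
  moreover have "V (Suc j) \<subseteq> V j" for j using anti[of j "Suc j"] by (auto simp: V_def)
  moreover have "finite_cdim (V 0)"
    using n by (simp add: V_def D_def b_fredholm_at_def finite_cdim_kernel_if_fredholm_on)
  ultimately obtain k where k: "\<And>j. j \<ge> k \<Longrightarrow> V j = V k"
    using decreasing_finite_dim_subspaces_stabilize by blast
  define M where "M = (\<Inter>j. D j)"
  have M: "complex_vector.subspace M" "closed M"
    unfolding M_def using D by (auto intro: complex_vector.subspace_Inter)
  \<comment> \<open>Since the kernels in \<open>D j\<close> stabilize at \<open>k\<close>, the last one lies in the intersection \<open>M\<close>.\<close>
  have VM: "V k \<subseteq> M"
  proof
    fix x assume x: "x \<in> V k"
    have "x \<in> D j" for j
    proof (cases "j \<le> k")
      case True
      then show ?thesis using x anti by (auto simp: V_def)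
    next
      case False
      then have "x \<in> V j" using x k[of j] by simp
      then show ?thesis by (simp add: V_def)
    qed
    then show "x \<in> M" by (simp add: M_def)
  qed
  have onto: "T ` M = M"
  proof
    have "T x \<in> D j" if "x \<in> M" for x j
      using that TD[of j] anti[of j "Suc j"] by (auto simp: M_def)
    then show "T ` M \<subseteq> M" by (auto simp: M_def)
    show "M \<subseteq> T ` M"
    proof
      fix y assume y: "y \<in> M"
      have "\<exists>x\<in>D j. T x = y" for j
      proof -
        have "y \<in> D (Suc j)" using y by (simp add: M_def)
        then show ?thesis unfolding TD[symmetric] by blast
      qed
      then obtain x where x: "\<And>j. x j \<in> D j" "\<And>j. T (x j) = y" by metis
      \<comment> \<open>Two preimages differ by an element of the stable kernel, so \<open>x k\<close> lies in every \<open>D j\<close>.\<close>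
      have "x k \<in> D j" for j
      proof (cases "j \<le> k")
        case True
        then show ?thesis using x(1)[of k] anti by blast
      next
        case False
        then have "x j \<in> D k" using x(1)[of j] anti[of k j] by auto
        then have "x j - x k \<in> V k"
          using x complex_vector.subspace_diff[OF D(1)] by (simp add: V_def cblinfun_linear_simps)
        then have "x j - x k \<in> V j" using k[of j] False by simp
        then have "x j - (x j - x k) \<in> D j"
          using x(1)[of j] complex_vector.subspace_diff[OF D(1), of "x j" j "x j - x k"]
          by (simp add: V_def)
        then show ?thesis by simp
      qed
      then have "x k \<in> M" by (simp add: M_def)
      then show "y \<in> T ` M" using x(2)[of k] by blast
    qed
  qed
  have bijM: "bij_betw (shifted T v) M M" if bij: "bij (cblinfun_apply (shifted T v))" for v
    unfolding bij_betw_def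
  proof
    show "inj_on (shifted T v) M" using bij by (meson bij_is_inj inj_on_subset subset_UNIV)
    have "shifted T v ` (\<Inter>j\<in>UNIV. D j) = (\<Inter>j\<in>UNIV. shifted T v ` D j)"
      using bij by (intro image_INT[of "cblinfun_apply (shifted T v)" UNIV UNIV D]) (auto simp: bij_is_inj)
    then show "shifted T v ` M = M"
      using bijD[OF bij] by (simp add: M_def bij_betw_def)
  qed
  have zero: "x = 0" if "x \<in> M" "T x = 0" for x
    using injective_if_surjective_and_resolvent_nearby[OF M onto _ that] near bijM by blast
  have inj: "inj_on T (D k)"
  proof (rule inj_onI)
    fix x y assume "x \<in> D k" "y \<in> D k" "T x = T y"
    then have "x - y \<in> V k"
      using complex_vector.subspace_diff[OF D(1)] by (simp add: V_def cblinfun_linear_simps)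
    then have "x - y \<in> M" "T (x - y) = 0" using VM by (auto simp: V_def)
    then have "x - y = 0" by (rule zero)
    then show "x = y" by simp
  qed
  have "closed (T ` D k)" using D(2) by (simp add: TD)
  then obtain c where c: "c > 0" "\<And>x. x \<in> D k \<Longrightarrow> c * norm x \<le> norm (T x)"
    using injective_bounded_below[OF bounded_clinear_cblinfun_apply D inj] by blast
  have "bij_betw T (D k) (D k)"
  proof (rule bij_betw_if_bounded_below_limit[OF clinear_cblinfun_apply D c])
    fix e :: real assume "e > 0"
    then obtain v where v: "cmod v < e" "bij (cblinfun_apply (shifted T v))" using near by blast
    then show "\<exists>v. cmod v < e \<and> bij_betw (\<lambda>x. T x - v *\<^sub>C x) (D k) (D k)"
      using bijD[OF v(2), of k] unfolding shifted_apply by blast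
  qed
  then show ?thesis unfolding drazin_invertible_def drazin_at_def D_def by blast
qed

section \<open>Composition operators and duality\<close>

lemma dual_operator_apply: "cblinfun_apply (dual_operator A) f = f o\<^sub>C A"
  by (simp add: dual_operator.rep_eq)

lemma right_mult_apply: "cblinfun_apply (right_mult A) U = U o\<^sub>C A"
  by (simp add: right_mult.rep_eq)

lemma cblinfun_compose_assoc: "(f o\<^sub>C g) o\<^sub>C h = f o\<^sub>C (g o\<^sub>C h)"
  by (rule cblinfun_eqI) (simp add: cblinfun_simps)

lemma cblinfun_compose_id: "f o\<^sub>C id_cblinfun = f" "id_cblinfun o\<^sub>C f = f"
  by (rule cblinfun_eqI, simp add: cblinfun_simps)+

lemma shifted_dual_operator: "shifted (dual_operator A) v = dual_operator (shifted A v)"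
  by (rule cblinfun_eqI)+ (simp add: cblinfun_simps cblinfun_linear_simps dual_operator_apply)

lemma shifted_right_mult: "shifted (right_mult A) v = right_mult (shifted A v)"
  by (rule cblinfun_eqI)+ (simp add: cblinfun_simps cblinfun_linear_simps right_mult_apply)

lemma cblinfun_power_commute: "cblinfun_power A n o\<^sub>C A = A o\<^sub>C cblinfun_power A n"
  by (induction n) (simp_all add: cblinfun_compose_id cblinfun_compose_assoc)

lemma funpow_dual_operator:
  "(cblinfun_apply (dual_operator A) ^^ n) f = f o\<^sub>C cblinfun_power A n"
  by (induction n) (simp_all add: dual_operator_apply cblinfun_compose_id cblinfun_compose_assoc
      cblinfun_power_commute)

lemma funpow_right_mult:
  "(cblinfun_apply (right_mult A) ^^ n) U = U o\<^sub>C cblinfun_power A n"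
  by (induction n) (simp_all add: right_mult_apply cblinfun_compose_id cblinfun_compose_assoc
      cblinfun_power_commute)

lemma bij_dual_operator:
  fixes A :: "'a::complex_banach \<Rightarrow>\<^sub>\<complex> 'a"
  assumes "bij (cblinfun_apply A)"
  shows "bij (cblinfun_apply (dual_operator A))"
proof -
  obtain B where "B o\<^sub>C A = id_cblinfun" "A o\<^sub>C B = id_cblinfun" using bij_imp_inverse[OF assms] .
  then have "dual_operator B (dual_operator A f) = f" "dual_operator A (dual_operator B f) = f" for f
    by (simp_all add: dual_operator_apply cblinfun_compose_assoc cblinfun_compose_id)
  then show ?thesis
    by (intro bij_betw_byWitness[where f' = "cblinfun_apply (dual_operator B)"]) auto
qed

lemma bij_right_mult_iff:
  fixes A :: "'a::complex_banach \<Rightarrow>\<^sub>\<complex> 'a"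
  shows "bij (cblinfun_apply (right_mult A)) \<longleftrightarrow> bij (cblinfun_apply A)"
proof
  assume "bij (cblinfun_apply A)"
  then obtain B where "B o\<^sub>C A = id_cblinfun" "A o\<^sub>C B = id_cblinfun" using bij_imp_inverse by blast
  then have "right_mult B (right_mult A U) = U" "right_mult A (right_mult B U) = U" for U
    by (simp_all add: right_mult_apply cblinfun_compose_assoc cblinfun_compose_id)
  then show "bij (cblinfun_apply (right_mult A))"
    by (intro bij_betw_byWitness[where f' = "cblinfun_apply (right_mult B)"]) auto
next
  assume bij: "bij (cblinfun_apply (right_mult A))"
  then obtain U where U: "U o\<^sub>C A = id_cblinfun"
    by (metis bij_is_surj right_mult_apply surjD)
  have "right_mult A (A o\<^sub>C U) = right_mult A id_cblinfun"
    by (simp add: right_mult_apply cblinfun_compose_assoc U cblinfun_compose_id)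
  then have "A o\<^sub>C U = id_cblinfun" using bij by (meson bij_is_inj injD)
  then show "bij (cblinfun_apply A)" by (rule bij_if_inverse[OF U])
qed

text \<open>Both operators compose with \<open>A\<close> from the right, so composition with the Drazin inverse of \<open>A\<close> from
the right is a Drazin inverse.\<close>

lemma drazin_invertible_dual_and_right_mult:
  fixes A :: "'a::complex_banach \<Rightarrow>\<^sub>\<complex> 'a"
  assumes "drazin_invertible A"
  shows "drazin_invertible (dual_operator A)" "drazin_invertible (right_mult A)"
proof -
  obtain p where p: "drazin_at A p" using assms by (auto simp: drazin_invertible_def)
  obtain V :: "'a \<Rightarrow>\<^sub>\<complex> 'a" where comm: "\<And>x. V (A x) = A (V x)"
    and "\<And>x. V (A (V x)) = V x"
    and inv: "\<And>x. (cblinfun_apply A ^^ Suc p) (V x) = (cblinfun_apply A ^^ p) x"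
    using drazin_inverse[OF p] by blast
  have VA: "V o\<^sub>C A = A o\<^sub>C V" by (rule cblinfun_eqI) (simp add: cblinfun_simps comm)
  have "V o\<^sub>C cblinfun_power A (Suc p) = cblinfun_power A p"
    by (rule cblinfun_eqI)
      (simp only: cblinfun_compose.rep_eq cblinfun_power_apply funpow_commute[of V A, OF comm] inv)
  then have VAp: "V o\<^sub>C (A o\<^sub>C cblinfun_power A p) = cblinfun_power A p" by simp
  have "drazin_at (dual_operator A) p"
    by (rule drazin_at_if_inverse[of "dual_operator V"])
      (simp_all only: funpow_dual_operator dual_operator_apply cblinfun_compose_assoc VA
        cblinfun_power.simps VAp)
  then show "drazin_invertible (dual_operator A)" by (auto simp: drazin_invertible_def)
  have "drazin_at (right_mult A) p"
    by (rule drazin_at_if_inverse[of "right_mult V"])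
      (simp_all only: funpow_right_mult right_mult_apply cblinfun_compose_assoc VA
        cblinfun_power.simps VAp)
  then show "drazin_invertible (right_mult A)" by (auto simp: drazin_invertible_def)
qed

text \<open>Test with a norming functional \<open>f\<close> of \<open>A\<^sup>p x\<close>: its value there is the value of \<open>V f\<close> at \<open>A\<^sup>p\<^sup>+\<^sup>1 x\<close>.
This gives a lower bound for \<open>A\<close> on the range of \<open>A\<^sup>p\<close>, although \<open>V\<close> need not be the adjoint of an
operator.\<close>

lemma funpow_bounded_below_if_dual_solvable:
  fixes A :: "'a::complex_banach \<Rightarrow>\<^sub>\<complex> 'a"
  assumes inv: "\<And>f. (cblinfun_apply (dual_operator A) ^^ Suc p) (cblinfun_apply V f)
      = (cblinfun_apply (dual_operator A) ^^ p) f"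
  shows "norm ((cblinfun_apply A ^^ p) x) \<le> norm V * norm ((cblinfun_apply A ^^ Suc p) x)"
proof -
  let ?y = "(cblinfun_apply A ^^ p) x"
  obtain f :: "'a \<Rightarrow>\<^sub>\<complex> complex" where f: "\<And>z. cmod (f z) \<le> norm z" "f ?y = of_real (norm ?y)"
    using norming_functional by blast
  have "norm f \<le> 1" by (rule norm_cblinfun_bound) (simp_all add: f)
  have "f ?y = (f o\<^sub>C cblinfun_power A p) x" by (simp add: cblinfun_simps cblinfun_power_apply)
  also have "\<dots> = V f ((cblinfun_apply A ^^ Suc p) x)"
    using inv[of f, symmetric] unfolding funpow_dual_operator
    by (simp add: cblinfun_compose.rep_eq cblinfun_power_apply)
  finally have "norm ?y = cmod (V f ((cblinfun_apply A ^^ Suc p) x))"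
    using f(2) by (metis abs_norm_cancel norm_of_real)
  also have "\<dots> \<le> norm (V f) * norm ((cblinfun_apply A ^^ Suc p) x)" by (rule norm_cblinfun)
  also have "\<dots> \<le> norm V * norm ((cblinfun_apply A ^^ Suc p) x)"
  proof (rule mult_right_mono)
    have "norm (V f) \<le> norm V * norm f" by (rule norm_cblinfun)
    also have "\<dots> \<le> norm V * 1" using \<open>norm f \<le> 1\<close> by (intro mult_left_mono) auto
    finally show "norm (V f) \<le> norm V" by simp
  qed simp
  finally show ?thesis .
qed

lemma bij_if_bij_dual_operator:
  fixes A :: "'a::complex_banach \<Rightarrow>\<^sub>\<complex> 'a"
  assumes bij: "bij (cblinfun_apply (dual_operator A))"
  shows "bij (cblinfun_apply A)"
proof -
  obtain V where "V o\<^sub>C dual_operator A = id_cblinfun" "dual_operator A o\<^sub>C V = id_cblinfun"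
    using bij_imp_inverse[OF bij] .
  then have V: "dual_operator A (V f) = f" for f
    by (metis cblinfun_compose.rep_eq id_cblinfun.rep_eq)
  have below: "norm x \<le> norm V * norm (A x)" for x
    using funpow_bounded_below_if_dual_solvable[of 0 A V x] V by simp
  have inj: "inj (cblinfun_apply A)"
  proof (rule injI)
    fix x y assume "A x = A y"
    then show "x = y" using below[of "x - y"] by (simp add: cblinfun_linear_simps)
  qed
  have sub: "complex_vector.subspace (range (cblinfun_apply A))"
    using subspace_range_power[of A 1] by (simp add: range_power_def)
  have "complete (range (cblinfun_apply A))"
  proof (rule complete_isometric_image[of "1 / (norm V + 1)"])
    show "0 < 1 / (norm V + 1)" by (simp add: add_nonneg_pos)
    have "norm x \<le> norm (A x) * (norm V + 1)" for x
      by (rule order_trans[OF below[of x]]) (simp add: algebra_simps)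
    then show "\<forall>x\<in>UNIV. norm (A x) \<ge> 1 / (norm V + 1) * norm x"
      by (simp add: add_nonneg_pos pos_divide_le_eq)
  qed (simp_all add: bounded_linear_cblinfun_apply complete_UNIV)
  then have closed: "closed (range (cblinfun_apply A))" by (rule complete_imp_closed)
  have "surj (cblinfun_apply A)"
  proof (rule ccontr)
    assume "\<not> surj (cblinfun_apply A)"
    then obtain y where "y \<notin> range (cblinfun_apply A)" by auto
    then obtain f :: "'a \<Rightarrow>\<^sub>\<complex> complex" where f: "\<And>w. w \<in> range (cblinfun_apply A) \<Longrightarrow> f w = 0" "f y = 1"
      using separating_functional[OF sub closed] by blast
    have "dual_operator A f = dual_operator A 0"
      by (rule cblinfun_eqI) (simp add: dual_operator_apply cblinfun_simps f)
    then have "f = 0" using bij by (meson bij_is_inj injD)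
    then show False using f(2) by (simp add: cblinfun_simps)
  qed
  then show ?thesis using inj by (simp add: bij_def)
qed

lemma bij_dual_operator_iff:
  fixes A :: "'a::complex_banach \<Rightarrow>\<^sub>\<complex> 'a"
  shows "bij (cblinfun_apply (dual_operator A)) \<longleftrightarrow> bij (cblinfun_apply A)"
  using bij_dual_operator bij_if_bij_dual_operator by blast

text \<open>By the previous estimate \<open>A\<close> is bounded below on the closure \<open>W\<close> of the range of \<open>A\<^sup>p\<close>. The
resolvent points of \<open>A\<^sup>*\<close> near 0 are resolvent points of \<open>A\<close>, so \<open>A\<close> is a limit of bijections of \<open>W\<close>
and hence bijective on \<open>W\<close>. Then \<open>A\<^sup>p\<close> maps \<open>W\<close> onto \<open>W\<close>, which shows that the range is closed.\<close>

theorem drazin_invertible_if_dual: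
  fixes A :: "'a::complex_banach \<Rightarrow>\<^sub>\<complex> 'a"
  assumes "drazin_invertible (dual_operator A)"
  shows "drazin_invertible A"
proof -
  obtain p where p: "drazin_at (dual_operator A) p" using assms by (auto simp: drazin_invertible_def)
  obtain V where "\<And>f. cblinfun_apply V (dual_operator A f) = dual_operator A (V f)"
    "\<And>f. cblinfun_apply V (dual_operator A (V f)) = V f"
    and V: "\<And>f. (cblinfun_apply (dual_operator A) ^^ Suc p) (cblinfun_apply V f)
      = (cblinfun_apply (dual_operator A) ^^ p) f"
    using drazin_inverse[OF p] by blast
  let ?R = "range_power A p"
  define W where "W = closure ?R"
  have W: "complex_vector.subspace W" "closed W"
  proof -
    have "c *\<^sub>C x \<in> W" if "x \<in> W" for c x
    proof -
      have "bounded_linear (\<lambda>x::'a. c *\<^sub>C x)" using bounded_clinear_scaleC bounded_clinear_def by blast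
      then have "(\<lambda>x. c *\<^sub>C x) ` closure ?R \<subseteq> closure ((\<lambda>x. c *\<^sub>C x) ` ?R)"
        by (rule closure_bounded_linear_image_subset)
      also have "\<dots> \<subseteq> closure ?R"
        by (intro closure_mono) (use complex_vector.subspace_scale[OF subspace_range_power] in blast)
      finally show ?thesis using that by (auto simp: W_def)
    qed
    moreover have "x + y \<in> W" if "x \<in> W" "y \<in> W" for x y
    proof -
      obtain u w where u: "\<And>n. u n \<in> ?R" "u \<longlonglongrightarrow> x" and w: "\<And>n. w n \<in> ?R" "w \<longlonglongrightarrow> y"
        using \<open>x \<in> W\<close> \<open>y \<in> W\<close> unfolding W_def closure_sequential by blast
      have "\<And>n. u n + w n \<in> ?R"
        using u w by (intro complex_vector.subspace_add[OF subspace_range_power])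
      then show ?thesis
        unfolding W_def closure_sequential using tendsto_add[OF u(2) w(2)]
        by (intro exI[of _ "\<lambda>n. u n + w n"]) auto
    qed
    moreover have "0 \<in> W"
      unfolding W_def using complex_vector.subspace_0[OF subspace_range_power] closure_subset by blast
    ultimately show "complex_vector.subspace W"
      by (auto simp: complex_vector.subspace_def)
  qed (simp add: W_def)
  define c where "c = 1 / (norm V + 1)"
  have c0: "c > 0" by (simp add: c_def add_nonneg_pos)
  have "?R \<subseteq> {x. c * norm x \<le> norm (A x)}"
  proof
    fix y assume "y \<in> ?R"
    then obtain x where x: "y = (cblinfun_apply A ^^ p) x" by (auto simp: range_power_def)
    have "norm y \<le> norm V * norm (A y)"
      using funpow_bounded_below_if_dual_solvable[of p A V x, OF V] by (simp add: x)
    also have "\<dots> \<le> (norm V + 1) * norm (A y)" by (intro mult_right_mono) auto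
    finally show "y \<in> {x. c * norm x \<le> norm (A x)}"
      by (simp add: c_def add_nonneg_pos pos_divide_le_eq mult.commute)
  qed
  moreover have "closed {x. c * norm x \<le> norm (A x)}"
    by (intro closed_Collect_le continuous_intros continuous_on_norm continuous_on_cblinfun_apply)
  ultimately have below: "c * norm x \<le> norm (A x)" if "x \<in> W" for x
    using closure_minimal[of ?R "{x. c * norm x \<le> norm (A x)}"] that by (auto simp: W_def)
  have closure_invariant: "cblinfun_apply S ` W \<subseteq> W" if "cblinfun_apply S ` ?R \<subseteq> ?R" for S
    using closure_bounded_linear_image_subset[OF bounded_linear_cblinfun_apply[of S], of ?R]
      closure_mono[OF that] unfolding W_def by blast
  obtain r where r: "r > 0" "\<And>v. v \<noteq> 0 \<Longrightarrow> cmod v < r \<Longrightarrow> bij (cblinfun_apply (shifted (dual_operator A) v))"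
    using drazin_invertible_punctured_resolvent[OF assms] by blast
  have bijW: "bij_betw (shifted A v) W W" if bij: "bij (cblinfun_apply (shifted A v))" for v
  proof -
    obtain S where "S o\<^sub>C shifted A v = id_cblinfun" "shifted A v o\<^sub>C S = id_cblinfun"
      using bij_imp_inverse[OF bij] .
    then have S: "S (shifted A v x) = x" "shifted A v (S x) = x" for x
      by (metis cblinfun_compose.rep_eq id_cblinfun.rep_eq)+
    have R: "shifted A v ` ?R = ?R"
      using bij_betw_range_power_if_commute[OF shifted_commute bij] by (simp add: bij_betw_def)
    have "S ` ?R = S ` shifted A v ` ?R" by (simp only: R)
    then have "S ` ?R = ?R" by (simp add: image_image S)
    then show ?thesis
      using closure_invariant[of S] closure_invariant[of "shifted A v"] R S
      by (intro bij_betw_byWitness[where f' = "cblinfun_apply S"]) auto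
  qed
  have "bij_betw A W W"
  proof (rule bij_betw_if_bounded_below_limit[OF clinear_cblinfun_apply W c0 below])
    fix e :: real assume e: "e > 0"
    define v where "v = complex_of_real (min e r / 2)"
    have v: "v \<noteq> 0" "cmod v < e" "cmod v < r" using e r(1) by (auto simp: v_def min_def)
    have bij: "bij (cblinfun_apply (shifted A v))"
      using r(2)[OF v(1,3)] by (simp add: shifted_dual_operator bij_dual_operator_iff)
    then show "\<exists>v. cmod v < e \<and> bij_betw (\<lambda>x. A x - v *\<^sub>C x) W W"
      using bijW[OF bij] v(2) unfolding shifted_apply by blast
  qed
  then have bij: "bij_betw (cblinfun_apply A ^^ k) W W" for k
    by (induction k) (auto intro: bij_betw_trans simp: id_def[symmetric])
  have "W \<subseteq> ?R"
    using bij[of p] unfolding range_power_def bij_betw_def by blast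
  then have "W = ?R" using closure_subset[of ?R] by (auto simp: W_def)
  then have "drazin_at A p" using \<open>bij_betw A W W\<close> by (simp add: drazin_at_def)
  then show ?thesis by (auto simp: drazin_invertible_def)
qed

lemma weyl_if_finite_rank_correction:
  fixes A G :: "'a::complex_banach \<Rightarrow>\<^sub>\<complex> 'a"
  assumes bij: "bij (cblinfun_apply G)" and B: "finite B" "\<And>x. A x - G x \<in> complex_vector.span B"
  shows "weyl A"
proof -
  have fin: "finite_cdim (complex_vector.span B)" unfolding finite_cdim_def using B(1) by blast
  show ?thesis
    using fredholm_index_0_if_finite_rank_perturbation[OF clinear_cblinfun_apply clinear_cblinfun_apply
        complex_vector.subspace_UNIV complex_vector.subspace_span fin subset_UNIV bij B(2)]
    by (simp add: weyl_def)
qed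

lemma rank_one_sum_dual_apply:
  "f o\<^sub>C (\<Sum>b\<in>N. rank_one (w b) (\<phi> b)) = (\<Sum>b\<in>N. f (w b) *\<^sub>C \<phi> b)"
  by (rule cblinfun_eqI) (simp add: cblinfun_simps sum_cblinfun_apply cblinfun_linear_simps
      rank_one.rep_eq scaleC_complex_def mult.commute)

lemma weylE:
  fixes A :: "'a::complex_normed_vector \<Rightarrow>\<^sub>\<complex> 'a"
  assumes "weyl A"
  obtains N C \<pi> where "finite N" "complex_vector.independent N" "N \<subseteq> {x \<in> UNIV. A x = 0}"
      "{x \<in> UNIV. A x = 0} \<subseteq> complex_vector.span N" "finite_quotient_basis UNIV (range (cblinfun_apply A)) C"
      "bij_betw \<pi> N C"
proof -
  have F: "fredholm_on UNIV A" "index_on UNIV A = 0" using assms by (simp_all add: weyl_def)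
  obtain N C where N: "finite N" "complex_vector.independent N" "N \<subseteq> {x \<in> UNIV. A x = 0}"
      "{x \<in> UNIV. A x = 0} \<subseteq> complex_vector.span N" and C: "finite_quotient_basis UNIV (range (cblinfun_apply A)) C"
    and i: "index_on UNIV A = int (card N) - int (card C)"
    using fredholm_onE[OF complex_vector.subspace_UNIV clinear_cblinfun_apply F(1)] .
  have "finite C" "card N = card C" using C F(2) i by (auto simp: finite_quotient_basis_def)
  then obtain \<pi> where "bij_betw \<pi> N C" using finite_same_card_bij[OF N(1)] by blast
  then show ?thesis by (rule that[OF N C])
qed

text \<open>Adding an operator \<open>L\<close> of finite rank to make one side bijective makes the other side bijective,
too. Starting from \<open>A\<^sup>*\<close>, the correction has to be of the form \<open>L\<^sup>*\<close>; this is achieved by using points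
of the space, not elements of the bidual, as coordinates on the kernel of \<open>A\<^sup>*\<close>.\<close>

lemma weyl_dual_operator_iff:
  fixes A :: "'a::complex_banach \<Rightarrow>\<^sub>\<complex> 'a"
  shows "weyl (dual_operator A) \<longleftrightarrow> weyl A"
proof
  assume "weyl A"
  then obtain N C \<pi> where N: "finite N" "complex_vector.independent N" "N \<subseteq> {x \<in> UNIV. A x = 0}"
      "{x \<in> UNIV. A x = 0} \<subseteq> complex_vector.span N"
    and C: "finite_quotient_basis UNIV (range (cblinfun_apply A)) C" and pi: "bij_betw \<pi> N C"
    by (rule weylE)
  obtain \<phi> :: "'a \<Rightarrow> 'a \<Rightarrow>\<^sub>\<complex> complex"
    where phi: "\<And>b b'. b \<in> N \<Longrightarrow> b' \<in> N \<Longrightarrow> \<phi> b b' = (if b = b' then 1 else 0)"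
    using dual_functionals[OF N(1,2)] by blast
  define L where "L = (\<Sum>b\<in>N. rank_one (\<pi> b) (\<phi> b))"
  have "bij_betw (\<lambda>x. A x + (\<Sum>b\<in>N. cblinfun_apply (\<phi> b) x *\<^sub>C \<pi> b)) UNIV UNIV"
    by (rule bij_betw_finite_rank_correction[OF clinear_cblinfun_apply complex_vector.subspace_UNIV _
          N(1,3,4) C pi clinear_cblinfun_apply phi]) auto
  also have "(\<lambda>x. A x + (\<Sum>b\<in>N. cblinfun_apply (\<phi> b) x *\<^sub>C \<pi> b)) = cblinfun_apply (A + L)"
    by (auto simp: L_def cblinfun_simps sum_cblinfun_apply rank_one.rep_eq)
  finally have "bij (cblinfun_apply (dual_operator (A + L)))" by (rule bij_dual_operator)
  moreover have "dual_operator A f - dual_operator (A + L) f \<in> complex_vector.span (\<phi> ` N)" for f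
  proof -
    have "dual_operator A f - dual_operator (A + L) f = - (f o\<^sub>C L)"
      by (rule cblinfun_eqI) (simp add: dual_operator_apply cblinfun_simps cblinfun_linear_simps)
    also have "\<dots> \<in> complex_vector.span (\<phi> ` N)"
      unfolding L_def rank_one_sum_dual_apply
      by (intro complex_vector.span_neg complex_vector.span_sum complex_vector.span_scale
          complex_vector.span_base imageI)
    finally show ?thesis .
  qed
  ultimately show "weyl (dual_operator A)"
    using N(1) by (intro weyl_if_finite_rank_correction[where B = "\<phi> ` N"]) auto
next
  assume "weyl (dual_operator A)"
  then obtain N C \<pi> where N: "finite N" "complex_vector.independent N"
      "N \<subseteq> {f \<in> UNIV. dual_operator A f = 0}"
      "{f \<in> UNIV. dual_operator A f = 0} \<subseteq> complex_vector.span N"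
    and C: "finite_quotient_basis UNIV (range (cblinfun_apply (dual_operator A))) C"
    and pi: "bij_betw \<pi> N C"
    by (rule weylE)
  obtain x :: "('a \<Rightarrow>\<^sub>\<complex> complex) \<Rightarrow> 'a"
    where x: "\<And>f g. f \<in> N \<Longrightarrow> g \<in> N \<Longrightarrow> g (x f) = (if f = g then 1 else 0)"
    using dual_points[OF N(1,2)] by blast
  define L where "L = (\<Sum>f\<in>N. rank_one (x f) (\<pi> f))"
  have "bij_betw (\<lambda>g. dual_operator A g + (\<Sum>f\<in>N. cblinfun_apply g (x f) *\<^sub>C \<pi> f)) UNIV UNIV"
  proof (rule bij_betw_finite_rank_correction[OF clinear_cblinfun_apply complex_vector.subspace_UNIV _
          N(1,3,4) C pi])
    show "clinear (\<lambda>g. cblinfun_apply g (x f))" for f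
      by (rule clinearI) (simp_all add: cblinfun_simps)
    show "cblinfun_apply g (x f) = (if f = g then 1 else 0)" if "f \<in> N" "g \<in> N" for f g
      using x that by blast
  qed auto
  also have "(\<lambda>g. dual_operator A g + (\<Sum>f\<in>N. cblinfun_apply g (x f) *\<^sub>C \<pi> f))
      = cblinfun_apply (dual_operator (A + L))"
  proof
    fix g
    have "dual_operator (A + L) g = (g o\<^sub>C A) + (g o\<^sub>C L)"
      by (rule cblinfun_eqI) (simp add: dual_operator_apply cblinfun_simps cblinfun_linear_simps)
    then show "dual_operator A g + (\<Sum>f\<in>N. cblinfun_apply g (x f) *\<^sub>C \<pi> f) = dual_operator (A + L) g"
      by (simp add: L_def rank_one_sum_dual_apply dual_operator_apply)
  qed
  finally have "bij (cblinfun_apply (A + L))" by (rule bij_if_bij_dual_operator)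
  moreover have "A z - (A + L) z \<in> complex_vector.span (x ` N)" for z
  proof -
    have "A z - (A + L) z = - (\<Sum>f\<in>N. cblinfun_apply (\<pi> f) z *\<^sub>C x f)"
      by (simp add: L_def cblinfun_simps sum_cblinfun_apply rank_one.rep_eq)
    also have "\<dots> \<in> complex_vector.span (x ` N)"
      by (intro complex_vector.span_neg complex_vector.span_sum complex_vector.span_scale
          complex_vector.span_base imageI)
    finally show ?thesis .
  qed
  ultimately show "weyl A"
    using N(1) by (intro weyl_if_finite_rank_correction[where B = "x ` N"]) auto
qed

section \<open>The right multiplication operator\<close>

lemma large_independent_set:
  assumes "\<not> finite_cdim (UNIV :: 'a::complex_normed_vector set)"
  obtains I :: "'a::complex_normed_vector set" where "finite I" "complex_vector.independent I" "card I = k"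
proof -
  obtain B :: "'a set" where B: "complex_vector.independent B" "UNIV \<subseteq> complex_vector.span B"
    by (rule complex_vector.basis_exists[of "UNIV :: 'a set"])
  then have "infinite B" using assms by (auto simp: finite_cdim_def)
  then obtain I where "I \<subseteq> B" "finite I" "card I = k" using infinite_arbitrarily_large by blast
  then show ?thesis using that[of I] B complex_vector.independent_mono by blast
qed

text \<open>The operators \<open>rank_one x (f o\<^sub>C S\<^sup>n)\<close> lie in the range of \<open>R\<^sub>S\<^sup>n\<close>, for all vectors \<open>x\<close>. If one functional
\<open>f o\<^sub>C S\<^sup>n \<noteq> 0\<close> were annihilated by \<open>S\<^sup>*\<close>, all these operators would be annihilated by \<open>R\<^sub>S\<close>, and
if \<open>f o\<^sub>C S\<^sup>n\<close> were not in the range of \<open>S\<^sup>*\<^sup>n\<^sup>+\<^sup>1\<close>, they would be independent modulo the next range; both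
is impossible as \<open>x\<close> runs through an infinite dimensional space. So \<open>S\<^sup>*\<close> is injective on the range
of its \<open>n\<close>-th power and maps it onto itself.\<close>

theorem drazin_invertible_dual_if_b_fredholm_right_mult:
  fixes S :: "'a::complex_banach \<Rightarrow>\<^sub>\<complex> 'a"
  assumes inf: "\<not> finite_cdim (UNIV :: 'a set)" and "b_fredholm (right_mult S)"
  shows "drazin_invertible (dual_operator S)"
proof -
  obtain n where n: "b_fredholm_at (right_mult S) n" using assms(2) by (auto simp: b_fredholm_def)
  let ?P = "cblinfun_power S n" and ?P1 = "cblinfun_power S (Suc n)"
  let ?M = "range_power (right_mult S) n"
  have PS: "?P o\<^sub>C S = ?P1" by (simp add: cblinfun_power_commute)
  have M: "?M = {U o\<^sub>C ?P |U. True}" by (auto simp: range_power_def funpow_right_mult)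
  have RM: "right_mult S ` ?M = {U o\<^sub>C ?P1 |U. True}"
    unfolding image_range_power by (auto simp: range_power_def funpow_right_mult simp del: cblinfun_power.simps funpow.simps)
  have F: "fredholm_on ?M (right_mult S)" using n by (simp add: b_fredholm_at_def)
  have rank_one_M: "rank_one x (f o\<^sub>C ?P) \<in> ?M" for x :: 'a and f
    unfolding M rank_one_compose[symmetric] by blast
  have kernel: "f o\<^sub>C ?P = 0" if f: "f o\<^sub>C ?P1 = 0" for f :: "'a \<Rightarrow>\<^sub>\<complex> complex"
  proof (rule ccontr)
    assume "f o\<^sub>C ?P \<noteq> 0"
    then obtain z where z: "(f o\<^sub>C ?P) z \<noteq> 0"
      by (rule nonzero_value)
    obtain B where B: "finite B" "{U \<in> ?M. right_mult S U = 0} \<subseteq> complex_vector.span B"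
      using finite_cdim_kernel_if_fredholm_on[OF F] by (auto simp: finite_cdim_def)
    \<comment> \<open>Evaluation at \<open>z\<close> maps the operators \<open>rank_one x (f o\<^sub>C ?P)\<close>, all of which lie in the finite
      dimensional kernel, onto the whole space.\<close>
    define e where "e U = cblinfun_apply U z" for U :: "'a \<Rightarrow>\<^sub>\<complex> 'a"
    interpret e: Vector_Spaces.linear scaleC scaleC e
      by (rule clinearI) (simp_all add: e_def cblinfun_simps)
    have "x \<in> complex_vector.span (e ` B)" for x
    proof -
      have "right_mult S (rank_one x (f o\<^sub>C ?P)) = rank_one x (f o\<^sub>C ?P1)"
        by (simp only: right_mult_apply rank_one_compose cblinfun_compose_assoc PS)
      also have "\<dots> = 0"
        unfolding f by (rule cblinfun_eqI) (simp add: rank_one.rep_eq cblinfun_simps)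
      finally have "rank_one x (f o\<^sub>C ?P) \<in> complex_vector.span B"
        using rank_one_M B(2) by blast
      then have "e (rank_one x (f o\<^sub>C ?P)) \<in> complex_vector.span (e ` B)"
        unfolding e.span_image by blast
      moreover have "e (rank_one x (f o\<^sub>C ?P)) = (f o\<^sub>C ?P) z *\<^sub>C x"
        by (simp add: e_def rank_one.rep_eq)
      ultimately have "inverse ((f o\<^sub>C ?P) z) *\<^sub>C ((f o\<^sub>C ?P) z *\<^sub>C x) \<in> complex_vector.span (e ` B)"
        by (metis complex_vector.span_scale)
      then show ?thesis using z by (simp add: scaleC_scaleC)
    qed
    then show False using inf B(1) unfolding finite_cdim_def by blast
  qed
  have range: "f o\<^sub>C ?P \<in> range_power (dual_operator S) (Suc n)" for f :: "'a \<Rightarrow>\<^sub>\<complex> complex"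
  proof -
    let ?W = "right_mult S ` ?M"
    have W: "complex_vector.subspace ?W"
      unfolding image_range_power by (rule subspace_range_power)
    obtain C where C: "finite_quotient_basis ?M ?W C"
      by (rule fredholm_onE[OF subspace_range_power clinear_cblinfun_apply F])
    then have finC: "finite C" by (simp add: finite_quotient_basis_def)
    have "\<exists>a. rank_one x (f o\<^sub>C ?P) - (\<Sum>b\<in>C. a b *\<^sub>C b) \<in> ?W" for x
      using finite_quotient_basis_expansion[OF C rank_one_M[of x f]] .
    then have "\<exists>a. \<forall>x. rank_one x (f o\<^sub>C ?P) - (\<Sum>b\<in>C. a x b *\<^sub>C b) \<in> ?W"
      by (intro choice allI)
    then obtain a where "\<forall>x. rank_one x (f o\<^sub>C ?P) - (\<Sum>b\<in>C. a x b *\<^sub>C b) \<in> ?W" ..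
    then have a: "rank_one x (f o\<^sub>C ?P) - (\<Sum>b\<in>C. a x b *\<^sub>C b) \<in> ?W" for x ..
    define v where "v x = (\<Sum>b\<in>C. a x b *\<^sub>C b)" for x
    have v: "v x \<in> complex_vector.span C" for x
      unfolding v_def by (intro complex_vector.span_sum complex_vector.span_scale complex_vector.span_base)
    \<comment> \<open>More independent vectors \<open>x\<close> than the defect: some combination of the operators
      \<open>rank_one x (f o\<^sub>C ?P)\<close> falls into the range.\<close>
    obtain I :: "'a set" where I: "finite I" "complex_vector.independent I" "card I = Suc (card C)"
      using large_independent_set[OF inf] by blast
    have "\<not> (\<forall>d. (\<Sum>x\<in>I. d x *\<^sub>C v x) = 0 \<longrightarrow> (\<forall>x\<in>I. d x = 0))"
    proof
      assume "\<forall>d. (\<Sum>x\<in>I. d x *\<^sub>C v x) = 0 \<longrightarrow> (\<forall>x\<in>I. d x = 0)"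
      then have "card I \<le> card C" by (intro card_le_if_independent_family[of I C v] I(1) finC v) blast
      then show False using I(3) by simp
    qed
    then obtain d where d: "(\<Sum>x\<in>I. d x *\<^sub>C v x) = 0" "\<exists>x\<in>I. d x \<noteq> 0" by blast
    define y where "y = (\<Sum>x\<in>I. d x *\<^sub>C x)"
    have "y \<noteq> 0"
      using complex_vector.independent_explicit_finite_subsets[of I] I(1,2) d(2) by (auto simp: y_def)
    obtain \<phi> :: "'a \<Rightarrow>\<^sub>\<complex> complex" where phi: "\<phi> y = 1"
      using functional_eq_1[OF \<open>y \<noteq> 0\<close>] .
    have "(\<Sum>x\<in>I. d x *\<^sub>C (rank_one x (f o\<^sub>C ?P) - v x)) \<in> ?W"
      using a by (intro complex_vector.subspace_sum[OF W] complex_vector.subspace_scale[OF W])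
        (simp add: v_def)
    then have "rank_one y (f o\<^sub>C ?P) \<in> ?W"
      by (simp add: y_def rank_one_sum complex_vector.scale_right_diff_distrib sum_subtractf d(1))
    then obtain U where "rank_one y (f o\<^sub>C ?P) = U o\<^sub>C ?P1" unfolding RM by blast
    then have "\<phi> o\<^sub>C rank_one y (f o\<^sub>C ?P) = (\<phi> o\<^sub>C U) o\<^sub>C ?P1"
      by (simp only: cblinfun_compose_assoc)
    then have "f o\<^sub>C ?P = (cblinfun_apply (dual_operator S) ^^ Suc n) (\<phi> o\<^sub>C U)"
      by (simp only: compose_rank_one phi funpow_dual_operator complex_vector.scale_one)
    then show ?thesis unfolding range_power_def by blast
  qed
  have "drazin_at (dual_operator S) n"
    unfolding drazin_at_def bij_betw_def
  proof
    show "inj_on (dual_operator S) (range_power (dual_operator S) n)"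
    proof (rule inj_onI)
      fix g h assume "g \<in> range_power (dual_operator S) n" "h \<in> range_power (dual_operator S) n"
        and eq: "dual_operator S g = dual_operator S h"
      then obtain g' h' where gh: "g = g' o\<^sub>C ?P" "h = h' o\<^sub>C ?P"
        by (auto simp: range_power_def funpow_dual_operator)
      have sub: "(g' - h') o\<^sub>C B = (g' o\<^sub>C B) - (h' o\<^sub>C B)" for B :: "'a \<Rightarrow>\<^sub>\<complex> 'a"
        by (rule cblinfun_eqI) (simp add: cblinfun_simps)
      have "(g' - h') o\<^sub>C ?P1 = 0"
        using eq unfolding sub gh dual_operator_apply cblinfun_compose_assoc PS by simp
      then have "(g' - h') o\<^sub>C ?P = 0" by (rule kernel)
      then show "g = h" by (simp add: sub gh)
    qed
    show "dual_operator S ` range_power (dual_operator S) n = range_power (dual_operator S) n"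
      unfolding image_range_power
    proof
      show "range_power (dual_operator S) n \<subseteq> range_power (dual_operator S) (Suc n)"
        using range by (auto simp: range_power_def[of _ n] funpow_dual_operator)
    qed (rule range_power_Suc_subset)
  qed
  then show ?thesis by (auto simp: drazin_invertible_def)
qed

lemma b_weyl_right_mult_iff:
  fixes S :: "'a::complex_banach \<Rightarrow>\<^sub>\<complex> 'a"
  assumes "\<not> finite_cdim (UNIV :: 'a set)"
  shows "b_weyl (right_mult S) \<longleftrightarrow> drazin_invertible S"
  using drazin_invertible_dual_if_b_fredholm_right_mult[OF assms] drazin_invertible_if_dual
    drazin_invertible_dual_and_right_mult(2) b_weyl_if_drazin_invertible
  by (auto simp: b_weyl_def)

lemma spectrum_dual_and_right_mult:
  fixes A :: "'a::complex_banach \<Rightarrow>\<^sub>\<complex> 'a"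
  shows "spectrum (dual_operator A) = spectrum A" "spectrum (right_mult A) = spectrum A"
  by (auto simp: in_spectrum_iff shifted_dual_operator shifted_right_mult bij_dual_operator_iff
      bij_right_mult_iff)

lemma nullity_pos_iff: "0 < nullity T \<longleftrightarrow> (\<exists>x. x \<noteq> 0 \<and> T x = 0)"
proof -
  have "nullity T = 0 \<longleftrightarrow> {x \<in> UNIV. T x = 0} = {0}"
    unfolding nullity_def nullity_on_def
    by (rule ecdim_eq_0_iff) (simp add: cblinfun_apply_zero)
  then show ?thesis using cblinfun_apply_zero[of T] by (auto simp: zero_less_iff_neq_zero)
qed

text \<open>\<open>f \<mapsto> rank_one z f\<close> and \<open>U \<mapsto> f o\<^sub>C U\<close> carry kernel elements of \<open>S\<^sup>*\<close> to kernel elements of \<open>R\<^sub>S\<close> and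
back.\<close>

lemma E_set_right_mult:
  fixes A :: "'a::complex_banach \<Rightarrow>\<^sub>\<complex> 'a"
  shows "E_set (right_mult A) = E_set (dual_operator A)"
proof -
  have "(\<exists>U. U \<noteq> 0 \<and> right_mult S U = 0) \<longleftrightarrow> (\<exists>f. f \<noteq> 0 \<and> dual_operator S f = 0)"
    for S :: "'a \<Rightarrow>\<^sub>\<complex> 'a"
  proof
    assume "\<exists>U. U \<noteq> 0 \<and> right_mult S U = 0"
    then obtain U where "U \<noteq> 0 \<and> right_mult S U = 0" ..
    then have U: "U \<noteq> 0" "U o\<^sub>C S = 0"
      unfolding right_mult_apply by (rule conjunct1, rule conjunct2)
    obtain z where z: "U z \<noteq> 0" using nonzero_value[OF U(1)] .
    obtain f :: "'a \<Rightarrow>\<^sub>\<complex> complex" where f: "f (U z) = 1"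
      using functional_eq_1[OF z] .
    have "(f o\<^sub>C U) z \<noteq> 0" using f by (simp add: cblinfun_simps)
    then have "f o\<^sub>C U \<noteq> 0" by (rule nonzero_if_nonzero_value)
    moreover have "dual_operator S (f o\<^sub>C U) = 0"
      unfolding dual_operator_apply cblinfun_compose_assoc U(2)
      by (rule cblinfun_eqI) (simp add: cblinfun_simps cblinfun_linear_simps)
    ultimately show "\<exists>f. f \<noteq> 0 \<and> dual_operator S f = 0" by blast
  next
    assume "\<exists>f. f \<noteq> 0 \<and> dual_operator S f = 0"
    then obtain f where "f \<noteq> 0 \<and> dual_operator S f = 0" ..
    then have f: "f \<noteq> 0" "f o\<^sub>C S = 0"
      unfolding dual_operator_apply by (rule conjunct1, rule conjunct2)
    obtain z where z: "f z \<noteq> 0" using nonzero_value[OF f(1)] .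
    then have "z \<noteq> 0" by (auto simp: cblinfun_apply_zero)
    have "rank_one z f z \<noteq> 0" using z \<open>z \<noteq> 0\<close> by (simp add: rank_one.rep_eq)
    then have "rank_one z f \<noteq> 0" by (rule nonzero_if_nonzero_value)
    moreover have "right_mult S (rank_one z f) = 0"
      unfolding right_mult_apply rank_one_compose f(2)
      by (rule cblinfun_eqI) (simp add: rank_one.rep_eq cblinfun_simps)
    ultimately show "\<exists>U. U \<noteq> 0 \<and> right_mult S U = 0" by blast
  qed
  then show ?thesis
    by (simp only: E_set_def spectrum_dual_and_right_mult nullity_pos_iff shifted_right_mult
        shifted_dual_operator)
qed

section \<open>The equivalence\<close>

lemma resolvent_near_isolated_spectral_point:
  fixes T :: "'a::complex_banach \<Rightarrow>\<^sub>\<complex> 'a"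
  assumes "l isolated_in spectrum T" "e > 0"
  obtains v where "cmod v < e" "bij (cblinfun_apply (shifted (shifted T l) v))"
proof -
  obtain U where U: "open U" "U \<inter> spectrum T = {l}" using assms(1) by (auto simp: isolated_in_def)
  then obtain d where d: "d > 0" "ball l d \<subseteq> U" using open_contains_ball by blast
  define v where "v = complex_of_real (min e d / 2)"
  have v: "cmod v < e" "cmod v < d" "v \<noteq> 0" using assms(2) d(1) by (auto simp: v_def min_def)
  then have "l + v \<in> U" using d(2) by (auto simp: dist_norm)
  moreover have "l + v \<noteq> l" using v(3) by simp
  ultimately have "l + v \<notin> spectrum T" using U(2) by blast
  then show ?thesis using that[of v] v(1) by (simp add: in_spectrum_iff shifted_shifted)
qed

text \<open>A Drazin invertible operator of finite nullity is always Weyl, and points of the resolvent set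
belong to \<open>Pi0_set A\<close>; so only one inclusion carries information.\<close>

lemma browder_theorem_iff:
  fixes A :: "'a::complex_banach \<Rightarrow>\<^sub>\<complex> 'a"
  shows "browder_theorem A \<longleftrightarrow> (\<forall>l. weyl (shifted A l) \<longrightarrow> drazin_invertible (shifted A l))"
proof -
  have finite: "nullity S < \<infinity>" if "weyl S" for S :: "'a \<Rightarrow>\<^sub>\<complex> 'a"
    using that by (simp add: weyl_def fredholm_on_def nullity_def)
  have "drazin_invertible (shifted A l) \<and> nullity (shifted A l) < \<infinity>" if "l \<notin> spectrum A" for l
  proof -
    have bij: "bij (cblinfun_apply (shifted A l))" using that by (simp add: in_spectrum_iff)
    then have "\<not> 0 < nullity (shifted A l)"
      unfolding nullity_pos_iff using cblinfun_apply_zero[of "shifted A l"] by (metis bij_is_inj injD)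
    then show ?thesis using drazin_invertible_if_bij[OF bij] by simp
  qed
  then have "spectrum A - Pi0_set A
      = {l. \<not> (drazin_invertible (shifted A l) \<and> nullity (shifted A l) < \<infinity>)}"
    unfolding Pi0_set_def Pi_set_eq by blast
  then have "browder_theorem A \<longleftrightarrow> {l. \<not> weyl (shifted A l)}
      = {l. \<not> (drazin_invertible (shifted A l) \<and> nullity (shifted A l) < \<infinity>)}"
    by (simp only: browder_theorem_def weyl_spectrum_def)
  also have "\<dots> \<longleftrightarrow> (\<forall>l. weyl (shifted A l)
      \<longleftrightarrow> drazin_invertible (shifted A l) \<and> nullity (shifted A l) < \<infinity>)"
    by blast
  also have "\<dots> \<longleftrightarrow> (\<forall>l. weyl (shifted A l) \<longrightarrow> drazin_invertible (shifted A l))"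
    using weyl_if_drazin_invertible[of "shifted A _"] finite by blast
  finally show ?thesis .
qed

theorem theorem3p6:
  fixes A :: "'a::complex_banach \<Rightarrow>\<^sub>\<complex> 'a"
  assumes "\<not> finite_cdim (UNIV :: 'a set)"
  shows "generalized_weyl_theorem (dual_operator A) \<longleftrightarrow>
    generalized_weyl_theorem (right_mult A) \<and> browder_theorem A"
proof -
  let ?D = "\<lambda>l. drazin_invertible (shifted A l)"
  let ?B = "\<lambda>l. b_weyl (dual_operator (shifted A l))"
  let ?E = "E_set (dual_operator A)"
  have DB: "?B l" if "?D l" for l
    using that by (intro b_weyl_if_drazin_invertible drazin_invertible_dual_and_right_mult)
  have BD: "?D l" if "?B l"
    and near: "\<And>e. e > 0 \<Longrightarrow> \<exists>v. cmod v < e \<and> bij (cblinfun_apply (shifted A (l + v)))" for l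
  proof (rule drazin_invertible_if_dual)
    show "drazin_invertible (dual_operator (shifted A l))"
    proof (rule drazin_invertible_if_b_fredholm_and_resolvent_nearby)
      show "b_fredholm (dual_operator (shifted A l))" using \<open>?B l\<close> by (simp add: b_weyl_def)
      show "\<exists>v. cmod v < e \<and> bij (cblinfun_apply (shifted (dual_operator (shifted A l)) v))"
        if "e > 0" for e
        using near[OF that]
        by (simp add: shifted_dual_operator bij_dual_operator_iff shifted_shifted)
    qed
  qed
  have gwR: "generalized_weyl_theorem (right_mult A) \<longleftrightarrow> {l. \<not> ?D l} = spectrum A - ?E"
    by (simp add: generalized_weyl_theorem_def b_weyl_spectrum_def shifted_right_mult
        b_weyl_right_mult_iff[OF assms] E_set_right_mult spectrum_dual_and_right_mult)
  have gwD: "generalized_weyl_theorem (dual_operator A) \<longleftrightarrow> {l. \<not> ?B l} = spectrum A - ?E"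
    by (simp add: generalized_weyl_theorem_def b_weyl_spectrum_def shifted_dual_operator
        spectrum_dual_and_right_mult)
  show ?thesis
  proof
    assume gw: "generalized_weyl_theorem (dual_operator A)"
    have eq: "?B l \<longleftrightarrow> ?D l" for l
    proof
      assume B: "?B l"
      show "?D l"
      proof (cases "l \<in> spectrum A")
        case True
        then have "l \<in> ?E" using gw B unfolding gwD by blast
        then have iso: "l isolated_in spectrum A"
          by (simp add: E_set_def spectrum_dual_and_right_mult)
        show ?thesis
          by (rule BD[OF B]) (metis resolvent_near_isolated_spectral_point[OF iso] shifted_shifted)
      next
        case False
        then show ?thesis by (intro drazin_invertible_if_bij) (simp add: in_spectrum_iff)
      qed
    qed (rule DB)
    then have "generalized_weyl_theorem (right_mult A)" using gw unfolding gwD gwR by simp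
    moreover have "browder_theorem A"
      unfolding browder_theorem_iff
    proof (intro allI impI)
      fix l assume "weyl (shifted A l)"
      then have "weyl (dual_operator (shifted A l))" by (simp add: weyl_dual_operator_iff)
      then show "?D l" using b_weyl_if_weyl eq by blast
    qed
    ultimately show "generalized_weyl_theorem (right_mult A) \<and> browder_theorem A" ..
  next
    assume R: "generalized_weyl_theorem (right_mult A) \<and> browder_theorem A"
    have "?D l" if B: "?B l" for l
    proof -
      obtain c where c: "c > 0"
        "\<And>v. v \<noteq> 0 \<Longrightarrow> cmod v < c \<Longrightarrow> weyl (shifted (dual_operator (shifted A l)) v)"
        using b_weyl_punctured_weyl[OF B] by blast
      show ?thesis
      proof (rule BD[OF B])
        fix e :: real assume e: "e > 0"
        define v where "v = complex_of_real (min e c / 2)"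
        have v: "v \<noteq> 0" "cmod v < e" "cmod v < c" using e c(1) by (auto simp: v_def min_def)
        have "weyl (shifted A (l + v))"
          using c(2)[OF v(1,3)] by (simp add: shifted_dual_operator weyl_dual_operator_iff shifted_shifted)
        then have "?D (l + v)" using R by (simp add: browder_theorem_iff)
        then obtain d where d: "d > 0"
          "\<And>w. w \<noteq> 0 \<Longrightarrow> cmod w < d \<Longrightarrow> bij (cblinfun_apply (shifted (shifted A (l + v)) w))"
          using drazin_invertible_punctured_resolvent by blast
        \<comment> \<open>A resolvent point so close to \<open>l + v\<close> that it stays within distance \<open>e\<close> of \<open>l\<close>.\<close>
        define w where "w = complex_of_real (min d (e - cmod v) / 2)"
        have w: "w \<noteq> 0" "cmod w < d" "cmod w < e - cmod v" using d(1) v(2) by (auto simp: w_def min_def)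
        have "cmod (v + w) < e" using norm_triangle_ineq[of v w] w(3) by simp
        moreover have "bij (cblinfun_apply (shifted A (l + (v + w))))"
          using d(2)[OF w(1,2)] by (simp add: shifted_shifted add.assoc)
        ultimately show "\<exists>v. cmod v < e \<and> bij (cblinfun_apply (shifted A (l + v)))" by blast
      qed
    qed
    then have "?B l \<longleftrightarrow> ?D l" for l using DB by blast
    then show "generalized_weyl_theorem (dual_operator A)" using R unfolding gwD gwR by simp
  qed
qed

end
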